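(* Let $T_1,\dots,T_m$ be a set of metric trees and, for each $k=1,\dots,n$, let $C_k$ be a cycle. Suppose that all the cycles $C_k$ have different lengths. Let $G$ be a metric graph formed by iteratively attaching either a metric tree $T_i$ or a cycle $C_k$ along a vertex or an edge $e$ that satisfies the following property: for any cycle $C\subset G$ that intersects $e$, the lengths satisfy $|e|<\frac13|C|$. Then the first Betti number of $G$ equals the number of points of the form $(\lambda/2,\lambda)$ in $D^{\mathrm{VR}}_{4,1}(G)$.
   Context: A metric graph is the geometric realization of a finite one-dimensional simplicial complex with the shortest path distance induced by positive lengths $\ell_e$ on the edges. A metric tree is a metric graph that is a tree; a cycle $C_k$ is a metric graph homeomorphic to a circle. $|\cdot|$ denotes length. $G$ is built by ordering all the $T_i$ and $C_k$ (each used once), starting with the first, and successively gluing each next piece to the graph built so far by identifying a single vertex of the piece with a vertex, or a single edge of the piece with an edge $e$ of the same length, with the resulting graph given the shortest path metric. For a finite metric space $Y$ and $r\ge 0$, $\mathrm{VR}_r(Y)$ is the simplicial complex of nonempty subsets $\sigma\subset Y$ with $\mathrm{diam}(\sigma)\le r$. With a fixed coefficient field $\mathbb F$, the persistence module $r\mapsto\widetilde H_1(\mathrm{VR}_r(Y);\mathbb F)$ decomposes into finitely many interval modules on intervals $[b_\alpha,d_\alpha)$, and $\mathrm{dgm}_1^{\mathrm{VR}}(Y)$ is the multiset of points $(b_\alpha,d_\alpha)$. If $|Y|\le 4$ this diagram has at most one point. $D^{\mathrm{VR}}_{4,1}(G)$ is identified with the subset of $\mathbb R^2$ of all $(t_b,t_d)$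 such that $\mathrm{dgm}_1^{\mathrm{VR}}(X')=\{(t_b,t_d)\}$ for some $X'\subset G$ with $|X'|\le 4$ (the empty diagram is omitted by convention). *)

theory Defs
  imports "HOL-Analysis.Analysis" "HOL-Library.Multiset"
begin

section \<open>Metric graphs\<close>

text \<open>The combinatorial data of a metric graph: the vertices and edges of a simplicial complex of
  dimension at most one, and the edge lengths. The values of \<open>elen\<close> off the edge set are irrelevant.\<close>

record 'a mgraph =
  verts :: "'a set"
  edges :: "'a set set"
  elen :: "'a set \<Rightarrow> real"

definition graph_simplices :: "'a mgraph \<Rightarrow> 'a set set" where
  "graph_simplices G = (\<lambda>v. {v}) ` verts G \<union> edges G"

text \<open>The geometric realization, in barycentric coordinates. Its topology is the one induced by the
  product topology on functions.\<close>

definition support :: "('a \<Rightarrow> real) \<Rightarrow> 'a set" where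
  "support x = {v. x v \<noteq> 0}"

definition realization :: "'a mgraph \<Rightarrow> ('a \<Rightarrow> real) set" where
  "realization G = {x. (\<forall>v. 0 \<le> x v) \<and> support x \<in> graph_simplices G \<and> (\<Sum>v\<in>support x. x v) = 1}"

definition closed_edge :: "'a mgraph \<Rightarrow> 'a set \<Rightarrow> ('a \<Rightarrow> real) set" where
  "closed_edge G e = {x \<in> realization G. support x \<subseteq> e}"

text \<open>Length of the segment between two points of the closed edge \<open>e = {u, w}\<close>. There
  \<open>\<bar>x u - y u\<bar> = \<bar>x w - y w\<bar>\<close>, since both coordinate pairs sum to 1, which explains the factor 1/2.\<close>

definition segment_length :: "'a mgraph \<Rightarrow> 'a set \<Rightarrow> ('a \<Rightarrow> real) \<Rightarrow> ('a \<Rightarrow> real) \<Rightarrow> real" where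
  "segment_length G e x y = elen G e * ((\<Sum>v\<in>e. \<bar>x v - y v\<bar>) / 2)"

text \<open>\<open>graph_path G x y L\<close>: there is a path of length \<open>L\<close> from \<open>x\<close> to \<open>y\<close> made of finitely many
  segments, each inside one closed edge.\<close>

inductive graph_path :: "'a mgraph \<Rightarrow> ('a \<Rightarrow> real) \<Rightarrow> ('a \<Rightarrow> real) \<Rightarrow> real \<Rightarrow> bool"
  for G :: "'a mgraph" where
  refl: "x \<in> realization G \<Longrightarrow> graph_path G x x 0"
| step: "\<lbrakk> graph_path G x y L; e \<in> edges G; y \<in> closed_edge G e; z \<in> closed_edge G e \<rbrakk>
    \<Longrightarrow> graph_path G x z (L + segment_length G e y z)"

definition graph_dist :: "'a mgraph \<Rightarrow> ('a \<Rightarrow> real) \<Rightarrow> ('a \<Rightarrow> real) \<Rightarrow> real" where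
  "graph_dist G x y = Inf {L. graph_path G x y L}"

definition graph_length :: "'a mgraph \<Rightarrow> real" where
  "graph_length G = (\<Sum>e\<in>edges G. elen G e)"

text \<open>The last clause says that all shortest path distances are finite, i.e. that the graph is
  connected.\<close>

definition metric_graph :: "'a mgraph \<Rightarrow> bool" where
  "metric_graph G \<longleftrightarrow>
     finite (verts G) \<and> verts G \<noteq> {} \<and>
     (\<forall>e\<in>edges G. e \<subseteq> verts G \<and> card e = 2 \<and> 0 < elen G e) \<and>
     (\<forall>x\<in>realization G. \<forall>y\<in>realization G. \<exists>L. graph_path G x y L)"

definition metric_cycle :: "'a mgraph \<Rightarrow> bool" where
  "metric_cycle C \<longleftrightarrow> metric_graph C \<and> realization C homeomorphic sphere (0::complex) 1"

definition metric_subgraph :: "'a mgraph \<Rightarrow> 'a mgraph \<Rightarrow> bool" where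
  "metric_subgraph H G \<longleftrightarrow>
     verts H \<subseteq> verts G \<and> edges H \<subseteq> edges G \<and> (\<forall>e\<in>edges H. elen H e = elen G e)"

definition metric_tree :: "'a mgraph \<Rightarrow> bool" where
  "metric_tree T \<longleftrightarrow> metric_graph T \<and> \<not> (\<exists>C. metric_subgraph C T \<and> metric_cycle C)"

section \<open>Gluing\<close>

definition mgraph_iso :: "'a mgraph \<Rightarrow> 'a mgraph \<Rightarrow> bool" where
  "mgraph_iso G H \<longleftrightarrow> (\<exists>f. inj_on f (verts G) \<and> verts H = f ` verts G \<and>
     edges H = (\<lambda>e. f ` e) ` edges G \<and> (\<forall>e\<in>edges G. elen H (f ` e) = elen G e))"

definition mgraph_union :: "'a mgraph \<Rightarrow> 'a mgraph \<Rightarrow> 'a mgraph" where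
  "mgraph_union H P = \<lparr> verts = verts H \<union> verts P, edges = edges H \<union> edges P,
     elen = (\<lambda>e. if e \<in> edges H then elen H e else elen P e) \<rparr>"

text \<open>\<open>assembled Ps A G\<close>: \<open>G\<close> is obtained by gluing the pieces \<open>Ps\<close> in the order of the list, and
  \<open>A\<close> is the set of edges of \<open>G\<close> along which a gluing took place. The quotient that identifies a
  vertex or an edge is formed by replacing the piece with an isomorphic copy \<open>P'\<close> whose vertex set
  meets that of the graph built so far exactly in the identified vertex or edge. Both ways of
  identifying an edge with another one are covered, as the isomorphism is arbitrary.\<close>

inductive assembled :: "'a mgraph list \<Rightarrow> 'a set set \<Rightarrow> 'a mgraph \<Rightarrow> bool" where
  start: "mgraph_iso P P' \<Longrightarrow> assembled [P] {} P'"
| glue_vertex: "\<lbrakk> assembled Ps A H; mgraph_iso P P'; verts H \<inter> verts P' = {v} \<rbrakk>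
    \<Longrightarrow> assembled (Ps @ [P]) A (mgraph_union H P')"
| glue_edge: "\<lbrakk> assembled Ps A H; mgraph_iso P P'; verts H \<inter> verts P' = e;
      e \<in> edges H; e \<in> edges P'; elen H e = elen P' e \<rbrakk>
    \<Longrightarrow> assembled (Ps @ [P]) (insert e A) (mgraph_union H P')"

section \<open>Simplicial homology over a field\<close>

record ('f, 'm) vspace =
  vcarrier :: "'m set"
  vadd :: "'m \<Rightarrow> 'm \<Rightarrow> 'm"
  vscale :: "'f \<Rightarrow> 'm \<Rightarrow> 'm"

definition linear_iso :: "('m \<Rightarrow> 'n) \<Rightarrow> ('f, 'm) vspace \<Rightarrow> ('f, 'n) vspace \<Rightarrow> bool" where
  "linear_iso \<phi> V W \<longleftrightarrow> bij_betw \<phi> (vcarrier V) (vcarrier W) \<and>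
     (\<forall>x\<in>vcarrier V. \<forall>y\<in>vcarrier V. \<phi> (vadd V x y) = vadd W (\<phi> x) (\<phi> y)) \<and>
     (\<forall>a. \<forall>x\<in>vcarrier V. \<phi> (vscale V a x) = vscale W a (\<phi> x))"

text \<open>Oriented \<open>p\<close>-chains with coefficients in \<open>'f\<close>: alternating functions on the
  orderings of the \<open>p\<close>-simplices.\<close>

definition chains :: "nat \<Rightarrow> 'v set set \<Rightarrow> ('v list \<Rightarrow> 'f::field) set" where
  "chains p K = {c. (\<forall>xs. c xs \<noteq> 0 \<longrightarrow> length xs = Suc p \<and> distinct xs \<and> set xs \<in> K) \<and>
     (\<forall>xs u ys v zs. c (xs @ u # ys @ v # zs) = - c (xs @ v # ys @ u # zs))}"

text \<open>In terms of the coefficient functions, \<open>\<partial>[v\<^sub>0,\<dots>,v\<^sub>p] = \<Sum>\<^sub>i (-1)\<^sup>i [\<dots>,v\<^sub>i\<^sub>-\<^sub>1,v\<^sub>i\<^sub>+\<^sub>1,\<dots>]\<close> takes the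
  following form, because the vertex removed can be moved to the front. For \<open>p = 0\<close> the value at
  the empty list is the augmentation, so the homology below is reduced homology.\<close>

definition boundary :: "'v set set \<Rightarrow> ('v list \<Rightarrow> 'f::field) \<Rightarrow> 'v list \<Rightarrow> 'f" where
  "boundary K c = (\<lambda>xs. \<Sum>v\<in>\<Union>K. c (v # xs))"

definition cycles :: "nat \<Rightarrow> 'v set set \<Rightarrow> ('v list \<Rightarrow> 'f::field) set" where
  "cycles p K = {c \<in> chains p K. boundary K c = (\<lambda>xs. 0)}"

definition boundaries :: "nat \<Rightarrow> 'v set set \<Rightarrow> ('v list \<Rightarrow> 'f::field) set" where
  "boundaries p K = boundary K ` chains (Suc p) K"

definition chain_add :: "('v list \<Rightarrow> 'f::field) \<Rightarrow> ('v list \<Rightarrow> 'f) \<Rightarrow> 'v list \<Rightarrow> 'f" where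
  "chain_add c d = (\<lambda>xs. c xs + d xs)"

definition chain_scale :: "'f::field \<Rightarrow> ('v list \<Rightarrow> 'f) \<Rightarrow> 'v list \<Rightarrow> 'f" where
  "chain_scale a c = (\<lambda>xs. a * c xs)"

text \<open>The quotient of the cycles by the boundaries. A homology class is a coset of \<open>boundaries p K\<close>;
  adding the boundaries in \<open>vscale\<close> only matters for the scalar 0.\<close>

definition homology :: "nat \<Rightarrow> 'v set set \<Rightarrow> ('f::field, ('v list \<Rightarrow> 'f) set) vspace" where
  "homology p K = \<lparr>
     vcarrier = (\<lambda>z. chain_add z ` boundaries p K) ` cycles p K,
     vadd = (\<lambda>X Y. {chain_add x y | x y. x \<in> X \<and> y \<in> Y}),
     vscale = (\<lambda>a X. {chain_add (chain_scale a x) b | x b. x \<in> X \<and> b \<in> boundaries p K}) \<rparr>"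

text \<open>The map into the homology of a larger complex \<open>L\<close> that is induced by the inclusion.\<close>

definition homology_inclusion ::
  "nat \<Rightarrow> 'v set set \<Rightarrow> ('v list \<Rightarrow> 'f::field) set \<Rightarrow> ('v list \<Rightarrow> 'f) set" where
  "homology_inclusion p L X = {chain_add x b | x b. x \<in> X \<and> b \<in> boundaries p L}"

definition coordinate_space :: "nat \<Rightarrow> ('f::field, nat \<Rightarrow> 'f) vspace" where
  "coordinate_space n = \<lparr> vcarrier = {c. \<forall>i\<ge>n. c i = 0},
     vadd = (\<lambda>c d i. c i + d i), vscale = (\<lambda>a c i. a * c i) \<rparr>"

text \<open>Reduced and unreduced homology agree in degree 1, and the rank of the first integral homology
  is the dimension of the first rational homology.\<close>

definition betti1 :: "'a mgraph \<Rightarrow> nat" where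
  "betti1 G = (THE n. \<exists>\<phi>. linear_iso \<phi>
     (homology 1 (graph_simplices G) :: (rat, ('a list \<Rightarrow> rat) set) vspace) (coordinate_space n))"

section \<open>Persistence modules and Vietoris-Rips persistence diagrams\<close>

text \<open>Persistence modules indexed by the reals \<open>r \<ge> 0\<close>; \<open>pm_map V r s\<close> is the structure map from
  index \<open>r\<close> to index \<open>s \<ge> r\<close>.\<close>

record ('f, 'm) pmodule =
  pm_space :: "real \<Rightarrow> ('f, 'm) vspace"
  pm_map :: "real \<Rightarrow> real \<Rightarrow> 'm \<Rightarrow> 'm"

definition pmodule_isomorphic :: "('f, 'm) pmodule \<Rightarrow> ('f, 'n) pmodule \<Rightarrow> bool" where
  "pmodule_isomorphic V W \<longleftrightarrow> (\<exists>\<phi>.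
     (\<forall>r\<ge>0. linear_iso (\<phi> r) (pm_space V r) (pm_space W r)) \<and>
     (\<forall>r s. 0 \<le> r \<and> r \<le> s \<longrightarrow>
        (\<forall>x\<in>vcarrier (pm_space V r). \<phi> s (pm_map V r s x) = pm_map W r s (\<phi> r x))))"

text \<open>The direct sum of the interval modules on \<open>[b, d)\<close> for \<open>(b, d)\<close> in the list; coordinate \<open>i\<close>
  belongs to the \<open>i\<close>-th entry.\<close>

definition interval_sum :: "(real \<times> real) list \<Rightarrow> ('f::field, nat \<Rightarrow> 'f) pmodule" where
  "interval_sum bars = \<lparr>
     pm_space = (\<lambda>r. \<lparr>
       vcarrier = {c. \<forall>i. c i \<noteq> 0 \<longrightarrow> i < length bars \<and> r \<in> {fst (bars ! i)..<snd (bars ! i)}},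
       vadd = (\<lambda>c d i. c i + d i),
       vscale = (\<lambda>a c i. a * c i) \<rparr>),
     pm_map = (\<lambda>r s c i. if i < length bars \<and> s \<in> {fst (bars ! i)..<snd (bars ! i)} then c i else 0) \<rparr>"

definition vr_complex :: "('p \<Rightarrow> 'p \<Rightarrow> real) \<Rightarrow> 'p set \<Rightarrow> real \<Rightarrow> 'p set set" where
  "vr_complex d Y r = {\<sigma>. \<sigma> \<noteq> {} \<and> \<sigma> \<subseteq> Y \<and> (\<forall>x\<in>\<sigma>. \<forall>y\<in>\<sigma>. d x y \<le> r)}"

definition vr_module ::
  "nat \<Rightarrow> ('p \<Rightarrow> 'p \<Rightarrow> real) \<Rightarrow> 'p set \<Rightarrow> ('f::field, ('p list \<Rightarrow> 'f) set) pmodule" where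
  "vr_module k d Y = \<lparr>
     pm_space = (\<lambda>r. homology k (vr_complex d Y r)),
     pm_map = (\<lambda>r s. homology_inclusion k (vr_complex d Y s)) \<rparr>"

text \<open>\<open>vr_diagram F k d Y M\<close>: \<open>M\<close> is the degree \<open>k\<close> Vietoris-Rips persistence diagram, with
  coefficients in the field \<open>'f\<close>, of the finite metric space \<open>Y\<close> with distance \<open>d\<close>.\<close>

definition vr_diagram ::
  "'f::field itself \<Rightarrow> nat \<Rightarrow> ('p \<Rightarrow> 'p \<Rightarrow> real) \<Rightarrow> 'p set \<Rightarrow> (real \<times> real) multiset \<Rightarrow> bool" where
  "vr_diagram F k d Y M \<longleftrightarrow> (\<exists>bars. mset bars = M \<and>
     (\<forall>(b, t)\<in>set bars. 0 \<le> b \<and> b < t) \<and>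
     pmodule_isomorphic (vr_module k d Y :: ('f, ('p list \<Rightarrow> 'f) set) pmodule) (interval_sum bars))"

text \<open>The set \<open>D\<^sub>n\<^sub>,\<^sub>k\<close> of the metric space \<open>X\<close> with distance \<open>d\<close>, for parameters such that the
  diagrams have at most one point (such as \<open>n = 4\<close> and \<open>k = 1\<close>), as a set of points of the plane.\<close>

definition vr_persistence_set ::
  "'f::field itself \<Rightarrow> nat \<Rightarrow> nat \<Rightarrow> ('p \<Rightarrow> 'p \<Rightarrow> real) \<Rightarrow> 'p set \<Rightarrow> (real \<times> real) set" where
  "vr_persistence_set F n k d X =
     {(tb, td). \<exists>X'\<subseteq>X. finite X' \<and> card X' \<le> n \<and> vr_diagram F k d X' {#(tb, td)#}}"

end

theory Submission
  imports Defs "HOL-Library.Function_Algebras"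
begin

text \<open>A point \<open>(l / 2, l)\<close> of the persistence set comes from four points that form a 4-cycle whose sides
  all have length \<open>l / 2\<close> and whose diagonals both have length \<open>l\<close>; every other flag complex on at most
  four vertices can be dismantled and has no homology in degree 1. A glued tree grows leaf by leaf, and a
  glued cycle is an ear, a path attached at the vertex or at the two endpoints of the gluing edge. A leaf
  creates neither a circulation nor such a square. An ear raises the Betti number by one, and the only
  new squares are the quadruples of equally spaced points on its cycle. The latter uses that a gluing
  edge \<open>e\<close> is short: the distances of any point off \<open>e\<close> to the endpoints of \<open>e\<close> differ by exactly
  \<open>\<bar>e\<bar>\<close> or sum to more than \<open>2 \<bar>e\<bar>\<close>, and this persists under further gluings. As the cycles have
  different lengths, different ears give different points.\<close>

section \<open>The shortest path distance\<close>

text \<open>The distance is an infimum over edge paths: upper bounds come from explicit paths, lower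
  bounds from potentials, functions that grow along a segment of an edge by at most its length.
  Extending potentials from the old graph across the new path gives exact distance formulas, and
  squares become a matter of linear arithmetic.

  The bound of one third enters as follows. On a circle of length \<open>l\<close> with an edge of
  length \<open>c\<close>, a point off the edge either passes the edge on a shortest route to one
  endpoint, or its distances to the endpoints sum to \<open>l - c\<close>; and
  \<open>l - c > 2 * c\<close> says exactly \<open>c < l / 3\<close>. The alternatives in
  \<open>short_edges\<close> are this statement freed from the circle. They speak of distances
  alone, so an induction can carry them, and it does so from the moment an edge appears, as the
  gluing along it may come later.

  A circle of length \<open>l\<close> has a square of side \<open>l / 4\<close>, hence the point
  \<open>(l / 4, l / 2)\<close>. Two translations frame the argument: a topological circle is
  recognised as a polygon, and the Betti number, a definite description, needs a coordinate map and
  the uniqueness of dimension.\<close>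

definition wf_graph :: "'a mgraph \<Rightarrow> bool" where
  "wf_graph G \<longleftrightarrow> finite (verts G) \<and> verts G \<noteq> {} \<and>
     (\<forall>e\<in>edges G. e \<subseteq> verts G \<and> card e = 2 \<and> 0 < elen G e)"

lemma metric_graph_iff:
  "metric_graph G \<longleftrightarrow>
     wf_graph G \<and> (\<forall>x\<in>realization G. \<forall>y\<in>realization G. \<exists>L. graph_path G x y L)"
  by (auto simp: metric_graph_def wf_graph_def)

lemma metric_graph_wf: "metric_graph G \<Longrightarrow> wf_graph G"
  by (simp add: metric_graph_iff)

lemma wf_graph_edgeD:
  assumes "wf_graph G" "{u, w} \<in> edges G"
  shows "u \<noteq> w" "u \<in> verts G" "w \<in> verts G" "0 < elen G {u, w}"
proof -
  have "{u, w} \<subseteq> verts G \<and> card {u, w} = 2 \<and> 0 < elen G {u, w}"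
    using assms unfolding wf_graph_def by blast
  then show "u \<noteq> w" "u \<in> verts G" "w \<in> verts G" "0 < elen G {u, w}" by auto
qed

lemma wf_graph_edge_cases:
  assumes "wf_graph G" "e \<in> edges G"
  obtains u w where "e = {u, w}" "u \<noteq> w" "u \<in> verts G" "w \<in> verts G" "0 < elen G e"
proof -
  have e: "e \<subseteq> verts G \<and> card e = 2 \<and> 0 < elen G e"
    using assms unfolding wf_graph_def by blast
  then obtain u w where "e = {u, w}" "u \<noteq> w" by (auto simp: card_2_iff)
  with e show ?thesis using that by auto
qed

section \<open>Points of the realization in barycentric coordinates\<close>

definition vertex_point :: "'a \<Rightarrow> 'a \<Rightarrow> real" where
  "vertex_point u = (\<lambda>v. if v = u then 1 else 0)"

definition edge_point :: "'a \<Rightarrow> 'a \<Rightarrow> real \<Rightarrow> 'a \<Rightarrow> real" where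
  "edge_point u w t = (\<lambda>v. if v = u then 1 - t else if v = w then t else 0)"

lemma edge_point_0 [simp]: "edge_point u w 0 = vertex_point u"
  by (auto simp: edge_point_def vertex_point_def)

lemma edge_point_1 [simp]: "u \<noteq> w \<Longrightarrow> edge_point u w 1 = vertex_point w"
  by (auto simp: edge_point_def vertex_point_def)

lemma edge_point_flip: "u \<noteq> w \<Longrightarrow> edge_point u w t = edge_point w u (1 - t)"
  by (auto simp: edge_point_def)

lemma support_vertex_point [simp]: "support (vertex_point v) = {v}"
  by (auto simp: support_def vertex_point_def)

lemma support_edge_point: "0 < t \<Longrightarrow> t < 1 \<Longrightarrow> support (edge_point u w t) = {u, w}"
  by (auto simp: support_def edge_point_def)

lemma vertex_point_inject [simp]: "vertex_point u = vertex_point v \<longleftrightarrow> u = v"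
  by (metis support_vertex_point singleton_inject)

lemma vertex_point_in_realization [simp]:
  assumes "wf_graph G"
  shows "vertex_point v \<in> realization G \<longleftrightarrow> v \<in> verts G"
proof -
  have "{v} \<notin> edges G"
    using assms by (fastforce simp: wf_graph_def)
  moreover have "\<forall>x. 0 \<le> vertex_point v x" "vertex_point v v = 1"
    by (simp_all add: vertex_point_def)
  ultimately show ?thesis
    by (auto simp: realization_def graph_simplices_def)
qed

lemma edge_point_in_realization:
  assumes "wf_graph G" "{u, w} \<in> edges G" "0 \<le> t" "t \<le> 1"
  shows "edge_point u w t \<in> realization G"
proof -
  note e = wf_graph_edgeD[OF assms(1,2)]
  consider "t = 0" | "t = 1" | "0 < t" "t < 1" using assms by linarith
  then show ?thesis
  proof cases
    case 3
    then have s: "support (edge_point u w t) = {u, w}" by (rule support_edge_point)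
    have "(\<Sum>v\<in>{u, w}. edge_point u w t v) = 1" using e by (simp add: edge_point_def)
    moreover have "0 \<le> edge_point u w t v" for v using 3 by (simp add: edge_point_def)
    ultimately show ?thesis using assms(2) by (simp add: realization_def graph_simplices_def s)
  qed (use assms e in auto)
qed

lemma closed_edge_eq:
  assumes "wf_graph G" "{u, w} \<in> edges G"
  shows "closed_edge G {u, w} = edge_point u w ` {0..1}"
proof (intro set_eqI iffI)
  note e = wf_graph_edgeD[OF assms(1,2)]
  fix x assume x: "x \<in> closed_edge G {u, w}"
  then have s: "support x \<subseteq> {u, w}" and nn: "\<And>v. 0 \<le> x v" and sum: "(\<Sum>v\<in>support x. x v) = 1"
    by (auto simp: closed_edge_def realization_def)
  have "(\<Sum>v\<in>support x. x v) = (\<Sum>v\<in>{u, w}. x v)"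
    using s by (intro sum.mono_neutral_left) (auto simp: support_def)
  then have uw: "x u + x w = 1" using sum e by simp
  have "x = edge_point u w (x w)"
  proof
    fix v
    have "x v = 0" if "v \<notin> {u, w}" using s that by (auto simp: support_def)
    moreover have "x u = 1 - x w" using uw by linarith
    ultimately show "x v = edge_point u w (x w) v" by (auto simp: edge_point_def)
  qed
  moreover have "x w \<in> {0..1}" using uw nn[of u] nn[of w] by auto
  ultimately show "x \<in> edge_point u w ` {0..1}" by blast
next
  fix x assume "x \<in> edge_point u w ` {0..1}"
  then obtain t where "x = edge_point u w t" "0 \<le> t" "t \<le> 1" by auto
  then show "x \<in> closed_edge G {u, w}"
    using edge_point_in_realization[OF assms, of t]
    by (auto simp: closed_edge_def support_def edge_point_def split: if_splits)
qed

lemma vertex_point_in_closed_edge: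
  assumes "wf_graph G" "e \<in> edges G"
  shows "vertex_point v \<in> closed_edge G e \<longleftrightarrow> v \<in> e"
proof -
  have "e \<subseteq> verts G" using assms by (auto simp: wf_graph_def)
  then show ?thesis using assms(1) by (auto simp: closed_edge_def)
qed

lemma realization_cases:
  assumes "wf_graph G" "x \<in> realization G"
  obtains (vertex) v where "v \<in> verts G" "x = vertex_point v"
  | (edge) u w t where "{u, w} \<in> edges G" "0 < t" "t < 1" "x = edge_point u w t"
proof -
  have "support x \<in> graph_simplices G" "(\<Sum>v\<in>support x. x v) = 1"
    using assms by (auto simp: realization_def)
  then consider v where "v \<in> verts G" "support x = {v}" | "support x \<in> edges G"
    by (auto simp: graph_simplices_def)
  then show ?thesis
  proof cases
    case 1
    then have "x = vertex_point v"
      using \<open>(\<Sum>v\<in>support x. x v) = 1\<close> by (auto simp: vertex_point_def support_def fun_eq_iff)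
    then show ?thesis using 1 vertex by blast
  next
    case 2
    then obtain u w where uw: "support x = {u, w}" "u \<noteq> w"
      using assms(1) by (metis wf_graph_edge_cases)
    then have "x \<in> closed_edge G {u, w}" using assms(2) by (simp add: closed_edge_def)
    then obtain t where t: "x = edge_point u w t" "t \<in> {0..1}"
      using closed_edge_eq[OF assms(1)] 2 uw by auto
    have "t \<noteq> 0" "t \<noteq> 1" using t uw by auto
    then show ?thesis using t 2 uw edge[of u w t] by auto
  qed
qed

lemma closed_edge_subset_realization: "closed_edge G e \<subseteq> realization G"
  by (auto simp: closed_edge_def)

section \<open>Paths, and the distance as an infimum of their lengths\<close>

lemma segment_length_edge_point:
  assumes "u \<noteq> w"
  shows "segment_length G {u, w} (edge_point u w s) (edge_point u w t) = elen G {u, w} * \<bar>s - t\<bar>"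
  using assms by (simp add: segment_length_def edge_point_def abs_minus_commute)

lemma segment_length_sym: "segment_length G e x y = segment_length G e y x"
  by (simp add: segment_length_def abs_minus_commute)

lemma segment_length_nonneg: "wf_graph G \<Longrightarrow> e \<in> edges G \<Longrightarrow> 0 \<le> segment_length G e x y"
  by (auto simp: segment_length_def wf_graph_def sum_nonneg less_imp_le)

lemma graph_path_realization:
  assumes "graph_path G x y L"
  shows "x \<in> realization G" "y \<in> realization G"
  using assms by (induction rule: graph_path.induct) (auto simp: closed_edge_def)

lemma graph_path_nonneg: "graph_path G x y L \<Longrightarrow> wf_graph G \<Longrightarrow> 0 \<le> L"
  by (induction rule: graph_path.induct) (auto simp: segment_length_nonneg)

lemma graph_path_trans:
  assumes "graph_path G y z M" "graph_path G x y L"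
  shows "graph_path G x z (L + M)"
  using assms
proof (induction rule: graph_path.induct)
  case (step x' y' L' e z)
  then show ?case using graph_path.step[of G x y' "L + L'" e z] by (simp add: add.assoc)
qed simp

lemma graph_path_segment:
  assumes "e \<in> edges G" "y \<in> closed_edge G e" "z \<in> closed_edge G e"
  shows "graph_path G y z (segment_length G e y z)"
proof -
  have "y \<in> realization G" using assms closed_edge_subset_realization by blast
  from graph_path.step[OF graph_path.refl[OF this] assms] show ?thesis by simp
qed

lemma graph_path_sym: "graph_path G x y L \<Longrightarrow> graph_path G y x L"
proof (induction rule: graph_path.induct)
  case (step x y L e z)
  have "graph_path G z y (segment_length G e y z)"
    using graph_path_segment[OF step.hyps(2,4,3)] by (subst segment_length_sym)
  from graph_path_trans[OF step.IH this] show ?case by (subst add.commute)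
qed (rule graph_path.refl)

lemma graph_path_mono:
  assumes "graph_path H x y L" "wf_graph H" "wf_graph G" "metric_subgraph H G"
  shows "graph_path G x y L"
proof -
  have real: "realization H \<subseteq> realization G"
    using assms(4) by (auto simp: realization_def graph_simplices_def metric_subgraph_def)
  show ?thesis using assms(1)
  proof (induction rule: graph_path.induct)
    case (refl x)
    then show ?case using real by (auto intro: graph_path.refl)
  next
    case (step x y L e z)
    have e: "e \<in> edges G" "elen G e = elen H e"
      using step.hyps assms(4) by (auto simp: metric_subgraph_def)
    have "y \<in> closed_edge G e" "z \<in> closed_edge G e"
      using step.hyps real by (auto simp: closed_edge_def)
    from graph_path.step[OF step.IH e(1) this]
    have "graph_path G x z (L + segment_length G e y z)" .
    then show ?case by (simp add: segment_length_def e)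
  qed
qed

lemma graph_dist_le: "wf_graph G \<Longrightarrow> graph_path G x y L \<Longrightarrow> graph_dist G x y \<le> L"
  unfolding graph_dist_def by (rule cInf_lower) (auto intro!: bdd_belowI[of _ 0] graph_path_nonneg)

lemma graph_dist_ge:
  assumes "metric_graph G" "x \<in> realization G" "y \<in> realization G"
    and "\<And>L. graph_path G x y L \<Longrightarrow> c \<le> L"
  shows "c \<le> graph_dist G x y"
  unfolding graph_dist_def using assms by (intro cInf_greatest) (auto simp: metric_graph_iff)

lemma graph_dist_approx:
  assumes "metric_graph G" "x \<in> realization G" "y \<in> realization G" "0 < \<epsilon>"
  obtains L where "graph_path G x y L" "L < graph_dist G x y + \<epsilon>"
proof -
  have "\<not> (graph_dist G x y + \<epsilon> \<le> graph_dist G x y)" using assms by simp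
  then show ?thesis using graph_dist_ge[OF assms(1-3)] that by (meson not_le)
qed

lemma graph_dist_nonneg:
  assumes "metric_graph G" "x \<in> realization G" "y \<in> realization G"
  shows "0 \<le> graph_dist G x y"
  by (rule graph_dist_ge[OF assms]) (use assms metric_graph_wf graph_path_nonneg in blast)

lemma graph_dist_refl:
  assumes "metric_graph G" "x \<in> realization G"
  shows "graph_dist G x x = 0"
  using graph_dist_nonneg[OF assms assms(2)]
    graph_dist_le[OF metric_graph_wf[OF assms(1)] graph_path.refl[OF assms(2)]] by linarith

lemma graph_dist_sym: "graph_dist G x y = graph_dist G y x"
proof -
  have "graph_path G x y = graph_path G y x" by (auto intro: graph_path_sym)
  then show ?thesis by (simp add: graph_dist_def)
qed

lemma graph_dist_triangle:
  assumes "metric_graph G" "x \<in> realization G" "y \<in> realization G" "z \<in> realization G"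
  shows "graph_dist G x z \<le> graph_dist G x y + graph_dist G y z"
proof (rule field_le_epsilon)
  fix \<epsilon> :: real assume "0 < \<epsilon>"
  then have e: "0 < \<epsilon> / 2" by simp
  obtain L where L: "graph_path G x y L" "L < graph_dist G x y + \<epsilon> / 2"
    using graph_dist_approx[OF assms(1-3) e] .
  obtain M where M: "graph_path G y z M" "M < graph_dist G y z + \<epsilon> / 2"
    using graph_dist_approx[OF assms(1,3,4) e] .
  show "graph_dist G x z \<le> graph_dist G x y + graph_dist G y z + \<epsilon>"
    using graph_dist_le[OF metric_graph_wf[OF assms(1)] graph_path_trans[OF M(1) L(1)]] L M by linarith
qed

text \<open>Summing over the segments bounds the rise of a potential by the length of the path. As
  \<open>graph_dist\<close> is an infimum, this is how it is bounded from below.\<close>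

lemma graph_path_potential:
  assumes "graph_path G x y L"
    and "\<And>e y z. e \<in> edges G \<Longrightarrow> y \<in> closed_edge G e \<Longrightarrow> z \<in> closed_edge G e
      \<Longrightarrow> f z - f y \<le> segment_length G e y z"
  shows "f y - f x \<le> L"
  using assms(1)
proof (induction rule: graph_path.induct)
  case (step x y L e z)
  then show ?case using assms(2)[of e y z] by linarith
qed simp

lemma graph_dist_potential:
  assumes "metric_graph G" "x \<in> realization G" "y \<in> realization G"
    and "\<And>e y z. e \<in> edges G \<Longrightarrow> y \<in> closed_edge G e \<Longrightarrow> z \<in> closed_edge G e
      \<Longrightarrow> f z - f y \<le> segment_length G e y z"
  shows "f y - f x \<le> graph_dist G x y"
  by (rule graph_dist_ge[OF assms(1-3)]) (rule graph_path_potential[OF _ assms(4)])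

lemma graph_dist_edge_point_le:
  assumes "wf_graph G" "{u, w} \<in> edges G" "s \<in> {0..1}" "t \<in> {0..1}"
  shows "graph_dist G (edge_point u w s) (edge_point u w t) \<le> elen G {u, w} * \<bar>s - t\<bar>"
proof -
  have "graph_path G (edge_point u w s) (edge_point u w t)
      (segment_length G {u, w} (edge_point u w s) (edge_point u w t))"
    using assms by (intro graph_path_segment) (auto simp: closed_edge_eq)
  then show ?thesis
    using graph_dist_le[OF assms(1)] segment_length_edge_point wf_graph_edgeD[OF assms(1,2)] by metis
qed

lemma graph_path_split:
  assumes "graph_path G x y L" "wf_graph G" "0 \<le> r" "r \<le> L"
  shows "\<exists>z. graph_path G x z r \<and> graph_path G z y (L - r)"
  using assms
proof (induction arbitrary: r rule: graph_path.induct)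
  case (refl x)
  then have "r = 0" by simp
  then show ?case using refl graph_path.refl[of x G] by auto
next
  case (step x y L e z)
  note hyps = step.hyps and wf = step.prems(1)
  show ?case
  proof (cases "r \<le> L")
    case True
    then obtain m where "graph_path G x m r" "graph_path G m y (L - r)"
      using step.IH step.prems by blast
    then show ?thesis
      using graph_path.step[OF _ hyps(2-4), of m "L - r"] by (auto simp: algebra_simps)
  next
    case False
    obtain u w where e: "e = {u, w}" "u \<noteq> w" "0 < elen G e"
      using wf_graph_edge_cases[OF wf hyps(2)] by metis
    obtain s t where st: "y = edge_point u w s" "z = edge_point u w t" "s \<in> {0..1}" "t \<in> {0..1}"
      using hyps(2-4) closed_edge_eq[OF wf, of u w] unfolding e(1) by auto
    have seg: "segment_length G e (edge_point u w a) (edge_point u w b) = elen G e * \<bar>a - b\<bar>" for a b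
      using segment_length_edge_point e by metis
    have pos: "0 < elen G e * \<bar>s - t\<bar>" using step.prems False seg st by auto
    \<comment> \<open>The fraction of the last segment at which arc length \<open>r\<close> is
      reached; the denominator is positive because \<open>L < r\<close>.\<close>
    define k where "k = (r - L) / (elen G e * \<bar>s - t\<bar>)"
    have k: "0 \<le> k" "k \<le> 1" "k * (elen G e * \<bar>s - t\<bar>) = r - L"
      using step.prems False seg st pos by (auto simp: k_def divide_simps)
    define q where "q = s + k * (t - s)"
    have "(1 - k) * s + k * t \<in> {0..1}"
      using k st convex_bound_le[of s 1 t "1 - k" k] by auto
    then have q: "q \<in> {0..1}" by (simp add: q_def algebra_simps)
    define m where "m = edge_point u w q"
    have m: "m \<in> closed_edge G e" using closed_edge_eq[OF wf, of u w] hyps(2) q unfolding e(1) m_def by auto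
    have "\<bar>s - q\<bar> = k * \<bar>s - t\<bar>" using k by (simp add: q_def abs_mult abs_minus_commute)
    then have 1: "segment_length G e y m = r - L"
      using k(3) by (simp add: seg st m_def mult.left_commute)
    have "q - t = (1 - k) * (s - t)" by (simp add: q_def algebra_simps)
    then have "\<bar>q - t\<bar> = \<bar>1 - k\<bar> * \<bar>s - t\<bar>" by (simp only: abs_mult)
    then have "\<bar>q - t\<bar> = \<bar>s - t\<bar> - k * \<bar>s - t\<bar>" using k by (simp add: left_diff_distrib)
    then have 2: "segment_length G e m z = segment_length G e y z - (r - L)"
      using k(3) by (simp add: seg st m_def right_diff_distrib mult.left_commute)
    have "graph_path G x m r"
      using graph_path.step[OF hyps(1,2,3) m] 1 by simp
    moreover have "graph_path G m z (L + segment_length G e y z - r)"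
      using graph_path_segment[OF hyps(2) m hyps(4)] 2 by (simp add: algebra_simps)
    ultimately show ?thesis by blast
  qed
qed

text \<open>An almost shortest path is cut in the middle. The error term stays because the infimum
  is not shown to be attained; strict inequalities absorb it later.\<close>

lemma approximate_midpoint:
  assumes "metric_graph G" "x \<in> realization G" "y \<in> realization G" "0 < \<epsilon>"
  obtains z where "z \<in> realization G"
    "graph_dist G x z \<le> graph_dist G x y / 2 + \<epsilon>" "graph_dist G z y \<le> graph_dist G x y / 2 + \<epsilon>"
proof -
  have wf: "wf_graph G" using assms metric_graph_wf by blast
  obtain L where L: "graph_path G x y L" "L < graph_dist G x y + \<epsilon>"
    using graph_dist_approx[OF assms] .
  have "0 \<le> L" using graph_path_nonneg L wf by blast
  then obtain z where z: "graph_path G x z (L / 2)" "graph_path G z y (L - L / 2)"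
    using graph_path_split[OF L(1) wf, of "L / 2"] by auto
  show ?thesis
  proof (rule that)
    show "z \<in> realization G" using graph_path_realization z by blast
  qed (use z[THEN graph_dist_le[OF wf]] L assms(4) in auto)
qed

text \<open>If no edge left \<open>S\<close>, the total barycentric weight on \<open>S\<close> would
  be constant on each closed edge and so along every path; but it is 1 at a vertex of
  \<open>S\<close> and 0 at a vertex outside.\<close>

lemma crossing_edge:
  assumes "metric_graph G" "S \<subseteq> verts G" "S \<noteq> {}" "S \<noteq> verts G"
  obtains u w where "{u, w} \<in> edges G" "u \<in> S" "w \<in> verts G - S"
proof (rule ccontr)
  assume "\<not> thesis"
  then have no: "\<And>u w. {u, w} \<in> edges G \<Longrightarrow> u \<in> S \<Longrightarrow> w \<in> verts G \<Longrightarrow> w \<in> S" using that by blast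
  have wf: "wf_graph G" using assms metric_graph_wf by blast
  then have fin: "finite S" using assms finite_subset by (auto simp: wf_graph_def)
  obtain a b where ab: "a \<in> S" "b \<in> verts G" "b \<notin> S" using assms by blast
  define f :: "('a \<Rightarrow> real) \<Rightarrow> real" where "f x = - (\<Sum>v\<in>S. x v)" for x
  obtain L where L: "graph_path G (vertex_point a) (vertex_point b) L"
    using assms(1,2) ab vertex_point_in_realization[OF wf] unfolding metric_graph_iff by blast
  have f: "f x = f y" if "e \<in> edges G" "x \<in> closed_edge G e" "y \<in> closed_edge G e" for e x y
  proof -
    note eG = that(1)
    obtain u w where e: "e = {u, w}" "u \<noteq> w" "u \<in> verts G" "w \<in> verts G"
      using wf_graph_edge_cases[OF wf eG] by metis
    have "(\<Sum>v\<in>S. x v) = (if u \<in> S then 1 else 0)" if "x \<in> closed_edge G e" for x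
    proof -
      obtain t where t: "x = edge_point u w t"
        using \<open>x \<in> closed_edge G e\<close> closed_edge_eq[OF wf, of u w] \<open>e \<in> edges G\<close> e by auto
      have both: "u \<in> S \<longleftrightarrow> w \<in> S" using no e \<open>e \<in> edges G\<close> by (metis insert_commute)
      show ?thesis
      proof (cases "u \<in> S")
        case True
        then have "(\<Sum>v\<in>S. x v) = (\<Sum>v\<in>{u, w}. x v)"
          using both fin t by (intro sum.mono_neutral_right) (auto simp: edge_point_def)
        then show ?thesis using True e t by (simp add: edge_point_def)
      next
        case False
        then have "(\<Sum>v\<in>S. x v) = 0"
          using both t by (intro sum.neutral) (auto simp: edge_point_def)
        then show ?thesis using False by simp
      qed
    qed
    then show ?thesis using that by (simp add: f_def)
  qed
  have "f y = f x" if "graph_path G x y L" for x y L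
    using that
  proof (induction rule: graph_path.induct)
    case (step x y L e z)
    then show ?case using f[of e y z] by simp
  qed simp
  then have "f (vertex_point a) = f (vertex_point b)" using L by metis
  moreover have "f (vertex_point a) = -1" "f (vertex_point b) = 0"
    using ab fin by (auto simp: f_def vertex_point_def)
  ultimately show False by simp
qed

section \<open>Attaching a path to a metric graph\<close>

text \<open>The distance from a fixed point is itself a potential. On \<open>H\<close> it is the
  seed of all potentials that are extended to \<open>G\<close>.\<close>

lemma graph_dist_edge_le_segment_length:
  assumes "metric_graph G" "e \<in> edges G" "x \<in> realization G" "y \<in> closed_edge G e" "z \<in> closed_edge G e"
  shows "graph_dist G x z - graph_dist G x y \<le> segment_length G e y z"
  using graph_dist_le[OF metric_graph_wf[OF assms(1)] graph_path_segment[OF assms(2,4,5)]]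
    graph_dist_triangle[OF assms(1,3), of y z] assms closed_edge_subset_realization by fastforce

lemma metric_subgraph_realization: "metric_subgraph H G \<Longrightarrow> realization H \<subseteq> realization G"
  by (auto simp: realization_def graph_simplices_def metric_subgraph_def)

lemma metric_subgraph_closed_edge:
  assumes "metric_subgraph H G" "wf_graph H" "wf_graph G" "e \<in> edges H"
  shows "closed_edge H e = closed_edge G e"
proof -
  obtain u w where "e = {u, w}" using wf_graph_edge_cases[OF assms(2,4)] by metis
  then show ?thesis using assms by (auto simp: metric_subgraph_def closed_edge_eq)
qed

text \<open>The interior vertices of the path are new. Its first vertex \<open>p 0\<close> lies in \<open>H\<close>, and its last
  vertex \<open>p n\<close> is either new, or in \<open>H\<close> and then possibly equal to \<open>p 0\<close>.\<close>

locale attached_path =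
  fixes H G :: "'a mgraph" and p :: "nat \<Rightarrow> 'a" and n :: nat
  assumes H: "metric_graph H" and sub: "metric_subgraph H G" and n: "0 < n"
    and p0: "p 0 \<in> verts H" and inj: "inj_on p {1..<n}" and new: "p ` {1..<n} \<inter> verts H = {}"
    and pn: "p n \<in> verts H \<or> p n \<notin> p ` {1..<n}"
    and vG: "verts G = verts H \<union> p ` {1..n}"
    and eG: "edges G = edges H \<union> (\<lambda>i. {p i, p (Suc i)}) ` {..<n}"
    and pos: "\<And>i. i < n \<Longrightarrow> 0 < elen G {p i, p (Suc i)}"
    and n2: "p n \<in> verts H \<Longrightarrow> 2 \<le> n" and n3: "p n = p 0 \<Longrightarrow> 3 \<le> n"
begin

definition step_len where "step_len i = elen G {p i, p (Suc i)}"
definition pos_of where "pos_of i = (\<Sum>j<i. step_len j)"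
definition total where "total = pos_of n"
text \<open>Position by arc length from \<open>p 0\<close>. It is a relation because the path may be
  closed: then its base vertex has both parameters, 0 and \<open>total\<close>.\<close>

definition path_at where
  "path_at x t \<longleftrightarrow>
    (\<exists>i \<theta>. i < n \<and> 0 \<le> \<theta> \<and> \<theta> \<le> 1 \<and>
      x = edge_point (p i) (p (Suc i)) \<theta> \<and> t = pos_of i + \<theta> * step_len i)"

lemma new_verts: "i < n \<Longrightarrow> 0 < i \<Longrightarrow> p i \<notin> verts H"
  using new by (auto simp: disjoint_iff)

lemma new_inj:
  assumes "i \<le> n" "j \<le> n" "p i = p j" "p i \<notin> verts H"
  shows "i = j"
proof -
  have ij: "0 < i" "0 < j" using assms p0 by (metis neq0_conv)+
  consider "i < n" "j < n" | "i = n" "j = n" | "i = n" "j < n" | "i < n" "j = n"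
    using assms by linarith
  then show ?thesis
  proof cases
    case 1 then show ?thesis using inj assms ij by (auto simp: inj_on_def)
  next
    case 3
    then have "p j \<in> p ` {1..<n}" using ij by auto
    then show ?thesis using pn assms 3 by auto
  next
    case 4
    then have "p i \<in> p ` {1..<n}" using ij by auto
    then show ?thesis using pn assms 4 by auto
  qed simp
qed

text \<open>A closed path has at least two edges by \<open>n2\<close>, so no edge of it runs between
  vertices of \<open>H\<close>. This keeps path edges apart from the edges of \<open>H\<close> and
  from each other.\<close>

lemma endpoint_new:
  assumes "i < n"
  shows "p i \<notin> verts H \<or> p (Suc i) \<notin> verts H"
proof (cases "i = 0")
  case True
  then show ?thesis using n2 new_verts[of 1] assms by (cases "n = 1") auto
qed (use new_verts assms in auto)

lemma p_neq: "i < n \<Longrightarrow> p i \<noteq> p (Suc i)"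
  using endpoint_new[of i] new_inj[of i "Suc i"] by auto

lemma in_H_cases: "i \<le> n \<Longrightarrow> p i \<in> verts H \<Longrightarrow> i = 0 \<or> i = n"
  using new_verts[of i] by linarith

lemma path_edge_inj:
  assumes "i < n" "j < n" "{p i, p (Suc i)} = {p j, p (Suc j)}"
  shows "i = j"
proof (rule ccontr)
  assume ne: "i \<noteq> j"
  \<comment> \<open>Two path edges that agree with reversed direction would make the path run along
    one edge and back, \<open>p 2 = p 0\<close> with \<open>n = 2\<close>, which \<open>n3\<close>
    excludes.\<close>
  have *: False if "i < n" "j < n" "p i = p (Suc j)" "p (Suc i) = p j" "p i \<notin> verts H" for i j
  proof -
    have "i = Suc j" using new_inj that by auto
    moreover have "p (Suc i) \<in> verts H"
      using new_inj[of "Suc i" j] that calculation by auto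
    ultimately have "Suc i = n" "j = 0" using in_H_cases[of "Suc i"] in_H_cases[of j] that by auto
    then show False using n3 that \<open>i = Suc j\<close> by auto
  qed
  consider "p i = p j" "p (Suc i) = p (Suc j)" | "p i = p (Suc j)" "p (Suc i) = p j"
    using assms(3) by (auto simp: doubleton_eq_iff)
  then show False
  proof cases
    case 1
    then show False
      using endpoint_new[OF assms(1)] new_inj[of i j] new_inj[of "Suc i" "Suc j"] assms ne by auto
  next
    case 2
    then show False using endpoint_new[OF assms(1)] *[of i j] *[of j i] assms by auto
  qed
qed

lemma wf_H: "wf_graph H"
  using H by (rule metric_graph_wf)

lemma wf_G: "wf_graph G"
proof -
  have "finite (verts G)" "verts G \<noteq> {}" using wf_H vG by (auto simp: wf_graph_def)
  moreover have "e \<subseteq> verts G \<and> card e = 2 \<and> 0 < elen G e" if "e \<in> edges G" for e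
  proof (cases "e \<in> edges H")
    case True
    then show ?thesis using wf_H sub by (auto simp: wf_graph_def metric_subgraph_def)
  next
    case False
    then obtain i where i: "i < n" "e = {p i, p (Suc i)}"
      using \<open>e \<in> edges G\<close> unfolding eG by blast
    moreover have "p i \<in> verts G"
      using vG p0 i by (cases i) auto
    moreover have "p (Suc i) \<in> verts G" using vG i by auto
    ultimately show ?thesis using p_neq pos by auto
  qed
  ultimately show ?thesis by (auto simp: wf_graph_def)
qed

lemma path_edge: "i < n \<Longrightarrow> {p i, p (Suc i)} \<in> edges G"
  using eG by auto

lemma path_edge_not_H: "i < n \<Longrightarrow> {p i, p (Suc i)} \<notin> edges H"
  using endpoint_new[of i] wf_graph_edgeD[OF wf_H] by blast

lemma step_len_pos: "i < n \<Longrightarrow> 0 < step_len i"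
  using pos by (simp add: step_len_def)

lemma pos_of_0 [simp]: "pos_of 0 = 0"
  by (simp add: pos_of_def)

lemma pos_of_Suc: "pos_of (Suc i) = pos_of i + step_len i"
  by (simp add: pos_of_def)

lemma pos_of_mono: "i \<le> j \<Longrightarrow> j \<le> n \<Longrightarrow> pos_of i \<le> pos_of j"
  unfolding pos_of_def using step_len_pos by (intro sum_mono2) (auto simp: less_imp_le)

lemma pos_of_strict_mono:
  assumes "i < j" "j \<le> n"
  shows "pos_of i < pos_of j"
  using pos_of_mono[of "Suc i" j] step_len_pos[of i] assms by (simp add: pos_of_Suc)

lemma total_pos: "0 < total"
  using pos_of_strict_mono[of 0 n] n by (simp add: total_def)

lemma path_at_range:
  assumes "path_at x t"
  shows "0 \<le> t" "t \<le> total"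
proof -
  obtain i \<theta> where i: "i < n" "0 \<le> \<theta>" "\<theta> \<le> 1" "t = pos_of i + \<theta> * step_len i"
    using assms by (auto simp: path_at_def)
  have "0 \<le> \<theta> * step_len i" "\<theta> * step_len i \<le> step_len i"
    using i step_len_pos[of i] by (auto intro: mult_left_le_one_le)
  moreover have "0 \<le> pos_of i" "pos_of i + step_len i \<le> total"
    using pos_of_mono[of 0 i] pos_of_mono[of "Suc i" n] i by (auto simp: total_def pos_of_Suc)
  ultimately show "0 \<le> t" "t \<le> total" using i by linarith+
qed

lemma path_at_realization: "path_at x t \<Longrightarrow> x \<in> realization G"
  using edge_point_in_realization[OF wf_G path_edge] by (auto simp: path_at_def)

lemma path_at_edge_point:
  "i < n \<Longrightarrow> 0 \<le> \<theta> \<Longrightarrow> \<theta> \<le> 1 \<Longrightarrow>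
    path_at (edge_point (p i) (p (Suc i)) \<theta>) (pos_of i + \<theta> * step_len i)"
  unfolding path_at_def by blast

lemma path_at_vertex: "i \<le> n \<Longrightarrow> path_at (vertex_point (p i)) (pos_of i)"
proof (cases "i = n")
  case True
  then obtain m where "i = Suc m" "m < n" using n by (metis Suc_pred lessI)
  then show ?thesis using path_at_edge_point[of m 1] p_neq by (simp add: pos_of_Suc)
next
  case False
  moreover assume "i \<le> n"
  ultimately show ?thesis using path_at_edge_point[of i 0] by simp
qed

lemma path_at_cases:
  assumes "path_at x t"
  obtains (vertex) i where "i \<le> n" "x = vertex_point (p i)" "t = pos_of i"
  | (edge) i \<theta> where "i < n" "0 < \<theta>" "\<theta> < 1" "x = edge_point (p i) (p (Suc i)) \<theta>"
      "t = pos_of i + \<theta> * step_len i"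
proof -
  obtain i \<theta> where i: "i < n" "0 \<le> \<theta>" "\<theta> \<le> 1" "x = edge_point (p i) (p (Suc i)) \<theta>"
      "t = pos_of i + \<theta> * step_len i"
    using assms by (auto simp: path_at_def)
  consider "\<theta> = 0" | "\<theta> = 1" | "0 < \<theta>" "\<theta> < 1" using i by linarith
  then show ?thesis
  proof cases
    case 1 then show ?thesis using vertex[of i] i by auto
  next
    case 2 then show ?thesis using vertex[of "Suc i"] i p_neq[of i] by (auto simp: pos_of_Suc)
  next
    case 3 then show ?thesis using edge[of i \<theta>] i by auto
  qed
qed

lemma support_H: "x \<in> realization H \<Longrightarrow> support x \<subseteq> verts H"
  using wf_H by (auto simp: realization_def graph_simplices_def wf_graph_def)

lemma path_at_in_H:
  assumes "path_at x t" "x \<in> realization H"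
  shows "t = 0 \<and> x = vertex_point (p 0) \<or>
    t = total \<and> x = vertex_point (p n) \<and> p n \<in> verts H"
  using assms(1)
proof (cases rule: path_at_cases)
  case (vertex i)
  then show ?thesis using in_H_cases[of i] assms(2) wf_H by (auto simp: total_def)
next
  case (edge i \<theta>)
  then have "support x = {p i, p (Suc i)}" by (simp add: support_edge_point)
  then show ?thesis using support_H[OF assms(2)] endpoint_new[of i] edge by auto
qed

lemma path_at_unique:
  assumes "path_at x t" "path_at x t'" "x \<notin> realization H"
  shows "t = t'"
  using assms(1)
proof (cases rule: path_at_cases)
  case (vertex i)
  note v = this
  show ?thesis using assms(2)
  proof (cases rule: path_at_cases)
    case (vertex j)
    then show ?thesis using v assms(3) wf_H new_inj[of i j] by auto
  next
    case (edge j \<theta>)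
    then have "support x = {p j, p (Suc j)}" by (auto simp: support_edge_point)
    then show ?thesis using v p_neq[of j] edge by auto
  qed
next
  case (edge i \<theta>)
  note e = this
  then have sx: "support x = {p i, p (Suc i)}" by (auto simp: support_edge_point)
  show ?thesis using assms(2)
  proof (cases rule: path_at_cases)
    case (vertex j)
    then show ?thesis using sx p_neq[of i] e by auto
  next
    case (edge j \<theta>')
    then have "support x = {p j, p (Suc j)}" by (auto simp: support_edge_point)
    then have "i = j" using path_edge_inj sx e edge by metis
    moreover have "x (p (Suc i)) = \<theta>" using e p_neq[of i] by (simp add: edge_point_def)
    moreover have "x (p (Suc j)) = \<theta>'" using edge p_neq[of j] by (simp add: edge_point_def)
    ultimately show ?thesis using e edge by simp
  qed
qed

lemma path_at_exists:
  assumes "0 \<le> t" "t \<le> total"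
  obtains x where "path_at x t"
proof -
  have "\<exists>x. path_at x t" if "m \<le> n" "0 \<le> t" "t \<le> pos_of m" for m
    using that
  proof (induction m)
    case 0
    then show ?case using path_at_vertex[of 0] by auto
  next
    case (Suc m)
    show ?case
    proof (cases "t \<le> pos_of m")
      case False
      define \<theta> where "\<theta> = (t - pos_of m) / step_len m"
      have "0 \<le> \<theta>" "\<theta> \<le> 1" "t = pos_of m + \<theta> * step_len m"
        using False Suc.prems step_len_pos[of m] by (auto simp: \<theta>_def pos_of_Suc divide_simps)
      then show ?thesis using path_at_edge_point[of m \<theta>] Suc.prems by auto
    qed (use Suc in auto)
  qed
  then show ?thesis using assms that by (auto simp: total_def)
qed

lemma realization_G_cases:
  assumes "x \<in> realization G"
  shows "x \<in> realization H \<or> (\<exists>t. path_at x t)"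
  using wf_G assms
proof (cases rule: realization_cases)
  case (vertex v)
  show ?thesis
  proof (cases "v \<in> verts H")
    case True
    then show ?thesis using vertex wf_H by simp
  next
    case False
    then obtain i where "i \<le> n" "v = p i" using vertex vG by auto
    then show ?thesis using path_at_vertex vertex by blast
  qed
next
  case (edge u w t)
  show ?thesis
  proof (cases "{u, w} \<in> edges H")
    case True
    then show ?thesis using edge_point_in_realization[OF wf_H True, of t] edge by auto
  next
    case False
    then obtain i where i: "i < n" "{u, w} = {p i, p (Suc i)}" using edge eG by auto
    then have "x = edge_point (p i) (p (Suc i)) t \<or> x = edge_point (p i) (p (Suc i)) (1 - t)"
      using edge edge_point_flip[of u w t] p_neq[of i] by (auto simp: doubleton_eq_iff)
    then show ?thesis using path_at_edge_point[of i t] path_at_edge_point[of i "1 - t"] i edge by auto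
  qed
qed

lemma path_at_in_closed_edge:
  assumes "path_at x t" "i < n" "pos_of i \<le> t" "t \<le> pos_of (Suc i)"
  shows "x \<in> closed_edge G {p i, p (Suc i)}"
  using assms(1)
proof (cases rule: path_at_cases)
  case (vertex j)
  have "\<not> j < i" using vertex pos_of_strict_mono[of j i] assms by auto
  moreover have "\<not> Suc i < j" using vertex pos_of_strict_mono[of "Suc i" j] assms by auto
  ultimately have "j = i \<or> j = Suc i" by auto
  then show ?thesis
    using vertex vertex_point_in_closed_edge[OF wf_G path_edge[OF assms(2)]] by auto
next
  case (edge j \<theta>)
  have t: "pos_of j < t" "t < pos_of (Suc j)"
    using edge step_len_pos[of j] by (auto simp: pos_of_Suc)
  have "\<not> j < i" using t pos_of_mono[of "Suc j" i] edge assms by auto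
  moreover have "\<not> i < j" using t pos_of_mono[of "Suc i" j] edge assms by auto
  ultimately have "j = i" by auto
  then show ?thesis using closed_edge_eq[OF wf_G path_edge[OF assms(2)]] edge by auto
qed

lemma closed_edge_path_at:
  assumes "i < n" "x \<in> closed_edge G {p i, p (Suc i)}"
  obtains \<theta> where "0 \<le> \<theta>" "\<theta> \<le> 1" "x = edge_point (p i) (p (Suc i)) \<theta>"
    "path_at x (pos_of i + \<theta> * step_len i)"
  using assms closed_edge_eq[OF wf_G path_edge[OF assms(1)]] path_at_edge_point[OF assms(1)] by auto

text \<open>A potential on \<open>H\<close> and a 1-Lipschitz function of arc length fit together as
  soon as they agree where the path is attached, because each edge of \<open>G\<close> lies entirely
  in \<open>H\<close> or in the path.\<close>

lemma potential_extension:
  assumes fH: "\<And>e y z. e \<in> edges H \<Longrightarrow> y \<in> closed_edge H e \<Longrightarrow> z \<in> closed_edge H e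
      \<Longrightarrow> fH z - fH y \<le> segment_length H e y z"
    and g: "\<And>t t'. 0 \<le> t \<Longrightarrow> t \<le> total \<Longrightarrow> 0 \<le> t' \<Longrightarrow> t' \<le> total \<Longrightarrow> g t' - g t \<le> \<bar>t - t'\<bar>"
    and 0: "fH (vertex_point (p 0)) = g 0"
    and 1: "p n \<in> verts H \<Longrightarrow> fH (vertex_point (p n)) = g total"
  obtains f where "\<And>x. x \<in> realization H \<Longrightarrow> f x = fH x" "\<And>x t. path_at x t \<Longrightarrow> f x = g t"
    "\<And>e y z. e \<in> edges G \<Longrightarrow> y \<in> closed_edge G e \<Longrightarrow> z \<in> closed_edge G e
      \<Longrightarrow> f z - f y \<le> segment_length G e y z"
proof -
  \<comment> \<open>Off \<open>H\<close> the parameter is unique, so any choice is the right one; at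
    the ends the two prescriptions agree by \<open>0\<close> and \<open>1\<close>.\<close>
  define f where "f x = (if x \<in> realization H then fH x else g (SOME t. path_at x t))" for x
  have fg: "f x = g t" if "path_at x t" for x t
  proof (cases "x \<in> realization H")
    case True
    then show ?thesis using path_at_in_H[OF that True] 0 1 by (auto simp: f_def)
  next
    case False
    have "path_at x (SOME t. path_at x t)" using that by (rule someI)
    then show ?thesis using path_at_unique[OF that _ False] False by (simp add: f_def)
  qed
  moreover have "f z - f y \<le> segment_length G e y z"
    if e: "e \<in> edges G" "y \<in> closed_edge G e" "z \<in> closed_edge G e" for e y z
  proof (cases "e \<in> edges H")
    case True
    have ce: "closed_edge G e = closed_edge H e"
      using metric_subgraph_closed_edge[OF sub wf_H wf_G True] by simp
    have "segment_length G e y z = segment_length H e y z"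
      using sub True by (auto simp: segment_length_def metric_subgraph_def)
    moreover have "y \<in> realization H" "z \<in> realization H"
      using e ce closed_edge_subset_realization by blast+
    ultimately show ?thesis using fH[OF True] e ce by (auto simp: f_def)
  next
    case False
    then obtain i where i: "i < n" "e = {p i, p (Suc i)}" using e eG by auto
    obtain a where a: "y = edge_point (p i) (p (Suc i)) a" "path_at y (pos_of i + a * step_len i)"
      using closed_edge_path_at[OF i(1)] e i by metis
    obtain b where b: "z = edge_point (p i) (p (Suc i)) b" "path_at z (pos_of i + b * step_len i)"
      using closed_edge_path_at[OF i(1)] e i by metis
    have "f z - f y \<le> \<bar>(pos_of i + a * step_len i) - (pos_of i + b * step_len i)\<bar>"
      using g[of "pos_of i + a * step_len i" "pos_of i + b * step_len i"]
        path_at_range[OF a(2)] path_at_range[OF b(2)] fg[OF a(2)] fg[OF b(2)] by simp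
    also have "\<dots> = \<bar>(a - b) * step_len i\<bar>" by (simp add: left_diff_distrib)
    also have "\<dots> = step_len i * \<bar>a - b\<bar>"
      using step_len_pos[OF i(1)] by (simp add: abs_mult mult.commute)
    also have "\<dots> = segment_length G e y z"
      using segment_length_edge_point[OF p_neq[OF i(1)]] i a b by (simp add: step_len_def)
    finally show ?thesis .
  qed
  ultimately show ?thesis using that[of f] by (simp add: f_def)
qed

lemma path_segment:
  assumes "i < n" "0 \<le> a" "a \<le> 1" "0 \<le> b" "b \<le> 1"
  shows "graph_path G (edge_point (p i) (p (Suc i)) a) (edge_point (p i) (p (Suc i)) b)
    (step_len i * \<bar>a - b\<bar>)"
proof -
  note ce = closed_edge_eq[OF wf_G path_edge[OF assms(1)]]
  have "graph_path G (edge_point (p i) (p (Suc i)) a) (edge_point (p i) (p (Suc i)) b)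
    (segment_length G {p i, p (Suc i)} (edge_point (p i) (p (Suc i)) a) (edge_point (p i) (p (Suc i)) b))"
    using assms by (intro graph_path_segment[OF path_edge]) (auto simp: ce)
  then show ?thesis using segment_length_edge_point[OF p_neq[OF assms(1)]] by (simp add: step_len_def)
qed

lemma path_vertices:
  assumes "i \<le> j" "j \<le> n"
  shows "graph_path G (vertex_point (p i)) (vertex_point (p j)) (pos_of j - pos_of i)"
  using assms
proof (induction j rule: dec_induct)
  case base
  then show ?case using graph_path.refl[of _ G] path_at_realization[OF path_at_vertex[of i]] by simp
next
  case (step j)
  have "graph_path G (vertex_point (p j)) (vertex_point (p (Suc j))) (step_len j)"
    using path_segment[of j 0 1] p_neq[of j] step by simp
  from graph_path_trans[OF this step.IH] show ?case
    using step by (simp add: pos_of_Suc algebra_simps)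
qed

lemma path_between:
  assumes "path_at x t" "path_at y t'"
  shows "graph_path G x y \<bar>t - t'\<bar>"
proof -
  have *: "graph_path G (edge_point (p i) (p (Suc i)) a) (edge_point (p j) (p (Suc j)) b)
      \<bar>pos_of i + a * step_len i - (pos_of j + b * step_len j)\<bar>"
    if "i \<le> j" "j < n" "0 \<le> a" "a \<le> 1" "0 \<le> b" "b \<le> 1" for i j a b
  proof (cases "i = j")
    case True
    have "\<bar>pos_of i + a * step_len i - (pos_of i + b * step_len i)\<bar> = \<bar>(a - b) * step_len i\<bar>"
      by (simp add: left_diff_distrib)
    also have "\<dots> = step_len i * \<bar>a - b\<bar>"
      using step_len_pos[of i] True that by (simp add: abs_mult mult.commute)
    finally show ?thesis using path_segment[of i a b] that True by simp
  next
    case False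
    then have ij: "Suc i \<le> j" "i < n" using that by auto
    have 1: "graph_path G (edge_point (p i) (p (Suc i)) a) (vertex_point (p (Suc i))) (step_len i * (1 - a))"
      using path_segment[of i a 1] p_neq[of i] ij that by simp
    have 2: "graph_path G (vertex_point (p (Suc i))) (vertex_point (p j)) (pos_of j - pos_of (Suc i))"
      using path_vertices[of "Suc i" j] ij that by simp
    have 3: "graph_path G (vertex_point (p j)) (edge_point (p j) (p (Suc j)) b) (step_len j * b)"
      using path_segment[of j 0 b] that by simp
    have "a * step_len i \<le> step_len i" "0 \<le> b * step_len j"
      using that ij step_len_pos[of i] step_len_pos[of j] by (auto intro: mult_left_le_one_le)
    moreover have "pos_of (Suc i) \<le> pos_of j" using pos_of_mono ij that by simp
    ultimately have "\<bar>pos_of i + a * step_len i - (pos_of j + b * step_len j)\<bar>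
        = step_len i * (1 - a) + (pos_of j - pos_of (Suc i) + step_len j * b)"
      by (simp add: pos_of_Suc algebra_simps)
    then show ?thesis using graph_path_trans[OF graph_path_trans[OF 3 2] 1] by simp
  qed
  obtain i a where i: "i < n" "0 \<le> a" "a \<le> 1" "x = edge_point (p i) (p (Suc i)) a"
      "t = pos_of i + a * step_len i"
    using assms by (auto simp: path_at_def)
  obtain j b where j: "j < n" "0 \<le> b" "b \<le> 1" "y = edge_point (p j) (p (Suc j)) b"
      "t' = pos_of j + b * step_len j"
    using assms by (auto simp: path_at_def)
  show ?thesis
  proof (cases "i \<le> j")
    case True
    then show ?thesis using *[of i j a b] i j by simp
  next
    case False
    then have "graph_path G y x \<bar>t' - t\<bar>" using *[of j i b a] i j by simp
    then show ?thesis using graph_path_sym by (metis abs_minus_commute)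
  qed
qed

lemma H_path: "graph_path H x y L \<Longrightarrow> graph_path G x y L"
  using graph_path_mono[OF _ wf_H wf_G sub] .

lemma metric_graph_G: "metric_graph G"
proof -
  have "\<exists>L. graph_path G (vertex_point (p 0)) x L" if "x \<in> realization G" for x
    using realization_G_cases[OF that]
  proof
    assume "x \<in> realization H"
    then show ?thesis using H_path H p0 wf_H unfolding metric_graph_iff
      by (metis vertex_point_in_realization)
  next
    assume "\<exists>t. path_at x t"
    then show ?thesis using path_between[OF path_at_vertex[of 0]] by blast
  qed
  then show ?thesis unfolding metric_graph_iff
    using wf_G graph_path_trans graph_path_sym by metis
qed

end

section \<open>Exact distances after attaching a path\<close>

context attached_path
begin

abbreviation "start_point \<equiv> vertex_point (p 0)"
abbreviation "end_point \<equiv> vertex_point (p n)"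

lemma start_in_H: "start_point \<in> realization H"
  using p0 wf_H by simp

lemma end_in_H: "p n \<in> verts H \<Longrightarrow> end_point \<in> realization H"
  using wf_H by simp

lemma H_in_G: "x \<in> realization H \<Longrightarrow> x \<in> realization G"
  using metric_subgraph_realization[OF sub] by blast

lemma path_at_start: "path_at start_point 0"
  using path_at_vertex[of 0] by simp

lemma path_at_end: "path_at end_point total"
  using path_at_vertex[of n] by (simp add: total_def)

lemma dist_G_le_H:
  assumes "x \<in> realization H" "y \<in> realization H"
  shows "graph_dist G x y \<le> graph_dist H x y"
proof (rule field_le_epsilon)
  fix \<epsilon> :: real assume "0 < \<epsilon>"
  then obtain L where "graph_path H x y L" "L < graph_dist H x y + \<epsilon>"
    using graph_dist_approx[OF H assms] by blast
  then show "graph_dist G x y \<le> graph_dist H x y + \<epsilon>"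
    using graph_dist_le[OF wf_G H_path, of x y L] by linarith
qed

lemma dist_path_le: "path_at x t \<Longrightarrow> path_at y t' \<Longrightarrow> graph_dist G x y \<le> \<bar>t - t'\<bar>"
  using graph_dist_le[OF wf_G path_between] .

lemma dist_G_triangle:
  "x \<in> realization G \<Longrightarrow> y \<in> realization G \<Longrightarrow> z \<in> realization G
    \<Longrightarrow> graph_dist G x z \<le> graph_dist G x y + graph_dist G y z"
  using graph_dist_triangle[OF metric_graph_G] .

lemma dist_H_path_le:
  assumes "x \<in> realization H" "path_at y t"
  shows "graph_dist G x y \<le> graph_dist H x start_point + t"
    and "p n \<in> verts H \<Longrightarrow> graph_dist G x y \<le> graph_dist H x end_point + (total - t)"
proof -
  note R = H_in_G[OF assms(1)] path_at_realization[OF assms(2)]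
  show "graph_dist G x y \<le> graph_dist H x start_point + t"
    using dist_G_triangle[OF R(1) H_in_G[OF start_in_H] R(2)] dist_G_le_H[OF assms(1) start_in_H]
      dist_path_le[OF path_at_start assms(2)] path_at_range[OF assms(2)] by linarith
  show "graph_dist G x y \<le> graph_dist H x end_point + (total - t)" if "p n \<in> verts H"
    using dist_G_triangle[OF R(1) H_in_G[OF end_in_H[OF that]] R(2)]
      dist_G_le_H[OF assms(1) end_in_H[OF that]]
      dist_path_le[OF path_at_end assms(2)] path_at_range[OF assms(2)] by linarith
qed

lemma dist_H_potential:
  assumes "x \<in> realization H" "e \<in> edges H" "y \<in> closed_edge H e" "z \<in> closed_edge H e"
  shows "graph_dist H x z - graph_dist H x y \<le> segment_length H e y z"
  using graph_dist_edge_le_segment_length[OF H assms(2,1,3,4)] .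

lemma dist_H_triangle:
  "x \<in> realization H \<Longrightarrow> y \<in> realization H \<Longrightarrow> z \<in> realization H
    \<Longrightarrow> graph_dist H x z \<le> graph_dist H x y + graph_dist H y z"
  using graph_dist_triangle[OF H] .

lemma potential_dist:
  assumes "\<And>e y z. e \<in> edges H \<Longrightarrow> y \<in> closed_edge H e \<Longrightarrow> z \<in> closed_edge H e
      \<Longrightarrow> fH z - fH y \<le> segment_length H e y z"
    and "\<And>t t'. g t' - g t \<le> \<bar>t - t'\<bar>"
    and "fH start_point = g 0" and "p n \<in> verts H \<Longrightarrow> fH end_point = g total"
  shows "\<exists>f. (\<forall>x\<in>realization H. f x = fH x) \<and> (\<forall>x t. path_at x t \<longrightarrow> f x = g t) \<and>
    (\<forall>x\<in>realization G. \<forall>y\<in>realization G. f y - f x \<le> graph_dist G x y)"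
proof (rule potential_extension[OF assms(1,2,3,4)])
  fix f
  assume f: "\<And>x. x \<in> realization H \<Longrightarrow> f x = fH x" "\<And>x t. path_at x t \<Longrightarrow> f x = g t"
    "\<And>e y z. e \<in> edges G \<Longrightarrow> y \<in> closed_edge G e \<Longrightarrow> z \<in> closed_edge G e
      \<Longrightarrow> f z - f y \<le> segment_length G e y z"
  have "f y - f x \<le> graph_dist G x y" if "x \<in> realization G" "y \<in> realization G" for x y
    by (rule graph_dist_potential[OF metric_graph_G that f(3)])
  then show ?thesis using f(1,2) by blast
qed

text \<open>A path with a new end can be entered from \<open>H\<close> only through
  \<open>p 0\<close>, so the distance from \<open>x\<close> continues along it with slope one. The
  route through \<open>p 0\<close> is the matching upper bound.\<close>

lemma open_potential:
  assumes "p n \<notin> verts H" "x \<in> realization H"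
  obtains f where "\<And>y. y \<in> realization H \<Longrightarrow> f y = graph_dist H x y"
    "\<And>y t. path_at y t \<Longrightarrow> f y = graph_dist H x start_point + t"
    "\<And>y. y \<in> realization G \<Longrightarrow> f y \<le> graph_dist G x y"
proof -
  define g where "g t = graph_dist H x start_point + t" for t
  have g: "graph_dist H x start_point = g 0" "\<And>t t'. g t' - g t \<le> \<bar>t - t'\<bar>"
    by (auto simp: g_def)
  obtain f where f: "\<forall>y\<in>realization H. f y = graph_dist H x y" "\<forall>y t. path_at y t \<longrightarrow> f y = g t"
    "\<forall>x\<in>realization G. \<forall>y\<in>realization G. f y - f x \<le> graph_dist G x y"
    using potential_dist[OF dist_H_potential[OF assms(2)] g(2,1)] assms(1) by blast
  have "f x = 0" using f(1) assms graph_dist_refl[OF H] by simp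
  then have "f y \<le> graph_dist G x y" if "y \<in> realization G" for y
    using f(3) H_in_G[OF assms(2)] that by fastforce
  then show ?thesis using f(1,2) by (intro that[of f]) (auto simp: g_def)
qed

lemma open_dist_H:
  assumes "p n \<notin> verts H" "x \<in> realization H" "y \<in> realization H"
  shows "graph_dist G x y = graph_dist H x y"
proof -
  obtain f where "f y = graph_dist H x y" "f y \<le> graph_dist G x y"
    using open_potential[OF assms(1,2)] assms(3) H_in_G by metis
  then show ?thesis using dist_G_le_H[OF assms(2,3)] by simp
qed

lemma open_dist_H_path:
  assumes "p n \<notin> verts H" "x \<in> realization H" "path_at y t"
  shows "graph_dist G x y = graph_dist H x start_point + t"
proof -
  obtain f where "f y = graph_dist H x start_point + t" "f y \<le> graph_dist G x y"
    using open_potential[OF assms(1,2)] assms(3) path_at_realization by metis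
  then show ?thesis using dist_H_path_le(1)[OF assms(2,3)] by simp
qed

lemma open_dist_path:
  assumes "p n \<notin> verts H" "path_at x t" "path_at y t'"
  shows "graph_dist G x y = \<bar>t - t'\<bar>"
proof -
  note r = path_at_range[OF assms(2)]
  \<comment> \<open>The distance from \<open>x\<close> as seen in \<open>H\<close>: first back along
    the path by \<open>t\<close>, then on from \<open>p 0\<close>.\<close>
  define fH where "fH y = graph_dist H start_point y + t" for y
  define g where "g t' = \<bar>t - t'\<bar>" for t'
  have 1: "fH z - fH y \<le> segment_length H e y z"
    if "e \<in> edges H" "y \<in> closed_edge H e" "z \<in> closed_edge H e" for e y z
    using dist_H_potential[OF start_in_H that] by (simp add: fH_def)
  have 2: "fH start_point = g 0" "\<And>t t'. g t' - g t \<le> \<bar>t - t'\<bar>"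
    using graph_dist_refl[OF H start_in_H] r by (auto simp: fH_def g_def)
  obtain f where f: "\<forall>y t'. path_at y t' \<longrightarrow> f y = g t'"
    "\<forall>x\<in>realization G. \<forall>y\<in>realization G. f y - f x \<le> graph_dist G x y"
    using potential_dist[OF 1 2(2,1)] assms(1) by blast
  have "f y - f x \<le> graph_dist G x y"
    using f(2) path_at_realization assms by blast
  moreover have "f x = \<bar>t - t\<bar>" "f y = \<bar>t - t'\<bar>" using f(1) assms by (auto simp: g_def)
  ultimately show ?thesis using dist_path_le[OF assms(2,3)] by simp
qed

text \<open>A point of the path is reached through the end that gives the shorter route. The bound
  on the distance between the ends says that the path is no shortcut in \<open>H\<close>; it makes
  the minimum take the distances in \<open>H\<close> as its values at both ends.\<close>

lemma closed_potential:
  assumes "p n \<in> verts H" "graph_dist H start_point end_point \<le> total" "x \<in> realization H"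
  obtains f where "\<And>y. y \<in> realization H \<Longrightarrow> f y = graph_dist H x y"
    "\<And>y t. path_at y t \<Longrightarrow>
      f y = min (graph_dist H x start_point + t) (graph_dist H x end_point + (total - t))"
    "\<And>y. y \<in> realization G \<Longrightarrow> f y \<le> graph_dist G x y"
proof -
  define g where
    "g t = min (graph_dist H x start_point + t) (graph_dist H x end_point + (total - t))" for t
  have "graph_dist H x start_point \<le> graph_dist H x end_point + total"
    "graph_dist H x end_point \<le> graph_dist H x start_point + total"
    using dist_H_triangle[OF assms(3) start_in_H end_in_H] dist_H_triangle[OF assms(3) end_in_H start_in_H]
      graph_dist_sym[of H end_point start_point] assms by auto
  then have g: "graph_dist H x start_point = g 0" "graph_dist H x end_point = g total"
    by (auto simp: g_def)
  have gl: "g t' - g t \<le> \<bar>t - t'\<bar>" for t t'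
    unfolding g_def min_def by auto
  obtain f where f: "\<forall>y\<in>realization H. f y = graph_dist H x y" "\<forall>y t. path_at y t \<longrightarrow> f y = g t"
    "\<forall>x\<in>realization G. \<forall>y\<in>realization G. f y - f x \<le> graph_dist G x y"
    using potential_dist[OF dist_H_potential[OF assms(3)] gl g] by blast
  have "f x = 0" using f(1) assms graph_dist_refl[OF H] by simp
  then have "f y \<le> graph_dist G x y" if "y \<in> realization G" for y
    using f(3) H_in_G[OF assms(3)] that by fastforce
  then show ?thesis using f(1,2) by (intro that[of f]) (auto simp: g_def)
qed

lemma closed_dist_H:
  assumes "p n \<in> verts H" "graph_dist H start_point end_point \<le> total"
    and "x \<in> realization H" "y \<in> realization H"
  shows "graph_dist G x y = graph_dist H x y"
proof -
  obtain f where "f y = graph_dist H x y" "f y \<le> graph_dist G x y"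
    using closed_potential[OF assms(1-3)] assms(4) H_in_G by metis
  then show ?thesis using dist_G_le_H[OF assms(3,4)] by simp
qed

lemma closed_dist_H_path:
  assumes "p n \<in> verts H" "graph_dist H start_point end_point \<le> total"
    and "x \<in> realization H" "path_at y t"
  shows "graph_dist G x y =
    min (graph_dist H x start_point + t) (graph_dist H x end_point + (total - t))"
proof -
  obtain f where
    "f y = min (graph_dist H x start_point + t) (graph_dist H x end_point + (total - t))"
    "f y \<le> graph_dist G x y"
    using closed_potential[OF assms(1-3)] assms(4) path_at_realization by metis
  then show ?thesis using dist_H_path_le(1)[OF assms(3,4)] dist_H_path_le(2)[OF assms(3,4,1)] by simp
qed

lemma closed_dist_path:
  assumes "p n \<in> verts H" "graph_dist H start_point end_point \<le> total"
    and "path_at x t" "path_at y t'"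
  shows "graph_dist G x y =
    min \<bar>t - t'\<bar> (graph_dist H start_point end_point + total - \<bar>t - t'\<bar>)"
proof -
  define c where "c = graph_dist H start_point end_point"
  have c: "0 \<le> c" "c \<le> total"
    using graph_dist_nonneg[OF H start_in_H end_in_H] assms by (auto simp: c_def)
  note r = path_at_range[OF assms(3)] and r' = path_at_range[OF assms(4)]
  \<comment> \<open>The distance on a circle of length \<open>c + total\<close>: the path, closed up
    by a shortest connection of its ends in \<open>H\<close>.\<close>
  define g where "g t' = min \<bar>t - t'\<bar> (c + total - \<bar>t - t'\<bar>)" for t'
  define fH where "fH y = min (graph_dist H start_point y + t) (graph_dist H end_point y + (total - t))" for y
  have 1: "fH z - fH y \<le> segment_length H e y z"
    if "e \<in> edges H" "y \<in> closed_edge H e" "z \<in> closed_edge H e" for e y z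
    using dist_H_potential[OF start_in_H that] dist_H_potential[OF end_in_H[OF assms(1)] that]
    by (simp add: fH_def min_def)
  have 2: "fH start_point = g 0" "fH end_point = g total"
    using r c graph_dist_refl[OF H start_in_H] graph_dist_refl[OF H end_in_H[OF assms(1)]]
      graph_dist_sym[of H end_point start_point] by (auto simp: fH_def g_def c_def)
  have 3: "g t'' - g t' \<le> \<bar>t' - t''\<bar>" for t' t''
  proof -
    have "\<bar>t - t''\<bar> - \<bar>t - t'\<bar> \<le> \<bar>t' - t''\<bar>" "\<bar>t - t'\<bar> - \<bar>t - t''\<bar> \<le> \<bar>t' - t''\<bar>"
      by linarith+
    then show ?thesis unfolding g_def min_def by (auto split del: if_split split: if_split)
  qed
  obtain f where f: "\<forall>y t'. path_at y t' \<longrightarrow> f y = g t'"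
    "\<forall>x\<in>realization G. \<forall>y\<in>realization G. f y - f x \<le> graph_dist G x y"
    using potential_dist[OF 1 3 2] by blast
  have "f y - f x \<le> graph_dist G x y"
    using f(2) path_at_realization assms by blast
  moreover have "f x = 0" using f(1) assms(3) c r by (auto simp: g_def)
  moreover have "f y = g t'" using f(1) assms(4) by blast
  ultimately have "g t' \<le> graph_dist G x y" by simp
  moreover have "graph_dist G x y \<le> \<bar>t - t'\<bar>" using dist_path_le assms by blast
  \<comment> \<open>The other way round: leave the path at its two ends and cross \<open>H\<close>
    between them.\<close>
  moreover have "graph_dist G x y \<le> c + total - \<bar>t - t'\<bar>"
  proof -
    note R = path_at_realization[OF assms(3)] path_at_realization[OF assms(4)]
      H_in_G[OF start_in_H] H_in_G[OF end_in_H[OF assms(1)]]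
    have se: "graph_dist G start_point end_point \<le> c"
      using dist_G_le_H[OF start_in_H end_in_H[OF assms(1)]] by (simp add: c_def)
    have es: "graph_dist G end_point start_point \<le> c"
      using se by (simp add: graph_dist_sym)
    show ?thesis
    proof (cases "t \<le> t'")
      case True
      then show ?thesis
        using dist_G_triangle[OF R(1,3,2)] dist_G_triangle[OF R(3,4,2)] se
          dist_path_le[OF assms(3) path_at_start] dist_path_le[OF path_at_end assms(4)] r r' by simp
    next
      case False
      then show ?thesis
        using dist_G_triangle[OF R(1,4,2)] dist_G_triangle[OF R(4,3,2)] es
          dist_path_le[OF assms(3) path_at_end] dist_path_le[OF path_at_start assms(4)] r r' by simp
    qed
  qed
  ultimately show ?thesis by (simp add: g_def c_def)
qed

end

section \<open>Four equally spaced points\<close>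

definition square_tuple :: "('p \<Rightarrow> 'p \<Rightarrow> real) \<Rightarrow> real \<Rightarrow> 'p \<Rightarrow> 'p \<Rightarrow> 'p \<Rightarrow> 'p \<Rightarrow> bool" where
  "square_tuple d s x1 x2 x3 x4 \<longleftrightarrow> d x1 x2 = s \<and> d x2 x3 = s \<and> d x3 x4 = s \<and> d x4 x1 = s \<and>
     d x1 x3 = 2 * s \<and> d x2 x4 = 2 * s"

definition has_square :: "'a mgraph \<Rightarrow> real \<Rightarrow> bool" where
  "has_square G s \<longleftrightarrow> (\<exists>x1\<in>realization G. \<exists>x2\<in>realization G. \<exists>x3\<in>realization G.
     \<exists>x4\<in>realization G. square_tuple (graph_dist G) s x1 x2 x3 x4)"

text \<open>The edges in \<open>B\<close> are isometrically embedded, and a point \<open>x\<close> with distances \<open>a\<close> and \<open>b\<close> from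
  the endpoints of such an edge, of length \<open>c\<close>, either lies on the edge, or has an endpoint as its
  nearest point on the edge with \<open>\<bar>a - b\<bar> = c\<close>, or satisfies \<open>a + b > 2 c\<close>.\<close>

definition short_edges :: "'a set set \<Rightarrow> 'a mgraph \<Rightarrow> bool" where
  "short_edges B G \<longleftrightarrow> (\<forall>u w. {u, w} \<in> B \<and> {u, w} \<in> edges G \<longrightarrow>
     graph_dist G (vertex_point u) (vertex_point w) = elen G {u, w} \<and>
     (\<forall>x\<in>realization G. x \<in> closed_edge G {u, w} \<or>
        \<bar>graph_dist G x (vertex_point u) - graph_dist G x (vertex_point w)\<bar> = elen G {u, w} \<or>
        2 * elen G {u, w} < graph_dist G x (vertex_point u) + graph_dist G x (vertex_point w)))"

lemma square_tuple_cong: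
  assumes "\<And>a b. a \<in> S \<Longrightarrow> b \<in> S \<Longrightarrow> d a b = d' a b"
    and "x1 \<in> S" "x2 \<in> S" "x3 \<in> S" "x4 \<in> S"
  shows "square_tuple d s x1 x2 x3 x4 \<longleftrightarrow> square_tuple d' s x1 x2 x3 x4"
  using assms by (simp add: square_tuple_def)

lemma square_tuple_rotate:
  "square_tuple (graph_dist G) s x1 x2 x3 x4 \<Longrightarrow> square_tuple (graph_dist G) s x2 x3 x4 x1"
  using graph_dist_sym[of G] by (auto simp: square_tuple_def)

lemma square_tuple_reflect:
  "square_tuple (graph_dist G) s x1 x2 x3 x4 \<Longrightarrow> square_tuple (graph_dist G) s x2 x1 x4 x3"
  using graph_dist_sym[of G] by (auto simp: square_tuple_def)

section \<open>Attaching a leaf\<close>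

context attached_path
begin

lemma path_at_zero:
  assumes "path_at x 0"
  shows "x = start_point"
  using assms
proof (cases rule: path_at_cases)
  case (vertex i)
  then show ?thesis using pos_of_strict_mono[of 0 i] by (cases i) auto
next
  case (edge i \<theta>)
  then have "0 < \<theta> * step_len i" "0 \<le> pos_of i"
    using pos_of_mono[of 0 i] step_len_pos[of i] by auto
  then show ?thesis using edge by linarith
qed

lemma path_at_total:
  assumes "path_at x total"
  shows "x = end_point"
  using assms
proof (cases rule: path_at_cases)
  case (vertex i)
  then show ?thesis using pos_of_strict_mono[of i n] by (cases "i = n") (auto simp: total_def)
next
  case (edge i \<theta>)
  have "\<theta> * step_len i < step_len i" using edge step_len_pos[of i] by simp
  moreover have "pos_of i + step_len i \<le> total"
    using pos_of_mono[of "Suc i" n] edge by (simp add: total_def pos_of_Suc)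
  ultimately show ?thesis using edge by simp
qed

lemma G_cases_open:
  assumes "x \<in> realization G"
  shows "x \<in> realization H \<or> (\<exists>t>0. path_at x t)"
  using realization_G_cases[OF assms]
proof
  assume "\<exists>t. path_at x t"
  then obtain t where t: "path_at x t" by blast
  show ?thesis
  proof (cases "t = 0")
    case True
    then show ?thesis using path_at_zero t start_in_H by auto
  next
    case False
    then show ?thesis using t path_at_range(1)[OF t] by (intro disjI2 exI[of _ t]) simp
  qed
qed simp

lemma G_cases_closed:
  assumes "x \<in> realization G" "p n \<in> verts H"
  shows "x \<in> realization H \<or> (\<exists>t. 0 < t \<and> t < total \<and> path_at x t)"
  using G_cases_open[OF assms(1)]
proof
  assume "\<exists>t>0. path_at x t"
  then obtain t where t: "path_at x t" "0 < t" by blast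
  show ?thesis
  proof (cases "t = total")
    case True
    then show ?thesis using path_at_total t end_in_H[OF assms(2)] by auto
  next
    case False
    then show ?thesis using t path_at_range(2)[OF t(1)] by (intro disjI2 exI[of _ t]) simp
  qed
qed simp

lemma H_dist:
  "x \<in> realization H \<Longrightarrow> 0 \<le> graph_dist H x start_point"
  "p n \<in> verts H \<Longrightarrow> x \<in> realization H \<Longrightarrow> 0 \<le> graph_dist H x end_point"
  "x \<in> realization H \<Longrightarrow> y \<in> realization H \<Longrightarrow>
    graph_dist H x y \<le> graph_dist H x start_point + graph_dist H y start_point"
  "p n \<in> verts H \<Longrightarrow> x \<in> realization H \<Longrightarrow> y \<in> realization H \<Longrightarrow>
    graph_dist H x y \<le> graph_dist H x end_point + graph_dist H y end_point"
  using graph_dist_nonneg[OF H, of x start_point] graph_dist_nonneg[OF H, of x end_point]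
    start_in_H end_in_H dist_H_triangle[of x start_point y] dist_H_triangle[of x end_point y]
    graph_dist_sym[of H y start_point] graph_dist_sym[of H y end_point] by auto

text \<open>From the corner furthest out, both neighbours lie in the direction of \<open>H\<close>.
  The two routes of length \<open>s\<close> overlap, so the neighbours are less than
  \<open>2 * s\<close> apart.\<close>

lemma no_square_at_leaf_tip:
  assumes leaf: "p n \<notin> verts H" and sq: "square_tuple (graph_dist G) s x1 x2 x3 x4" and s: "0 < s"
    and x1: "path_at x1 t" "0 < t"
    and x2: "x2 \<in> realization H \<or> (\<exists>r\<le>t. path_at x2 r)"
    and x4: "x4 \<in> realization H \<or> (\<exists>r\<le>t. path_at x4 r)"
  shows False
proof -
  have sy: "graph_dist G x2 x1 = s" "graph_dist G x4 x1 = s" "graph_dist G x2 x4 = 2 * s"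
    using sq graph_dist_sym[of G] by (auto simp: square_tuple_def)
  have dH: "graph_dist G y x1 = graph_dist H y start_point + t" if "y \<in> realization H" for y
    using open_dist_H_path[OF leaf that x1(1)] .
  have dP: "graph_dist G y x1 = t - r" if "path_at y r" "r \<le> t" for y r
    using open_dist_path[OF leaf that(1) x1(1)] that by simp
  consider "x2 \<in> realization H" "x4 \<in> realization H"
    | r where "x2 \<in> realization H" "path_at x4 r" "r \<le> t"
    | r where "x4 \<in> realization H" "path_at x2 r" "r \<le> t"
    | r r' where "path_at x2 r" "r \<le> t" "path_at x4 r'" "r' \<le> t"
    using x2 x4 by blast
  then show False
  proof cases
    case 1
    then show False
      using open_dist_H[OF leaf, of x2 x4] H_dist(3)[of x2 x4] sy dH[of x2] dH[of x4] x1 s by simp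
  next
    case (2 r)
    then show False
      using open_dist_H_path[OF leaf, of x2 x4 r] sy dH[of x2] dP[of x4 r] s by simp
  next
    case (3 r)
    then show False
      using open_dist_H_path[OF leaf, of x4 x2 r] sy dH[of x4] dP[of x2 r] s graph_dist_sym[of G x2 x4]
      by simp
  next
    case (4 r r')
    then show False using open_dist_path[OF leaf, of x2 r x4 r'] sy dP[of x2 r] dP[of x4 r'] s by simp
  qed
qed

lemma has_square_leaf:
  assumes leaf: "p n \<notin> verts H" and s: "0 < s"
  shows "has_square G s \<longleftrightarrow> has_square H s"
proof
  assume "has_square G s"
  then obtain x1 x2 x3 x4 where x: "x1 \<in> realization G" "x2 \<in> realization G" "x3 \<in> realization G"
    "x4 \<in> realization G" and sq: "square_tuple (graph_dist G) s x1 x2 x3 x4"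
    by (auto simp: has_square_def)
  \<comment> \<open>Height above \<open>H\<close>. By \<open>tip\<close>, a corner at least as high
    as its two neighbours has height 0; applied to the highest corner this puts all four into
    \<open>H\<close>.\<close>
  define \<tau> where "\<tau> x = (if x \<in> realization H then 0 else (SOME t. 0 < t \<and> path_at x t))" for x
  have \<tau>: "x \<in> realization H \<and> \<tau> x = 0 \<or> 0 < \<tau> x \<and> path_at x (\<tau> x)" if "x \<in> realization G" for x
  proof (cases "x \<in> realization H")
    case False
    then have "\<exists>t. 0 < t \<and> path_at x t" using G_cases_open[OF that] by blast
    then show ?thesis using someI_ex[of "\<lambda>t. 0 < t \<and> path_at x t"] False by (simp add: \<tau>_def)
  qed (simp add: \<tau>_def)
  have tip: "y1 \<in> realization H \<and> \<tau> y1 = 0"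
    if "square_tuple (graph_dist G) s y1 y2 y3 y4" "y1 \<in> realization G" "y2 \<in> realization G"
      "y4 \<in> realization G" "\<tau> y2 \<le> \<tau> y1" "\<tau> y4 \<le> \<tau> y1" for y1 y2 y3 y4
    using no_square_at_leaf_tip[OF leaf that(1) s, of "\<tau> y1"] \<tau>[OF that(2)] \<tau>[OF that(3)] \<tau>[OF that(4)]
      that(5,6) by blast
  note sq2 = square_tuple_rotate[OF sq]
  note sq3 = square_tuple_rotate[OF sq2]
  note sq4 = square_tuple_rotate[OF sq3]
  have "\<tau> x1 = 0 \<and> \<tau> x2 = 0 \<and> \<tau> x3 = 0 \<and> \<tau> x4 = 0"
    using tip[OF sq x(1,2,4)] tip[OF sq2 x(2,3,1)] tip[OF sq3 x(3,4,2)] tip[OF sq4 x(4,1,3)]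
      \<tau>[OF x(1)] \<tau>[OF x(2)] \<tau>[OF x(3)] \<tau>[OF x(4)] by linarith
  then have "x1 \<in> realization H" "x2 \<in> realization H" "x3 \<in> realization H" "x4 \<in> realization H"
    using \<tau> x by force+
  then show "has_square H s"
    using sq square_tuple_cong[of "realization H" "graph_dist G" "graph_dist H" x1 x2 x3 x4 s,
        OF open_dist_H[OF leaf]] unfolding has_square_def by blast
next
  assume "has_square H s"
  then obtain x1 x2 x3 x4 where x: "x1 \<in> realization H" "x2 \<in> realization H" "x3 \<in> realization H"
    "x4 \<in> realization H" and sq: "square_tuple (graph_dist H) s x1 x2 x3 x4"
    by (auto simp: has_square_def)
  then show "has_square G s"
    using square_tuple_cong[of "realization H" "graph_dist G" "graph_dist H" x1 x2 x3 x4 s,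
        OF open_dist_H[OF leaf]] x[THEN H_in_G] unfolding has_square_def by blast
qed

lemma old_edge:
  assumes "e \<in> edges H"
  shows "elen G e = elen H e" "closed_edge G e = closed_edge H e"
  using assms sub metric_subgraph_closed_edge[OF sub wf_H wf_G] by (auto simp: metric_subgraph_def)

text \<open>For an old edge, a point of the leaf sees both endpoints as \<open>start_point\<close>
  does, with both distances increased by \<open>t\<close>; this preserves the last two alternatives.
  If \<open>start_point\<close> is on the edge, it is an endpoint and the difference is the full
  length. For the new edge itself, all of \<open>H\<close> sees one endpoint through the
  other.\<close>

lemma short_edges_leaf:
  assumes leaf: "p n \<notin> verts H" and n1: "n = 1" and H: "short_edges B H"
  shows "short_edges B G"
  unfolding short_edges_def
proof (intro allI impI)
  fix u w assume e: "{u, w} \<in> B \<and> {u, w} \<in> edges G"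
  let ?c = "elen G {u, w}" and ?d = "graph_dist G"
  show "?d (vertex_point u) (vertex_point w) = ?c \<and>
    (\<forall>x\<in>realization G. x \<in> closed_edge G {u, w} \<or>
      \<bar>?d x (vertex_point u) - ?d x (vertex_point w)\<bar> = ?c \<or>
      2 * ?c < ?d x (vertex_point u) + ?d x (vertex_point w))"
  proof (cases "{u, w} \<in> edges H")
    case True
    note uw = wf_graph_edgeD[OF wf_H True]
    have R: "vertex_point u \<in> realization H" "vertex_point w \<in> realization H" using uw wf_H by auto
    have HH: "graph_dist H (vertex_point u) (vertex_point w) = elen H {u, w}"
      "\<And>x. x \<in> realization H \<Longrightarrow> x \<in> closed_edge H {u, w} \<or>
        \<bar>graph_dist H x (vertex_point u) - graph_dist H x (vertex_point w)\<bar> = elen H {u, w} \<or>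
        2 * elen H {u, w} < graph_dist H x (vertex_point u) + graph_dist H x (vertex_point w)"
      using H e True unfolding short_edges_def by blast+
    have far: "x \<in> closed_edge G {u, w} \<or>
      \<bar>?d x (vertex_point u) - ?d x (vertex_point w)\<bar> = ?c \<or>
      2 * ?c < ?d x (vertex_point u) + ?d x (vertex_point w)" if "x \<in> realization H" for x
      using HH(2)[OF that] by (simp add: old_edge[OF True] open_dist_H[OF leaf that R(1)]
          open_dist_H[OF leaf that R(2)])
    have c: "?d (vertex_point u) (vertex_point w) = ?c"
      using HH(1) by (simp add: old_edge[OF True] open_dist_H[OF leaf R])
    moreover have "\<bar>?d x (vertex_point u) - ?d x (vertex_point w)\<bar> = ?c \<or>
      2 * ?c < ?d x (vertex_point u) + ?d x (vertex_point w)" if x: "path_at x t" for x t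
    proof -
      have dx: "?d x v = ?d start_point v + t" if "v \<in> realization H" for v
        using open_dist_H_path[OF leaf that x] open_dist_H[OF leaf that start_in_H]
        by (simp add: graph_dist_sym)
      have "start_point \<in> closed_edge G {u, w} \<longrightarrow> p 0 = u \<or> p 0 = w"
        using vertex_point_in_closed_edge[OF wf_G, of "{u, w}" "p 0"] e by auto
      moreover have "?d start_point start_point = 0"
        using graph_dist_refl[OF metric_graph_G H_in_G[OF start_in_H]] .
      ultimately have "start_point \<in> closed_edge G {u, w} \<longrightarrow> \<bar>?d start_point (vertex_point u) -
          ?d start_point (vertex_point w)\<bar> = ?c"
        using c graph_dist_sym[of G "vertex_point w" "vertex_point u"] uw(4) old_edge(1)[OF True] by auto
      then show ?thesis
        using far[OF start_in_H] dx[OF R(1)] dx[OF R(2)] path_at_range(1)[OF x] by linarith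
    qed
    ultimately show ?thesis using far realization_G_cases by blast
  next
    case False
    then have uw: "{u, w} = {p 0, p (Suc 0)}" using e eG n1 by auto
    have uwn: "{u, w} = {p 0, p n}" using uw n1 by simp
    have tot: "pos_of (Suc 0) = total" unfolding total_def using n1 by simp
    then have tot': "total = ?c" unfolding pos_of_def step_len_def uw by simp
    have se: "?d start_point end_point = ?c"
      using open_dist_path[OF leaf path_at_start path_at_end] tot' total_pos by simp
    have "x \<in> closed_edge G {u, w} \<or> \<bar>?d x start_point - ?d x end_point\<bar> = ?c" if "x \<in> realization G" for x
      using realization_G_cases[OF that]
    proof
      assume "x \<in> realization H"
      then show ?thesis
        using open_dist_H_path[OF leaf _ path_at_start, of x] open_dist_H_path[OF leaf _ path_at_end, of x]
          tot' total_pos by simp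
    next
      assume "\<exists>t. path_at x t"
      then obtain t where t: "path_at x t" by blast
      then show ?thesis
        using path_at_in_closed_edge[OF t, of 0] path_at_range[OF t] n tot uw by simp
    qed
    moreover have "u = p 0 \<and> w = p n \<or> u = p n \<and> w = p 0"
      using uwn by (simp add: doubleton_eq_iff)
    ultimately show ?thesis using se graph_dist_sym[of G end_point start_point]
      by (metis abs_minus_commute)
  qed
qed

end

section \<open>Attaching an ear: which squares can arise\<close>

lemma circle_difference:
  fixes a b s l :: real
  assumes "s = min \<bar>a - b\<bar> (l - \<bar>a - b\<bar>)"
  shows "b - a = s \<or> b - a = s - l \<or> b - a = - s \<or> b - a = l - s"
  using assms by (auto simp: min_def abs_if split: if_splits)

text \<open>On a circle of length \<open>l > 4 s\<close>, two consecutive steps of length \<open>s\<close> that lead to a point at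
  distance \<open>2 s\<close> have the same orientation.\<close>

lemma circle_orientation:
  fixes a b c s l :: real
  assumes "s = min \<bar>a - b\<bar> (l - \<bar>a - b\<bar>)" "s = min \<bar>b - c\<bar> (l - \<bar>b - c\<bar>)"
    and "2 * s = min \<bar>a - c\<bar> (l - \<bar>a - c\<bar>)" and "0 < s" "4 * s < l"
  shows "(b - a = s \<or> b - a = s - l) \<and> (c - b = s \<or> c - b = s - l) \<or>
    (a - b = s \<or> a - b = s - l) \<and> (b - c = s \<or> b - c = s - l)"
proof -
  define x where "x = b - a"
  define y where "y = c - b"
  have "x = s \<or> x = s - l \<or> x = - s \<or> x = l - s" "y = s \<or> y = s - l \<or> y = - s \<or> y = l - s"
    using circle_difference[OF assms(1)] circle_difference[OF assms(2)] by (simp_all add: x_def y_def)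
  moreover have "x + y = 2 * s \<or> x + y = 2 * s - l \<or> x + y = - 2 * s \<or> x + y = l - 2 * s"
    using circle_difference[OF assms(3)] by (simp add: x_def y_def)
  ultimately have "(x = s \<or> x = s - l) \<and> (y = s \<or> y = s - l) \<or>
    (x = - s \<or> x = l - s) \<and> (y = - s \<or> y = l - s)"
    using assms(4,5) by (elim disjE) simp_all
  then show ?thesis unfolding x_def y_def by (elim disjE conjE) simp_all
qed

text \<open>The ear and its base, a vertex or an edge, form a cycle of length \<open>total\<close>
  plus the base length. So the strict inequality in \<open>base\<close> says that the base edge is
  shorter than a third of this cycle.\<close>

locale attached_ear = attached_path +
  fixes B :: "'a set set"
  assumes closed: "p n \<in> verts H" and short: "short_edges B H"
    and base: "p 0 = p n \<or>
      {p 0, p n} \<in> B \<and> {p 0, p n} \<in> edges H \<and> 2 * elen H {p 0, p n} < total"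
begin

definition base_len where "base_len = (if p 0 = p n then 0 else elen H {p 0, p n})"
definition ear_len where "ear_len = total + base_len"

abbreviation "dist_start x \<equiv> graph_dist H x start_point"
abbreviation "dist_end x \<equiv> graph_dist H x end_point"

lemma base_dist: "graph_dist H start_point end_point = base_len"
  using base short graph_dist_refl[OF H start_in_H] by (auto simp: base_len_def short_edges_def)

lemma base_len: "0 \<le> base_len" "2 * base_len < total"
proof -
  show "0 \<le> base_len"
    using graph_dist_nonneg[OF H start_in_H end_in_H[OF closed]] base_dist by simp
  show "2 * base_len < total" using base total_pos by (auto simp: base_len_def)
qed

lemma base_le_total: "graph_dist H start_point end_point \<le> total"
  using base_len base_dist by linarith

lemmas dist_HH = closed_dist_H[OF closed base_le_total]
lemmas dist_HP = closed_dist_H_path[OF closed base_le_total]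
lemmas dist_PP = closed_dist_path[OF closed base_le_total, unfolded base_dist]

lemma dist_PH:
  "x \<in> realization H \<Longrightarrow> path_at y t \<Longrightarrow>
    graph_dist G y x = min (dist_start x + t) (dist_end x + (total - t))"
  using dist_HP graph_dist_sym[of G] by simp

lemma triangles:
  assumes "x \<in> realization H"
  shows "0 \<le> dist_start x" "0 \<le> dist_end x" "base_len \<le> dist_start x + dist_end x"
    "dist_start x \<le> dist_end x + base_len" "dist_end x \<le> dist_start x + base_len"
  using H_dist(1)[OF assms] H_dist(2)[OF closed assms]
    dist_H_triangle[OF start_in_H assms end_in_H[OF closed]]
    dist_H_triangle[OF assms start_in_H end_in_H[OF closed]]
    dist_H_triangle[OF assms end_in_H[OF closed] start_in_H]
    graph_dist_sym[of H start_point x] graph_dist_sym[of H end_point start_point] base_dist by auto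

lemma triangles2:
  assumes "x \<in> realization H" "y \<in> realization H"
  shows "graph_dist H x y \<le> dist_start x + dist_start y" "graph_dist H x y \<le> dist_end x + dist_end y"
    "dist_start x \<le> graph_dist H x y + dist_start y" "dist_end x \<le> graph_dist H x y + dist_end y"
    "dist_start y \<le> graph_dist H x y + dist_start x" "dist_end y \<le> graph_dist H x y + dist_end x"
  using H_dist(3)[OF assms] H_dist(4)[OF closed assms] dist_H_triangle[OF assms start_in_H]
    dist_H_triangle[OF assms(2,1) start_in_H] dist_H_triangle[OF assms end_in_H[OF closed]]
    dist_H_triangle[OF assms(2,1) end_in_H[OF closed]] graph_dist_sym[of H y x] by auto

lemma closed_base_edge:
  assumes "p 0 \<noteq> p n" "x \<in> closed_edge H {p 0, p n}"
  shows "dist_start x + dist_end x = base_len"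
proof -
  have e: "{p 0, p n} \<in> edges H" using base assms by simp
  obtain t where t: "x = edge_point (p 0) (p n) t" "t \<in> {0..1}"
    using closed_edge_eq[OF wf_H e] assms by auto
  have "dist_start x \<le> base_len * t"
    using graph_dist_edge_point_le[OF wf_H e t(2), of 0] t assms by (simp add: base_len_def)
  moreover have "dist_end x \<le> base_len * (1 - t)"
    using graph_dist_edge_point_le[OF wf_H e t(2), of 1] t assms by (simp add: base_len_def)
  ultimately have "dist_start x + dist_end x \<le> base_len" by (simp add: algebra_simps)
  moreover have "x \<in> realization H" using assms closed_edge_subset_realization by blast
  ultimately show ?thesis using triangles(3) by force
qed

lemma base_point_exists:
  assumes "0 \<le> r" "r \<le> base_len"
  obtains x where "x \<in> realization H" "dist_start x = r" "dist_end x = base_len - r"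
proof (cases "p 0 = p n")
  case True
  then have "r = 0" using assms by (simp add: base_len_def)
  then show ?thesis
    using that[OF start_in_H] True graph_dist_refl[OF H start_in_H] by (simp add: base_len_def)
next
  case False
  then have e: "{p 0, p n} \<in> edges H" using base by simp
  then have pos: "0 < base_len" using wf_graph_edgeD(4)[OF wf_H e] False by (simp add: base_len_def)
  define t where "t = r / base_len"
  have t: "t \<in> {0..1}" "base_len * t = r" using assms pos by (auto simp: t_def)
  define x where "x = edge_point (p 0) (p n) t"
  have xe: "x \<in> closed_edge H {p 0, p n}" using closed_edge_eq[OF wf_H e] t by (simp add: x_def)
  have "dist_start x \<le> r"
    using graph_dist_edge_point_le[OF wf_H e t(1), of 0] t False by (simp add: x_def base_len_def)
  moreover have "dist_end x \<le> base_len * (1 - t)"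
    using graph_dist_edge_point_le[OF wf_H e t(1), of 1] t False by (simp add: base_len_def x_def)
  then have "dist_end x \<le> base_len - r" using t by (simp add: algebra_simps)
  moreover have "dist_start x + dist_end x = base_len" using closed_base_edge[OF False xe] .
  ultimately show ?thesis using that[of x] xe closed_edge_subset_realization by force
qed

text \<open>If \<open>x1\<close> reaches \<open>x2\<close> and \<open>x4\<close> through the same
  end of the ear, the two routes overlap. If it uses different ends, crossing the base instead of
  the ear connects \<open>x2\<close> to \<open>x4\<close> more cheaply, as the base is shorter than
  \<open>total\<close>. Either way they are less than \<open>2 * s\<close> apart.\<close>

lemma square_one:
  assumes sq: "square_tuple (graph_dist G) s x1 x2 x3 x4" and s: "0 < s"
    and t: "path_at x1 t" "0 < t" "t < total"
    and x: "x2 \<in> realization H" "x4 \<in> realization H"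
  shows False
proof -
  have "s = min (dist_start x2 + t) (dist_end x2 + (total - t))"
    "s = min (dist_start x4 + t) (dist_end x4 + (total - t))" "graph_dist H x2 x4 = 2 * s"
    using sq dist_PH[OF x(1) t(1)] dist_HP[OF x(2) t(1)] dist_HH[OF x] by (auto simp: square_tuple_def)
  then show False
    using triangles2[OF x] triangles[OF x(1)] triangles[OF x(2)] s t base_len
    by (auto simp: min_def split: if_splits)
qed

text \<open>The corner \<open>x1\<close> comes first on the path, so it reaches \<open>x4\<close>
  through \<open>p 0\<close>, while \<open>x2\<close> reaches \<open>x3\<close> through
  \<open>p n\<close>. Any other route for a side would bring two opposite corners closer than
  \<open>2 * s\<close>.\<close>

lemma square_adjacent_arith:
  assumes sq: "square_tuple (graph_dist G) s x1 x2 x3 x4" and s: "0 < s"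
    and t1: "path_at x1 t1" "0 < t1" and t2: "path_at x2 t2" "t2 < total"
    and x: "x3 \<in> realization H" "x4 \<in> realization H" and le: "t1 \<le> t2"
  shows "t2 - t1 = s" "dist_start x4 = s - t1" "dist_end x3 = s - total + t2"
    "dist_start x3 = 2 * s - t1" "dist_end x4 = 2 * s - total + t2" "s \<le> base_len"
proof -
  have eqs: "s = min (t2 - t1) (ear_len - (t2 - t1))"
    "s = min (dist_start x3 + t2) (dist_end x3 + (total - t2))"
    "s = min (dist_start x4 + t1) (dist_end x4 + (total - t1))"
    "2 * s = min (dist_start x3 + t1) (dist_end x3 + (total - t1))"
    "2 * s = min (dist_start x4 + t2) (dist_end x4 + (total - t2))"
    "graph_dist H x3 x4 = s"
    using sq dist_PP[OF t1(1) t2(1)] dist_PH[OF x(1) t1(1)] dist_PH[OF x(1) t2(1)]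
      dist_HP[OF x(2) t1(1)] dist_PH[OF x(2) t2(1)] dist_HH[OF x] le
    by (auto simp: square_tuple_def ear_len_def add.commute)
  note tri = triangles2[OF x] triangles[OF x(1)] triangles[OF x(2)]
  have 1: "t2 - t1 = s"
  proof (rule ccontr)
    assume "t2 - t1 \<noteq> s"
    then have "s = ear_len - (t2 - t1)" using eqs(1) by linarith
    moreover have "s = dist_start x4 + t1 \<or> s = dist_end x4 + (total - t1)" using eqs(3) by linarith
    moreover have "2 * s \<le> dist_end x4 + (total - t2)" using eqs(5) by linarith
    ultimately show False using tri s t1 t2 le unfolding ear_len_def by linarith
  qed
  have 2: "dist_end x3 = s - total + t2"
    using eqs(2,4) 1 s by linarith
  have 3: "dist_start x4 = s - t1"
    using eqs(3,5) 1 s by linarith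
  have 4: "dist_start x3 = 2 * s - t1" using eqs(4,6) 3 tri(3) by linarith
  have 5: "dist_end x4 = 2 * s - total + t2" using eqs(5,6) 2 tri(6) by linarith
  show "t2 - t1 = s" "dist_start x4 = s - t1" "dist_end x3 = s - total + t2"
    "dist_start x3 = 2 * s - t1" "dist_end x4 = 2 * s - total + t2" by fact+
  \<comment> \<open>The differences \<open>dist_start x3 - dist_end x3\<close> and
    \<open>dist_end x4 - dist_start x4\<close> are at most \<open>base_len\<close> each and add up
    to \<open>2 * s\<close>.\<close>
  show "s \<le> base_len" using 1 2 3 4 5 tri by linarith
qed

text \<open>If neither \<open>x3\<close> nor \<open>x4\<close> lies on the base edge, then the sides of the square are as long as the
  base edge, and the midpoint of \<open>x3\<close> and \<open>x4\<close> violates the shortness of the base edge.\<close>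

lemma square_adjacent_le:
  assumes sq: "square_tuple (graph_dist G) s x1 x2 x3 x4" and s: "0 < s"
    and t1: "path_at x1 t1" "0 < t1" and t2: "path_at x2 t2" "t2 < total"
    and x: "x3 \<in> realization H" "x4 \<in> realization H" and le: "t1 \<le> t2"
  shows "4 * s = ear_len"
proof (rule ccontr)
  assume ne: "4 * s \<noteq> ear_len"
  note ar = square_adjacent_arith[OF assms]
  have bp: "0 < base_len" using ar(6) s by linarith
  then have nb: "p 0 \<noteq> p n" by (auto simp: base_len_def)
  then have far: "y \<in> closed_edge H {p 0, p n} \<or> \<bar>dist_start y - dist_end y\<bar> = base_len \<or>
      2 * base_len < dist_start y + dist_end y" if "y \<in> realization H" for y
    using base short that unfolding short_edges_def base_len_def by auto
  have sum: "dist_start x3 + dist_end x3 = 4 * s - total" "dist_start x4 + dist_end x4 = 4 * s - total"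
    using ar by linarith+
  \<comment> \<open>On the base edge the two distances sum to \<open>base_len\<close>, and
    \<open>sum\<close> would then give \<open>4 * s = ear_len\<close>.\<close>
  have "x3 \<notin> closed_edge H {p 0, p n}" "x4 \<notin> closed_edge H {p 0, p n}"
    using closed_base_edge[OF nb] sum ne unfolding ear_len_def by force+
  then have "\<bar>dist_start x3 - dist_end x3\<bar> = base_len" "\<bar>dist_start x4 - dist_end x4\<bar> = base_len"
    using far[OF x(1)] far[OF x(2)] sum ar(6) base_len by linarith+
  then have sb: "s = base_len" "dist_start x3 = dist_end x3 + base_len"
    "dist_end x4 = dist_start x4 + base_len"
    using ar bp s by linarith+
  have sx: "dist_end x3 = dist_start x4" "2 * dist_start x4 = 3 * base_len - total"
    using sb sum by linarith+
  have "dist_start x4 \<noteq> 0" using sx sb(1) ne unfolding ear_len_def by linarith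
  then have pos: "0 < dist_start x4" using triangles(1)[OF x(2)] by linarith
  \<comment> \<open>An exact midpoint would have distance
    \<open>base_len / 2 + dist_start x4\<close> from both ends of the base. The three quantities are
    the slacks in the comparisons below, and a quarter of the least one absorbs the error of the
    approximate midpoint.\<close>
  define \<epsilon> where "\<epsilon> = min (dist_start x4) (min base_len (total - 2 * base_len)) / 4"
  have \<epsilon>: "0 < \<epsilon>" "4 * \<epsilon> \<le> dist_start x4" "4 * \<epsilon> \<le> base_len" "4 * \<epsilon> \<le> total - 2 * base_len"
    using pos bp base_len by (auto simp: \<epsilon>_def)
  obtain y where y: "y \<in> realization H" "graph_dist H x3 y \<le> graph_dist H x3 x4 / 2 + \<epsilon>"
    "graph_dist H y x4 \<le> graph_dist H x3 x4 / 2 + \<epsilon>"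
    using approximate_midpoint[OF H x \<epsilon>(1)] .
  have d34: "graph_dist H x3 x4 = base_len"
    using sq dist_HH[OF x] sb by (simp add: square_tuple_def)
  note tri = triangles2[OF x(1) y(1)] triangles2[OF y(1) x(2)]
  have "\<bar>dist_start y - dist_end y\<bar> < base_len" "dist_start y + dist_end y \<le> 2 * base_len"
    using tri y(2,3) d34 sb sx \<epsilon> by linarith+
  \<comment> \<open>The other two alternatives for \<open>y\<close> are ruled out. But the sum of
    its distances to the ends exceeds \<open>base_len\<close> by nearly
    \<open>2 * dist_start x4\<close>, so it cannot be on the edge either.\<close>
  then have "y \<in> closed_edge H {p 0, p n}" using far[OF y(1)] by linarith
  then have "dist_start y + dist_end y = base_len" using closed_base_edge[OF nb] by simp
  then show False using tri y(2,3) d34 sb sx \<epsilon> by linarith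
qed

lemma square_adjacent:
  assumes sq: "square_tuple (graph_dist G) s x1 x2 x3 x4" and s: "0 < s"
    and t1: "path_at x1 t1" "0 < t1" "t1 < total" and t2: "path_at x2 t2" "0 < t2" "t2 < total"
    and x: "x3 \<in> realization H" "x4 \<in> realization H"
  shows "4 * s = ear_len"
proof (cases "t1 \<le> t2")
  case True
  then show ?thesis using square_adjacent_le[OF sq s t1(1,2) t2(1,3) x] by simp
next
  case False
  then show ?thesis
    using square_adjacent_le[OF square_tuple_reflect[OF sq] s t2(1,2) t1(1,3) x(2,1)] by simp
qed

lemma square_three:
  assumes sq: "square_tuple (graph_dist G) s x1 x2 x3 x4" and s: "0 < s"
    and t1: "path_at x1 t1" "0 < t1" "t1 < total" and t2: "path_at x2 t2" "0 < t2" "t2 < total"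
    and t3: "path_at x3 t3" "0 < t3" "t3 < total" and x: "x4 \<in> realization H"
  shows "4 * s = ear_len"
proof -
  have *: "4 * s = ear_len"
    if sq: "square_tuple (graph_dist G) s x1 x2 x3 x4"
      and t1: "path_at x1 t1" "0 < t1" "t1 < total" and t2: "path_at x2 t2"
      and t3: "path_at x3 t3" "0 < t3" "t3 < total" and le: "t1 \<le> t3" for x1 x3 t1 t3
  proof -
    have eqs: "s = min \<bar>t1 - t2\<bar> (ear_len - \<bar>t1 - t2\<bar>)" "s = min \<bar>t2 - t3\<bar> (ear_len - \<bar>t2 - t3\<bar>)"
      "2 * s = min (t3 - t1) (ear_len - (t3 - t1))"
      "s = min (dist_start x4 + t1) (dist_end x4 + (total - t1))"
      "s = min (dist_start x4 + t3) (dist_end x4 + (total - t3))"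
      "2 * s = min (dist_start x4 + t2) (dist_end x4 + (total - t2))"
      using sq dist_PP[OF t1(1) t2] dist_PP[OF t2 t3(1)] dist_PP[OF t1(1) t3(1)]
        dist_HP[OF x t1(1)] dist_PH[OF x t3(1)] dist_PH[OF x t2] le
      by (auto simp: square_tuple_def ear_len_def add.commute)
    \<comment> \<open>\<open>x4\<close> reaches \<open>x1\<close> and \<open>x3\<close> through
      different ends: through the same end, equal distances would force
      \<open>t1 = t3\<close>.\<close>
    have 1: "dist_start x4 + t1 = s" "dist_end x4 + (total - t3) = s" using eqs(3,4,5) s by linarith+
    have 2: "t1 \<le> t2" using eqs(6) 1 s by linarith
    have 3: "t2 \<le> t3" using eqs(6) 1 s by linarith
    \<comment> \<open>The arc from \<open>x1\<close> to \<open>x3\<close> through the base is no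
      longer than the route over \<open>x4\<close>. Hence both arcs between these opposite corners
      have length \<open>2 * s\<close>.\<close>
    have 4: "ear_len - (t3 - t1) \<le> 2 * s" using 1 triangles(3)[OF x] unfolding ear_len_def by linarith
    have "t2 - t1 = s" "t3 - t2 = s" using eqs(1,2,3) 2 3 4 s by linarith+
    then show ?thesis using eqs(3) 4 by linarith
  qed
  show ?thesis
  proof (cases "t1 \<le> t3")
    case True
    then show ?thesis using *[OF sq t1 t2(1) t3] by simp
  next
    case False
    have "square_tuple (graph_dist G) s x3 x2 x1 x4"
      using sq graph_dist_sym[of G] by (auto simp: square_tuple_def)
    then show ?thesis using *[of x3 x1 t3 t1] t1 t2(1) t3 False by simp
  qed
qed

text \<open>All distances are those of a circle of length \<open>ear_len\<close>. A diagonal gives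
  \<open>4 * s\<close> at most this length; if it were smaller, the four sides would be steps of one
  orientation that never close up.\<close>

lemma square_four:
  assumes sq: "square_tuple (graph_dist G) s x1 x2 x3 x4" and s: "0 < s"
    and t: "path_at x1 t1" "path_at x2 t2" "path_at x3 t3" "path_at x4 t4"
  shows "4 * s = ear_len"
proof -
  note r = path_at_range[OF t(1)] path_at_range[OF t(2)] path_at_range[OF t(3)] path_at_range[OF t(4)]
  have PP: "graph_dist G x y = min \<bar>t - t'\<bar> (ear_len - \<bar>t - t'\<bar>)"
    if "path_at x t" "path_at y t'" for x y t t'
    using dist_PP[OF that] by (simp add: ear_len_def add.commute)
  have D: "graph_dist G x1 x2 = s" "graph_dist G x2 x3 = s" "graph_dist G x3 x4 = s"
    "graph_dist G x4 x1 = s" "graph_dist G x1 x3 = 2 * s" "graph_dist G x2 x4 = 2 * s"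
    using sq by (auto simp: square_tuple_def)
  have eqs: "s = min \<bar>t1 - t2\<bar> (ear_len - \<bar>t1 - t2\<bar>)" "s = min \<bar>t2 - t3\<bar> (ear_len - \<bar>t2 - t3\<bar>)"
    "s = min \<bar>t3 - t4\<bar> (ear_len - \<bar>t3 - t4\<bar>)" "s = min \<bar>t4 - t1\<bar> (ear_len - \<bar>t4 - t1\<bar>)"
    "2 * s = min \<bar>t1 - t3\<bar> (ear_len - \<bar>t1 - t3\<bar>)" "2 * s = min \<bar>t2 - t4\<bar> (ear_len - \<bar>t2 - t4\<bar>)"
    using D[THEN sym] by (simp_all only: PP[OF t(1,2)] PP[OF t(2,3)] PP[OF t(3,4)] PP[OF t(4,1)]
        PP[OF t(1,3)] PP[OF t(2,4)])
  have l: "total \<le> ear_len" using base_len by (simp add: ear_len_def)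
  have "4 * s \<le> ear_len" using eqs(5) by linarith
  moreover have "\<not> 4 * s < ear_len"
  proof
    assume less: "4 * s < ear_len"
    \<comment> \<open>A step by \<open>s\<close> in the positive direction of the circle, read off
      in path parameters: the second form occurs when the step passes the base and the parameter
      starts again.\<close>
    define fwd where "fwd a b \<longleftrightarrow> b - a = s \<or> b - a = s - ear_len" for a b
    have "fwd t1 t2 \<and> fwd t2 t3 \<or> fwd t2 t1 \<and> fwd t3 t2"
      using circle_orientation[OF eqs(1,2,5) s less] by (simp add: fwd_def)
    moreover have "fwd t2 t3 \<and> fwd t3 t4 \<or> fwd t3 t2 \<and> fwd t4 t3"
      using circle_orientation[OF eqs(2,3,6) s less] by (simp add: fwd_def)
    moreover have "fwd t3 t4 \<and> fwd t4 t1 \<or> fwd t4 t3 \<and> fwd t1 t4"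
      using circle_orientation[OF eqs(3,4) _ s less] eqs(5)
      by (simp add: fwd_def abs_minus_commute)
    moreover have "\<not> (fwd t2 t3 \<and> fwd t3 t2)" "\<not> (fwd t3 t4 \<and> fwd t4 t3)"
      using s less unfolding fwd_def by linarith+
    \<comment> \<open>The four parameter differences sum to 0. At least one step passes the base, so
      the sum is at most \<open>4 * s - ear_len\<close>, which is negative.\<close>
    moreover have cycle: "\<not> (fwd a b \<and> fwd b c \<and> fwd c d \<and> fwd d a)" for a b c d
    proof
      assume fwd: "fwd a b \<and> fwd b c \<and> fwd c d \<and> fwd d a"
      have le: "y - x \<le> s" if "fwd x y" for x y using that s less by (auto simp: fwd_def)
      have "b - a \<le> s" "c - b \<le> s" "d - c \<le> s" "a - d \<le> s" using fwd le by blast+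
      moreover have "b - a = s - ear_len \<or> c - b = s - ear_len \<or> d - c = s - ear_len \<or> a - d = s - ear_len"
      proof (rule ccontr)
        assume "\<not> ?thesis"
        then have "b - a = s" "c - b = s" "d - c = s" "a - d = s" using fwd unfolding fwd_def by blast+
        then show False using s by linarith
      qed
      ultimately show False using less by linarith
    qed
    ultimately show False using cycle[of t1 t2 t3 t4] cycle[of t4 t3 t2 t1] by argo
  qed
  ultimately show ?thesis by simp
qed

end

text \<open>Arithmetic behind the persistence of \<open>short_edges\<close> for an old edge with
  endpoints \<open>u\<close>, \<open>w\<close> and length \<open>c0\<close>: \<open>Au\<close>,
  \<open>Aw\<close> and \<open>Bu\<close>, \<open>Bw\<close> are the distances of the endpoints from
  the start and the end of the ear, \<open>c\<close> is the base length, \<open>q\<close> the length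
  of the ear, and \<open>t\<close> the position of a point on it. Routes through the same end just
  shift an alternative; only routes through different ends need an argument.\<close>

lemma far_point_arith:
  fixes c0 c q t Au Aw Bu Bw :: real
  assumes s: "\<bar>Au - Aw\<bar> = c0 \<or> 2 * c0 < Au + Aw" and e: "\<bar>Bu - Bw\<bar> = c0 \<or> 2 * c0 < Bu + Bw"
    and tri: "Au \<le> Bu + c" "Bu \<le> Au + c" "Aw \<le> Bw + c" "Bw \<le> Aw + c"
    and lip: "\<bar>Au - Aw\<bar> \<le> c0" "\<bar>Bu - Bw\<bar> \<le> c0"
    and nn: "0 \<le> Au" "0 \<le> Aw" "0 \<le> Bu" "0 \<le> Bw"
    and q: "0 \<le> c" "2 * c < q" and t: "0 \<le> t" "t \<le> q"
    and a: "a = min (Au + t) (Bu + (q - t))" and b: "b = min (Aw + t) (Bw + (q - t))"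
  shows "\<bar>a - b\<bar> = c0 \<or> 2 * c0 < a + b"
proof -
  have mixed: "\<bar>a - b\<bar> = c0 \<or> 2 * c0 < a + b"
    if "\<bar>Au - Aw\<bar> = c0 \<or> 2 * c0 < Au + Aw" "\<bar>Bu - Bw\<bar> = c0 \<or> 2 * c0 < Bu + Bw"
      "Au \<le> Bu + c" "Bu \<le> Au + c" "Aw \<le> Bw + c" "Bw \<le> Aw + c"
      "\<bar>Au - Aw\<bar> \<le> c0" "\<bar>Bu - Bw\<bar> \<le> c0"
      "0 \<le> Au" "0 \<le> Bw" "a = Au + t" "b = Bw + (q - t)" "a \<le> Bu + (q - t)" "b \<le> Aw + t"
    for a b Au Aw Bu Bw
  proof (rule ccontr)
    assume "\<not> ?thesis"
    then have n: "\<bar>a - b\<bar> \<noteq> c0" "a + b \<le> 2 * c0" by auto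
    have le: "a - b \<le> c0" "b - a \<le> c0" using that by linarith+
    then have lt: "a - b < c0" "b - a < c0" using n by linarith+
    have sum: "Au + Bw + q \<le> 2 * c0" using n that by linarith
    have 1: "\<not> 2 * c0 < Au + Aw" using sum that q by linarith
    have 2: "\<not> 2 * c0 < Bu + Bw" using sum that q by linarith
    have 3: "Au - Aw \<noteq> c0" using lt that by linarith
    have 4: "Bw - Bu \<noteq> c0" using lt that by linarith
    \<comment> \<open>With this, adding \<open>Aw <= Bw + c\<close> and \<open>Bu <= Au + c\<close>
      gives \<open>c0 <= c\<close>; but \<open>sum\<close> gives \<open>q <= 2 * c0\<close>, against
      \<open>2 * c < q\<close>.\<close>
    have "Aw = Au + c0" "Bu = Bw + c0" using that(1,2) 1 2 3 4 by linarith+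
    then show False using sum that q by linarith
  qed
  consider "a = Au + t" "b = Aw + t" | "a = Bu + (q - t)" "b = Bw + (q - t)"
    | "a = Au + t" "b = Bw + (q - t)" | "a = Bu + (q - t)" "b = Aw + t"
    using a b by linarith
  then show ?thesis
  proof cases
    case 1 then show ?thesis using s t by linarith
  next
    case 2 then show ?thesis using e t by linarith
  next
    case 3
    then show ?thesis using mixed[of Au Aw Bu Bw a b] s e tri lip nn a b by simp
  next
    case 4
    have "\<bar>b - a\<bar> = c0 \<or> 2 * c0 < b + a"
      using mixed[of Aw Au Bw Bu b a] s e tri lip nn a b 4 by (simp add: abs_minus_commute add.commute)
    then show ?thesis by linarith
  qed
qed

section \<open>Attaching an ear: the new square, and the persistence of short edges\<close>

context attached_ear
begin

lemma ear_square: "has_square G (ear_len / 4)"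
proof -
  let ?l = ear_len
  have l: "?l = total + base_len" "0 < ?l" "base_len \<le> ?l / 3" "?l / 2 \<le> total"
    using base_len total_pos by (auto simp: ear_len_def)
  obtain x2 where x2: "path_at x2 (?l / 4)" using path_at_exists[of "?l / 4"] l by auto
  obtain x3 where x3: "path_at x3 (?l / 2)" using path_at_exists[of "?l / 2"] l by auto
  have PP: "graph_dist G x y = min \<bar>t - t'\<bar> (?l - \<bar>t - t'\<bar>)"
    if "path_at x t" "path_at y t'" for x y t t'
    using dist_PP[OF that] by (simp add: ear_len_def add.commute)
  have R: "start_point \<in> realization G" "x2 \<in> realization G" "x3 \<in> realization G"
    using path_at_realization path_at_start x2 x3 by blast+
  have 1: "graph_dist G start_point x2 = ?l / 4" "graph_dist G x2 x3 = ?l / 4"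
    "graph_dist G start_point x3 = 2 * (?l / 4)"
    using PP[OF path_at_start x2] PP[OF x2 x3] PP[OF path_at_start x3] l(2) by linarith+
  show ?thesis
  proof (cases "3 * ?l / 4 \<le> total")
    case True
    then obtain x4 where x4: "path_at x4 (3 * ?l / 4)" using path_at_exists[of "3 * ?l / 4"] l by auto
    have "graph_dist G x3 x4 = ?l / 4" "graph_dist G x4 start_point = ?l / 4"
      "graph_dist G x2 x4 = 2 * (?l / 4)"
      using PP[OF x3 x4] PP[OF x4 path_at_start] PP[OF x2 x4] l(2) by linarith+
    then have "square_tuple (graph_dist G) (?l / 4) start_point x2 x3 x4"
      using 1 by (simp add: square_tuple_def)
    then show ?thesis using R path_at_realization[OF x4] unfolding has_square_def by blast
  next
    case False
    \<comment> \<open>The corner at three quarters of the circle falls onto the base, where it is at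
      distance \<open>?l / 4\<close> from \<open>start_point\<close>, measured backwards.\<close>
    then have r: "0 \<le> ?l / 4" "?l / 4 \<le> base_len" using l by linarith+
    obtain x4 where x4: "x4 \<in> realization H" "dist_start x4 = ?l / 4" "dist_end x4 = base_len - ?l / 4"
      using base_point_exists[OF r] .
    have "graph_dist G x3 x4 = ?l / 4" "graph_dist G x4 start_point = ?l / 4"
      "graph_dist G x2 x4 = 2 * (?l / 4)"
      using dist_PH[OF x4(1) x3] dist_HH[OF x4(1) start_in_H] dist_PH[OF x4(1) x2] x4 l False by linarith+
    then have "square_tuple (graph_dist G) (?l / 4) start_point x2 x3 x4"
      using 1 by (simp add: square_tuple_def)
    then show ?thesis using R H_in_G[OF x4(1)] unfolding has_square_def by blast
  qed
qed

lemma has_square_ear: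
  assumes s: "0 < s"
  shows "has_square G s \<longleftrightarrow> has_square H s \<or> 4 * s = ear_len"
proof
  assume "has_square G s"
  then obtain x1 x2 x3 x4 where x: "x1 \<in> realization G" "x2 \<in> realization G" "x3 \<in> realization G"
    "x4 \<in> realization G" and sq: "square_tuple (graph_dist G) s x1 x2 x3 x4"
    by (auto simp: has_square_def)
  define E where "E y \<longleftrightarrow> (\<exists>t. path_at y t \<and> 0 < t \<and> t < total)" for y
  have HE: "y \<in> realization H \<or> E y" if "y \<in> realization G" for y
    using G_cases_closed[OF that closed] by (auto simp: E_def)
  note sq2 = square_tuple_rotate[OF sq]
  note sq3 = square_tuple_rotate[OF sq2]
  note sq4 = square_tuple_rotate[OF sq3]
  have one: False if "square_tuple (graph_dist G) s y1 y2 y3 y4" "E y1" "y2 \<in> realization H" "y4 \<in> realization H"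
    for y1 y2 y3 y4 using square_one[OF that(1) s] that(2-4) unfolding E_def by blast
  have two: "4 * s = ear_len"
    if "square_tuple (graph_dist G) s y1 y2 y3 y4" "E y1" "E y2" "y3 \<in> realization H" "y4 \<in> realization H"
    for y1 y2 y3 y4 using square_adjacent[OF that(1) s] that(2-5) unfolding E_def by blast
  have three: "4 * s = ear_len"
    if "square_tuple (graph_dist G) s y1 y2 y3 y4" "E y1" "E y2" "E y3" "y4 \<in> realization H"
    for y1 y2 y3 y4 using square_three[OF that(1) s] that(2-5) unfolding E_def by blast
  have four: "4 * s = ear_len" if "E x1" "E x2" "E x3" "E x4"
    using square_four[OF sq s] that unfolding E_def by blast
  \<comment> \<open>Up to rotation, \<open>two\<close>, \<open>three\<close> and \<open>four\<close>
    treat two or more ear corners with an adjacent pair among them. In \<open>one\<close> the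
    opposite corner is arbitrary, so it covers a single ear corner as well as two opposite
    ones.\<close>
  have "4 * s = ear_len \<or> x1 \<in> realization H \<and> x2 \<in> realization H \<and> x3 \<in> realization H \<and> x4 \<in> realization H"
    using HE[OF x(1)] HE[OF x(2)] HE[OF x(3)] HE[OF x(4)]
      one[OF sq] one[OF sq2] one[OF sq3] one[OF sq4] two[OF sq] two[OF sq2] two[OF sq3] two[OF sq4]
      three[OF sq] three[OF sq2] three[OF sq3] three[OF sq4] four by argo
  then show "has_square H s \<or> 4 * s = ear_len"
    using sq square_tuple_cong[of "realization H" "graph_dist G" "graph_dist H" x1 x2 x3 x4 s, OF dist_HH]
    unfolding has_square_def by blast
next
  assume "has_square H s \<or> 4 * s = ear_len"
  then show "has_square G s"
  proof
    assume "has_square H s"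
    then obtain x1 x2 x3 x4 where x: "x1 \<in> realization H" "x2 \<in> realization H" "x3 \<in> realization H"
      "x4 \<in> realization H" and sq: "square_tuple (graph_dist H) s x1 x2 x3 x4"
      by (auto simp: has_square_def)
    then show "has_square G s"
      using square_tuple_cong[of "realization H" "graph_dist G" "graph_dist H" x1 x2 x3 x4 s,
          OF dist_HH] x[THEN H_in_G] unfolding has_square_def by blast
  next
    assume "4 * s = ear_len"
    then have "s = ear_len / 4" by simp
    then show "has_square G s" using ear_square by (simp only:)
  qed
qed

text \<open>From a point off a new edge of length \<open>c\<close>, the routes to its endpoints
  either use the same side, with difference \<open>c\<close>, or different sides; then the distances
  sum to at least \<open>ear_len - c\<close>, which exceeds \<open>2 * c\<close> by
  \<open>new_short\<close>.\<close>

lemma short_edges_ear: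
  assumes new_short: "\<And>i. i < n \<Longrightarrow> {p i, p (Suc i)} \<in> B \<Longrightarrow> 3 * elen G {p i, p (Suc i)} < ear_len"
  shows "short_edges B G"
  unfolding short_edges_def
proof (intro allI impI)
  fix u w assume e: "{u, w} \<in> B \<and> {u, w} \<in> edges G"
  let ?c = "elen G {u, w}" and ?d = "graph_dist G"
  show "?d (vertex_point u) (vertex_point w) = ?c \<and>
    (\<forall>x\<in>realization G. x \<in> closed_edge G {u, w} \<or>
      \<bar>?d x (vertex_point u) - ?d x (vertex_point w)\<bar> = ?c \<or>
      2 * ?c < ?d x (vertex_point u) + ?d x (vertex_point w))"
  proof (cases "{u, w} \<in> edges H")
    case True
    note uw = wf_graph_edgeD[OF wf_H True]
    let ?u = "vertex_point u" and ?w = "vertex_point w"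
    have R: "?u \<in> realization H" "?w \<in> realization H" using uw wf_H by auto
    have HH: "graph_dist H ?u ?w = elen H {u, w}"
      "\<And>x. x \<in> realization H \<Longrightarrow> x \<in> closed_edge H {u, w} \<or>
        \<bar>graph_dist H x ?u - graph_dist H x ?w\<bar> = elen H {u, w} \<or>
        2 * elen H {u, w} < graph_dist H x ?u + graph_dist H x ?w"
      using short e True unfolding short_edges_def by blast+
    have far: "x \<in> closed_edge G {u, w} \<or>
      \<bar>?d x ?u - ?d x ?w\<bar> = ?c \<or> 2 * ?c < ?d x ?u + ?d x ?w" if "x \<in> realization H" for x
      using HH(2)[OF that] by (simp add: old_edge[OF True] dist_HH[OF that R(1)] dist_HH[OF that R(2)])
    have c: "?d ?u ?w = ?c"
      using HH(1) by (simp add: old_edge[OF True] dist_HH[OF R])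
    \<comment> \<open>The ear is attached at vertices. A vertex on the old edge is one of its
      endpoints and so satisfies the second alternative, which disposes of the first one.\<close>
    have vertex: "\<bar>graph_dist H ?u (vertex_point v) - graph_dist H ?w (vertex_point v)\<bar> = ?c \<or>
        2 * ?c < graph_dist H ?u (vertex_point v) + graph_dist H ?w (vertex_point v)"
      if v: "v \<in> verts H" for v
    proof -
      have vR: "vertex_point v \<in> realization H" using v wf_H by simp
      have "\<bar>graph_dist H (vertex_point v) ?u - graph_dist H (vertex_point v) ?w\<bar> = ?c"
        if "vertex_point v \<in> closed_edge H {u, w}"
      proof -
        have "v = u \<or> v = w" using that vertex_point_in_closed_edge[OF wf_H True] by auto
        then show ?thesis
          using HH(1) graph_dist_refl[OF H R(1)] graph_dist_refl[OF H R(2)] uw(4)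
            graph_dist_sym[of H ?w ?u] old_edge(1)[OF True] by auto
      qed
      then show ?thesis using HH(2)[OF vR] old_edge(1)[OF True]
        unfolding graph_dist_sym[of H "vertex_point v"] by auto
    qed
    have "\<bar>?d x ?u - ?d x ?w\<bar> = ?c \<or> 2 * ?c < ?d x ?u + ?d x ?w" if x: "path_at x t" for x t
    proof (rule far_point_arith[OF vertex[OF p0] vertex[OF closed]])
      show "?d x ?u = min (dist_start ?u + t) (dist_end ?u + (total - t))"
        "?d x ?w = min (dist_start ?w + t) (dist_end ?w + (total - t))"
        using dist_PH[OF R(1) x] dist_PH[OF R(2) x] by auto
      show "\<bar>dist_start ?u - dist_start ?w\<bar> \<le> ?c" "\<bar>dist_end ?u - dist_end ?w\<bar> \<le> ?c"
        using triangles2[OF R] HH(1) old_edge(1)[OF True] by auto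
    qed (use triangles[OF R(1)] triangles[OF R(2)] base_len path_at_range[OF x] in auto)
    then show ?thesis using far c realization_G_cases by blast
  next
    case False
    then obtain i where i: "i < n" "{u, w} = {p i, p (Suc i)}" using e eG by auto
    let ?a = "vertex_point (p i)" and ?b = "vertex_point (p (Suc i))"
    have c: "?c = step_len i" "0 < step_len i" "3 * step_len i < ear_len"
      using i new_short[OF i(1)] e step_len_pos[OF i(1)] by (auto simp: step_len_def)
    have a: "path_at ?a (pos_of i)" and b: "path_at ?b (pos_of i + step_len i)"
      using path_at_vertex[of i] path_at_vertex[of "Suc i"] i by (auto simp: pos_of_Suc)
    note r = path_at_range[OF a] path_at_range[OF b]
    have l: "ear_len = total + base_len" by (simp add: ear_len_def)
    have PP: "graph_dist G x y = min \<bar>t - t'\<bar> (ear_len - \<bar>t - t'\<bar>)"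
      if "path_at x t" "path_at y t'" for x y t t'
      using dist_PP[OF that] by (simp add: ear_len_def add.commute)
    have ab: "?d ?a ?b = ?c" using PP[OF a b] c by simp
    have "x \<in> closed_edge G {u, w} \<or> \<bar>?d x ?a - ?d x ?b\<bar> = ?c \<or> 2 * ?c < ?d x ?a + ?d x ?b"
      if "x \<in> realization G" for x
      using realization_G_cases[OF that]
    proof
      assume x: "x \<in> realization H"
      have "?d x ?a = min (dist_start x + pos_of i) (dist_end x + (total - pos_of i))"
        "?d x ?b = min (dist_start x + (pos_of i + step_len i)) (dist_end x + (total - (pos_of i + step_len i)))"
        using dist_HP[OF x a] dist_HP[OF x b] by auto
      then show ?thesis using triangles(3)[OF x] l c by linarith
    next
      assume "\<exists>t. path_at x t"
      then obtain t where t: "path_at x t" by blast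
      show ?thesis
      proof (cases "pos_of i \<le> t \<and> t \<le> pos_of (Suc i)")
        case True
        then show ?thesis using path_at_in_closed_edge[OF t i(1)] i by simp
      next
        case False
        then show ?thesis
          using PP[OF t a] PP[OF t b] path_at_range[OF t] r l c base_len(1) unfolding pos_of_Suc by linarith
      qed
    qed
    moreover have "u = p i \<and> w = p (Suc i) \<or> u = p (Suc i) \<and> w = p i"
      using i by (simp add: doubleton_eq_iff)
    ultimately show ?thesis using ab graph_dist_sym[of G ?b ?a]
      by (metis abs_minus_commute add.commute)
  qed
qed

end

section \<open>Chains of low degree\<close>

text \<open>Chains of degree 0, 1 and 2 live on lists of length 1, 2 and 3. Passing to functions of
  one, two and three arguments turns the boundary into a plain sum over the first argument.\<close>

definition chain0 :: "('v \<Rightarrow> 'f::field) \<Rightarrow> 'v list \<Rightarrow> 'f" where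
  "chain0 g = (\<lambda>xs. case xs of [a] \<Rightarrow> g a | _ \<Rightarrow> 0)"

definition chain1 :: "('v \<Rightarrow> 'v \<Rightarrow> 'f::field) \<Rightarrow> 'v list \<Rightarrow> 'f" where
  "chain1 g = (\<lambda>xs. case xs of [a, b] \<Rightarrow> g a b | _ \<Rightarrow> 0)"

definition chain2 :: "('v \<Rightarrow> 'v \<Rightarrow> 'v \<Rightarrow> 'f::field) \<Rightarrow> 'v list \<Rightarrow> 'f" where
  "chain2 g = (\<lambda>xs. case xs of [a, b, c] \<Rightarrow> g a b c | _ \<Rightarrow> 0)"

lemma chain1_simps [simp]: "chain1 g [a, b] = g a b"
  by (simp add: chain1_def)

lemma chain1_other: "length xs \<noteq> 2 \<Longrightarrow> chain1 g xs = 0"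
  by (auto simp: chain1_def split: list.splits)

lemma chain2_simps [simp]: "chain2 g [a, b, c] = g a b c"
  by (simp add: chain2_def)

lemma chain2_other: "length xs \<noteq> 3 \<Longrightarrow> chain2 g xs = 0"
  by (auto simp: chain2_def split: list.splits)

lemma length2_iff: "length xs = 2 \<longleftrightarrow> (\<exists>a b. xs = [a, b])"
  by (auto simp: numeral_2_eq_2 length_Suc_conv)

lemma length3_iff: "length xs = 3 \<longleftrightarrow> (\<exists>a b c. xs = [a, b, c])"
  by (auto simp: numeral_3_eq_3 length_Suc_conv)

lemma chain1_eqI:
  assumes "\<And>a b. c [a, b] = g a b" "\<And>xs. length xs \<noteq> 2 \<Longrightarrow> c xs = 0"
  shows "c = chain1 g"
proof
  fix xs show "c xs = chain1 g xs"
  proof (cases "length xs = 2")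
    case True
    then show ?thesis using assms(1) by (auto simp: length2_iff)
  qed (simp add: assms(2) chain1_other)
qed

lemma chain1_cong_iff: "chain1 g = chain1 h \<longleftrightarrow> g = h"
  by (metis chain1_simps ext)

lemma chainsI:
  assumes "\<And>xs. c xs \<noteq> 0 \<Longrightarrow> length xs = Suc p \<and> distinct xs \<and> set xs \<in> K"
    and "\<And>xs u ys v zs. c (xs @ u # ys @ v # zs) = - c (xs @ v # ys @ u # zs)"
  shows "c \<in> chains p K"
  unfolding chains_def mem_Collect_eq using assms(1) by (intro conjI allI assms(2)) blast

lemma chains_support: "c \<in> chains p K \<Longrightarrow> c xs \<noteq> 0 \<Longrightarrow> length xs = Suc p \<and> distinct xs \<and> set xs \<in> K"
  unfolding chains_def mem_Collect_eq by (drule conjunct1) blast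

lemma chains_alternating:
  assumes "c \<in> chains p K"
  shows "c (xs @ u # ys @ v # zs) = - c (xs @ v # ys @ u # zs)"
  using assms unfolding chains_def mem_Collect_eq by (elim conjE allE) assumption

lemma chains1_eq:
  assumes "c \<in> chains 1 K"
  shows "c = chain1 (\<lambda>a b. c [a, b])"
  using assms by (intro chain1_eqI) (auto simp: chains_def)

lemma chain1_in_chains:
  "chain1 g \<in> chains 1 K \<longleftrightarrow>
    (\<forall>a b. g a b = - g b a) \<and> (\<forall>a b. g a b \<noteq> 0 \<longrightarrow> a \<noteq> b \<and> {a, b} \<in> K)"
    (is "?L \<longleftrightarrow> ?R")
proof
  assume L: ?L
  have 1: "\<forall>xs u ys v zs. chain1 g (xs @ u # ys @ v # zs) = - chain1 g (xs @ v # ys @ u # zs)"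
    and 2: "\<forall>xs. chain1 g xs \<noteq> 0 \<longrightarrow> length xs = Suc 1 \<and> distinct xs \<and> set xs \<in> K"
    using L unfolding chains_def mem_Collect_eq by (rule conjunct2, rule conjunct1)
  have "g a b = - g b a" for a b
    using 1[rule_format, of "[]" a "[]" b "[]"] by simp
  moreover have "g a b \<noteq> 0 \<longrightarrow> a \<noteq> b \<and> {a, b} \<in> K" for a b
    using 2[rule_format, of "[a, b]"] by simp
  ultimately show ?R by (intro conjI allI)
next
  assume R: ?R
  have "length xs = Suc 1 \<and> distinct xs \<and> set xs \<in> K" if "chain1 g xs \<noteq> 0" for xs
  proof -
    have "length xs = 2" using that chain1_other by blast
    then obtain a b where "xs = [a, b]" by (auto simp: length2_iff)
    then show ?thesis using that conjunct2[OF R] by simp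
  qed
  moreover have "chain1 g (xs @ u # ys @ v # zs) = - chain1 g (xs @ v # ys @ u # zs)" for xs u ys v zs
  proof (cases "xs = [] \<and> ys = [] \<and> zs = []")
    case True
    then show ?thesis using conjunct1[OF R, rule_format, of u v] by simp
  next
    case False
    then have "length xs + length ys + length zs \<noteq> 0" by auto
    then show ?thesis by (simp add: chain1_other)
  qed
  ultimately show ?L by (rule chainsI)
qed

lemma chain2_in_chains:
  assumes "\<And>a b c. g a b c = - g b a c" "\<And>a b c. g a b c = - g a c b"
    and "\<And>a b c. g a b c \<noteq> 0 \<Longrightarrow> distinct [a, b, c] \<and> {a, b, c} \<in> K"
  shows "chain2 g \<in> chains (Suc 1) K"
proof -
  have "length xs = Suc (Suc 1) \<and> distinct xs \<and> set xs \<in> K" if "chain2 g xs \<noteq> 0" for xs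
  proof -
    have "length xs = 3" using that chain2_other by blast
    then obtain a b c where "xs = [a, b, c]" by (auto simp: length3_iff)
    then show ?thesis using that assms(3)[of a b c] by simp
  qed
  moreover have "chain2 g (xs @ u # ys @ v # zs) = - chain2 g (xs @ v # ys @ u # zs)" for xs u ys v zs
  proof (cases "length xs + length ys + length zs = 1")
    case True
    then consider a where "xs = [a]" "ys = []" "zs = []" | a where "xs = []" "ys = [a]" "zs = []"
      | a where "xs = []" "ys = []" "zs = [a]"
      by (auto simp: add_is_1 length_Suc_conv)
    then show ?thesis
    proof cases
      case 1
      then show ?thesis using assms(2)[of a u v] by simp
    next
      case 2
      have "g u a v = - g v a u"
        using assms(1)[of u a v] assms(2)[of a u v] assms(1)[of a v u] by simp
      then show ?thesis using 2 by simp
    next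
      case 3
      then show ?thesis using assms(1)[of u v a] by simp
    qed
  next
    case False
    then show ?thesis by (simp add: chain2_other)
  qed
  ultimately show ?thesis by (rule chainsI)
qed

lemma boundary_chain1: "boundary K (chain1 g) = chain0 (\<lambda>b. \<Sum>v\<in>\<Union>K. g v b)"
  by (rule ext) (auto simp: boundary_def chain0_def chain1_def split: list.splits)

lemma boundary_chain2: "boundary K (chain2 g) = chain1 (\<lambda>a b. \<Sum>v\<in>\<Union>K. g v a b)"
  by (rule ext) (auto simp: boundary_def chain1_def chain2_def split: list.splits)

lemma chain0_eq_0: "chain0 g = (\<lambda>xs. 0) \<longleftrightarrow> (\<forall>a. g a = 0)"
proof
  assume "chain0 g = (\<lambda>xs. 0)"
  then have "chain0 g [a] = 0" for a by simp
  then show "\<forall>a. g a = 0" by (simp add: chain0_def)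
qed (auto simp: chain0_def split: list.splits)

definition cycle1 :: "'v set set \<Rightarrow> ('v \<Rightarrow> 'v \<Rightarrow> 'f::field) \<Rightarrow> bool" where
  "cycle1 K g \<longleftrightarrow> (\<forall>a b. g a b = - g b a) \<and> (\<forall>a b. g a b \<noteq> 0 \<longrightarrow> a \<noteq> b \<and> {a, b} \<in> K) \<and>
     (\<forall>b. (\<Sum>v\<in>\<Union>K. g v b) = 0)"

lemma chain1_in_cycles: "chain1 g \<in> cycles 1 K \<longleftrightarrow> cycle1 K g"
  unfolding cycles_def mem_Collect_eq chain1_in_chains boundary_chain1 chain0_eq_0 cycle1_def by blast

lemma cycles1_eq: "cycles 1 K = chain1 ` {g. cycle1 K g}"
proof (intro set_eqI iffI)
  fix c :: "'a list \<Rightarrow> 'b" assume c: "c \<in> cycles 1 K"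
  then have "c \<in> chains 1 K" unfolding cycles_def by blast
  then have "c = chain1 (\<lambda>a b. c [a, b])" by (rule chains1_eq)
  moreover from this have "cycle1 K (\<lambda>a b. c [a, b])" using c chain1_in_cycles by metis
  ultimately show "c \<in> chain1 ` {g. cycle1 K g}" by blast
next
  fix c :: "'a list \<Rightarrow> 'b" assume "c \<in> chain1 ` {g. cycle1 K g}"
  then show "c \<in> cycles 1 K" using chain1_in_cycles by blast
qed

lemma zero_in_chains: "(\<lambda>xs. 0) \<in> chains p K"
  by (simp add: chains_def)

lemma boundary_zero: "boundary K (\<lambda>xs. 0) = (\<lambda>xs. 0)"
  by (simp add: boundary_def)

lemma zero_in_boundaries: "(\<lambda>xs. 0) \<in> boundaries p K"
  unfolding boundaries_def by (rule image_eqI) (rule boundary_zero[symmetric], rule zero_in_chains)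

lemma chain_add_in_chains: "c \<in> chains p K \<Longrightarrow> d \<in> chains p K \<Longrightarrow> chain_add c d \<in> chains p K"
proof (rule chainsI)
  assume c: "c \<in> chains p K" and d: "d \<in> chains p K"
  show "length xs = Suc p \<and> distinct xs \<and> set xs \<in> K" if "chain_add c d xs \<noteq> 0" for xs
  proof -
    have "c xs \<noteq> 0 \<or> d xs \<noteq> 0" using that by (auto simp: chain_add_def)
    then show ?thesis using chains_support[OF c] chains_support[OF d] by blast
  qed
  show "chain_add c d (xs @ u # ys @ v # zs) = - chain_add c d (xs @ v # ys @ u # zs)" for xs u ys v zs
    by (simp add: chain_add_def chains_alternating[OF c, of xs u] chains_alternating[OF d, of xs u])
qed

lemma boundary_add: "boundary K (chain_add c d) = chain_add (boundary K c) (boundary K d)"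
  by (simp add: boundary_def chain_add_def sum.distrib)

lemma boundaries_add:
  assumes "c \<in> boundaries p K" "d \<in> boundaries p K"
  shows "chain_add c d \<in> boundaries p K"
proof -
  obtain x y where x: "x \<in> chains (Suc p) K" "c = boundary K x" and y: "y \<in> chains (Suc p) K" "d = boundary K y"
    using assms unfolding boundaries_def by blast
  have "chain_add c d = boundary K (chain_add x y)" by (simp only: x y boundary_add)
  then show ?thesis
    unfolding boundaries_def using chain_add_in_chains[OF x(1) y(1)] by (rule image_eqI)
qed

lemma boundaries_scale:
  assumes "b \<in> boundaries p K"
  shows "chain_scale a b \<in> boundaries p K"
proof -
  obtain c where c: "c \<in> chains (Suc p) K" "b = boundary K c" using assms by (auto simp: boundaries_def)
  have "chain_scale a c \<in> chains (Suc p) K"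
  proof (rule chainsI)
    show "length xs = Suc (Suc p) \<and> distinct xs \<and> set xs \<in> K" if "chain_scale a c xs \<noteq> 0" for xs
      using chains_support[OF c(1), of xs] that by (auto simp: chain_scale_def)
    show "chain_scale a c (xs @ u # ys @ v # zs) = - chain_scale a c (xs @ v # ys @ u # zs)" for xs u ys v zs
      by (simp add: chain_scale_def chains_alternating[OF c(1), of xs u])
  qed
  moreover have "boundary K (chain_scale a c) = chain_scale a b"
    by (simp add: c(2) boundary_def chain_scale_def sum_distrib_left)
  ultimately show ?thesis unfolding boundaries_def by (metis imageI)
qed

lemma zero_in_cycles: "(\<lambda>xs. 0) \<in> cycles p K"
  by (simp add: cycles_def zero_in_chains boundary_zero)

lemma coset_of_boundary:
  fixes z :: "'v list \<Rightarrow> 'f::field"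
  assumes z: "z \<in> boundaries p K"
  shows "chain_add z ` boundaries p K = boundaries p K"
proof (intro equalityI subsetI)
  fix b :: "'v list \<Rightarrow> 'f" assume "b \<in> boundaries p K"
  then have "chain_add (chain_scale (-1) z) b \<in> boundaries p K"
    by (intro boundaries_add boundaries_scale z)
  moreover have "chain_add z (chain_add (chain_scale (-1) z) b) = b"
    by (simp add: chain_add_def chain_scale_def)
  ultimately show "b \<in> chain_add z ` boundaries p K" by (metis imageI)
qed (use z boundaries_add in auto)

lemma homology_trivial:
  fixes K :: "'v set set"
  assumes "(cycles p K :: ('v list \<Rightarrow> 'f::field) set) \<subseteq> boundaries p K"
  shows "vcarrier (homology p K :: ('f, ('v list \<Rightarrow> 'f) set) vspace) = {boundaries p K}"
proof -
  have "chain_add z ` boundaries p K = boundaries p K" if "z \<in> cycles p K" for z :: "'v list \<Rightarrow> 'f"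
    using assms that by (intro coset_of_boundary) auto
  then have "(\<lambda>z. chain_add z ` boundaries p K) ` (cycles p K :: ('v list \<Rightarrow> 'f) set) = {boundaries p K}"
    using zero_in_cycles[of p K, where 'b='f] by force
  then show ?thesis by (simp add: homology_def)
qed

section \<open>Flag complexes with at most four vertices\<close>

definition flag_complex :: "'v set \<Rightarrow> ('v \<Rightarrow> 'v \<Rightarrow> bool) \<Rightarrow> 'v set set" where
  "flag_complex Y A = {\<sigma>. \<sigma> \<noteq> {} \<and> \<sigma> \<subseteq> Y \<and> (\<forall>x\<in>\<sigma>. \<forall>y\<in>\<sigma>. A x y)}"

lemma Union_flag_complex: "(\<And>x. x \<in> Y \<Longrightarrow> A x x) \<Longrightarrow> \<Union>(flag_complex Y A) = Y"
proof (intro equalityI subsetI)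
  fix x assume "\<And>x. x \<in> Y \<Longrightarrow> A x x" "x \<in> Y"
  then have "{x} \<in> flag_complex Y A" by (simp add: flag_complex_def)
  then show "x \<in> \<Union>(flag_complex Y A)" by blast
qed (auto simp: flag_complex_def)

text \<open>The vertex is isolated, or dominated in the sense of dismantlable graphs.\<close>

definition removable :: "('v \<Rightarrow> 'v \<Rightarrow> bool) \<Rightarrow> 'v set \<Rightarrow> 'v \<Rightarrow> bool" where
  "removable A S v \<longleftrightarrow> (\<forall>x\<in>S - {v}. \<not> A v x) \<or>
     (\<exists>w\<in>S - {v}. A v w \<and> (\<forall>x\<in>S - {v}. A v x \<longrightarrow> A w x))"

text \<open>If every neighbour of \<open>v\<close> other than \<open>w\<close> is also a neighbour of \<open>w\<close>, then subtracting the
  boundary of the cone with apex \<open>w\<close> over the star of \<open>v\<close> in the cycle clears \<open>v\<close>.\<close>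

lemma remove_vertex:
  fixes g :: "'v \<Rightarrow> 'v \<Rightarrow> 'f::field"
  assumes fin: "finite Y" and rf: "\<And>x. x \<in> Y \<Longrightarrow> A x x" and sym: "\<And>x y. A x y \<Longrightarrow> A y x"
    and g: "cycle1 (flag_complex Y A) g" and supp: "\<And>a b. g a b \<noteq> 0 \<Longrightarrow> a \<in> S \<and> b \<in> S"
    and S: "S \<subseteq> Y" "v \<in> S" and rem: "removable A S v"
  obtains g' where "cycle1 (flag_complex Y A) g'" "\<And>a b. g' a b \<noteq> 0 \<Longrightarrow> a \<in> S - {v} \<and> b \<in> S - {v}"
    "\<exists>d\<in>boundaries 1 (flag_complex Y A). chain1 g = chain_add (chain1 g') d"
proof -
  let ?K = "flag_complex Y A"
  have UK: "\<Union>?K = Y" using Union_flag_complex[of Y A] rf by blast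
  have K2: "{a, b} \<in> ?K \<longleftrightarrow> a \<in> Y \<and> b \<in> Y \<and> A a b" for a b
    using rf sym by (auto simp: flag_complex_def)
  have alt: "g a b = - g b a" and ne: "g a b \<noteq> 0 \<Longrightarrow> a \<noteq> b \<and> a \<in> Y \<and> b \<in> Y \<and> A a b"
    and cyc: "(\<Sum>x\<in>Y. g x b) = 0" for a b
    using g unfolding cycle1_def UK K2 by blast+
  show ?thesis
  proof (cases "\<forall>x\<in>S - {v}. \<not> A v x")
    case True
    have "a \<noteq> v \<and> b \<noteq> v" if "g a b \<noteq> 0" for a b
      using True supp[OF that] ne[OF that] sym by blast
    then show ?thesis
      using that[of g] g supp zero_in_boundaries[of 1 ?K] by (force simp: chain_add_def)
  next
    case False
    then obtain w where w: "w \<in> S" "w \<noteq> v" "A v w" "\<And>x. x \<in> S \<Longrightarrow> x \<noteq> v \<Longrightarrow> A v x \<Longrightarrow> A w x"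
      using rem unfolding removable_def by blast
    define f where "f x = (if x = w then 0 else g v x)" for x
    define \<delta> :: "'v \<Rightarrow> 'v \<Rightarrow> 'f" where "\<delta> x y = (if y = x then 1 else 0)" for x y
    define F where "F = (\<Sum>y\<in>Y. f y)"
    have wY: "w \<in> Y" "v \<in> Y" using S w by auto
    have fv: "f v = 0" "f w = 0" using ne[of v v] by (auto simp: f_def)
    have fne: "x \<noteq> v \<and> x \<noteq> w \<and> x \<in> S \<and> A v x \<and> A w x" if "f x \<noteq> 0" for x
      using that ne[of v x] supp[of v x] w(4)[of x] by (auto simp: f_def split: if_splits)
    \<comment> \<open>Conservation at \<open>v\<close>: what \<open>g\<close> sends from
      \<open>v\<close> to its other neighbours is opposite to what it sends to
      \<open>w\<close>.\<close>
    have F: "F = - g v w"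
    proof -
      have "(\<Sum>y\<in>Y. g v y) = 0"
        using cyc[of v] alt[of v] by (simp add: sum_negf)
      moreover have "(\<Sum>y\<in>Y. g v y) = g v w + (\<Sum>y\<in>Y - {w}. g v y)"
        using fin wY by (intro sum.remove) auto
      moreover have "F = f w + (\<Sum>y\<in>Y - {w}. f y)"
        unfolding F_def using fin wY by (intro sum.remove) auto
      moreover have "(\<Sum>y\<in>Y - {w}. f y) = (\<Sum>y\<in>Y - {w}. g v y)"
        by (intro sum.cong) (auto simp: f_def)
      ultimately show ?thesis using fv by (simp add: eq_neg_iff_add_eq_0 add.commute)
    qed
    \<comment> \<open>The 3 by 3 determinant with rows \<open>\<delta> w\<close>,
      \<open>\<delta> v\<close> and \<open>f\<close>, evaluated at \<open>a\<close>,
      \<open>b\<close>, \<open>c\<close>. It is the alternating function of the sum of the oriented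
      triangles \<open>[w, v, x]\<close> with weights \<open>f x\<close>.\<close>
    define e where "e a b c = \<delta> w a * (\<delta> v b * f c - \<delta> v c * f b) + \<delta> w b * (\<delta> v c * f a - \<delta> v a * f c)
      + \<delta> w c * (\<delta> v a * f b - \<delta> v b * f a)" for a b c
    have e_ne: "distinct [a, b, c] \<and> {a, b, c} \<in> ?K" if "e a b c \<noteq> 0" for a b c
    proof -
      have base: "distinct [w, v, x] \<and> {w, v, x} \<in> ?K" if "f x \<noteq> 0" for x
      proof -
        have "A x w" "A x v" "A w v" using fne[OF that] w(3) sym by blast+
        then show ?thesis
          using fne[OF that] w(1-3) wY S(1) rf by (auto simp: flag_complex_def)
      qed
      have "a = w \<and> b = v \<and> f c \<noteq> 0 \<or> a = w \<and> c = v \<and> f b \<noteq> 0 \<or> b = w \<and> c = v \<and> f a \<noteq> 0 \<or>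
        b = w \<and> a = v \<and> f c \<noteq> 0 \<or> c = w \<and> a = v \<and> f b \<noteq> 0 \<or> c = w \<and> b = v \<and> f a \<noteq> 0"
      proof (rule ccontr)
        assume "\<not> ?thesis"
        then have "\<delta> w a * (\<delta> v b * f c) = 0" "\<delta> w a * (\<delta> v c * f b) = 0" "\<delta> w b * (\<delta> v c * f a) = 0"
          "\<delta> w b * (\<delta> v a * f c) = 0" "\<delta> w c * (\<delta> v a * f b) = 0" "\<delta> w c * (\<delta> v b * f a) = 0"
          by (auto simp: \<delta>_def)
        then have "e a b c = 0" unfolding e_def by (simp only: right_diff_distrib) simp
        then show False using that by simp
      qed
      then show ?thesis
        by (elim disjE conjE) (use base[of a] base[of b] base[of c] in \<open>auto simp: insert_commute\<close>)
    qed
    have e_chain: "chain2 e \<in> chains (Suc 1) ?K"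
      by (rule chain2_in_chains[OF _ _ e_ne]) (auto simp: e_def algebra_simps)
    \<comment> \<open>The determinant summed over its first argument, with the sum of
      \<open>\<delta> w\<close> equal to 1 and that of \<open>f\<close> equal to
      \<open>F\<close>.\<close>
    define h where "h a b = \<delta> v a * f b - \<delta> v b * f a + \<delta> w a * (\<delta> v b * F - f b) + \<delta> w b * (f a - \<delta> v a * F)"
      for a b
    have sum_\<delta>: "(\<Sum>y\<in>Y. \<delta> x y * k y) = k x" if "x \<in> Y" for x and k :: "'v \<Rightarrow> 'f"
      using fin that by (simp add: \<delta>_def if_distrib[of "\<lambda>t. t * _"] cong: if_cong)
    have sum_\<delta>1: "(\<Sum>y\<in>Y. \<delta> x y) = 1" if "x \<in> Y" for x
      using sum_\<delta>[OF that, of "\<lambda>_. 1"] by simp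
    have bd: "boundary ?K (chain2 e) = chain1 h"
    proof -
      have "(\<Sum>y\<in>Y. e y a b) = h a b" for a b
      proof -
        have "(\<Sum>y\<in>Y. e y a b) = (\<Sum>y\<in>Y. \<delta> w y * (\<delta> v a * f b - \<delta> v b * f a))
          + (\<delta> w a * (\<delta> v b * (\<Sum>y\<in>Y. f y) - (\<Sum>y\<in>Y. \<delta> v y * f b)))
          + (\<delta> w b * ((\<Sum>y\<in>Y. \<delta> v y * f a) - \<delta> v a * (\<Sum>y\<in>Y. f y)))"
          by (simp only: e_def sum.distrib sum_subtractf sum_distrib_left[symmetric])
        then show ?thesis by (simp add: sum_\<delta>[OF wY(1)] sum_\<delta>[OF wY(2)] h_def F_def)
      qed
      then show ?thesis by (simp add: boundary_chain2 UK)
    qed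
    have h_alt: "h a b = - h b a" for a b by (simp add: h_def algebra_simps)
    have h_cyc: "(\<Sum>a\<in>Y. h a b) = 0" for b
    proof -
      have "(\<Sum>a\<in>Y. h a b) = (\<Sum>a\<in>Y. \<delta> v a * f b) - \<delta> v b * (\<Sum>a\<in>Y. f a)
        + (\<Sum>a\<in>Y. \<delta> w a * (\<delta> v b * F - f b)) + \<delta> w b * ((\<Sum>a\<in>Y. f a) - (\<Sum>a\<in>Y. \<delta> v a * F))"
        by (simp only: h_def sum.distrib sum_subtractf sum_distrib_left[symmetric])
      then show ?thesis by (simp add: sum_\<delta>[OF wY(1)] sum_\<delta>[OF wY(2)] F_def[symmetric])
    qed
    define g' where "g' a b = g a b - h a b" for a b
    have g'_alt: "g' a b = - g' b a" for a b using alt[of a b] h_alt[of a b] by (simp add: g'_def)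
    \<comment> \<open>\<open>h\<close> agrees with \<open>g\<close> on all edges at
      \<open>v\<close>: by the choice of \<open>f\<close> away from \<open>w\<close>, and by the
      value of \<open>F\<close> at \<open>w\<close>.\<close>
    have g'v: "g' v b = 0" for b
    proof -
      consider "b = w" | "b = v" | "b \<noteq> w" "b \<noteq> v" by blast
      then show ?thesis
      proof cases
        case 1
        then show ?thesis using fv F w(2) by (simp add: g'_def h_def \<delta>_def)
      next
        case 2
        then show ?thesis using ne[of v v] fv w(2) by (auto simp: g'_def h_def \<delta>_def)
      next
        case 3
        then show ?thesis using fv w(2) by (simp add: g'_def h_def \<delta>_def f_def)
      qed
    qed
    have g'v2: "g' a v = 0" for a using g'_alt[of a v] g'v by simp
    have g'_ne: "a \<noteq> b \<and> {a, b} \<in> ?K \<and> a \<in> S - {v} \<and> b \<in> S - {v}" if "g' a b \<noteq> 0" for a b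
    proof -
      have av: "a \<noteq> v" "b \<noteq> v" using that g'v g'v2 by auto
      then have "g' a b = g a b - (\<delta> w b * f a - \<delta> w a * f b)"
        by (simp add: g'_def h_def \<delta>_def)
      then have "g a b \<noteq> 0 \<or> b = w \<and> f a \<noteq> 0 \<or> a = w \<and> f b \<noteq> 0"
        using that by (auto simp: \<delta>_def split: if_splits)
      then show ?thesis
        using av ne[of a b] supp[of a b] fne[of a] fne[of b] w(1) wY S sym K2 by blast
    qed
    have "(\<Sum>x\<in>Y. g' x b) = 0" for b
      using cyc[of b] h_cyc[of b] by (simp add: g'_def sum_subtractf)
    then have "cycle1 ?K g'"
      unfolding cycle1_def UK using g'_alt g'_ne by blast
    moreover have "chain1 g = chain_add (chain1 g') (chain1 h)"
      by (rule ext) (auto simp: chain_add_def chain1_def g'_def split: list.splits)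
    moreover have "chain1 h \<in> boundaries 1 ?K"
      using bd e_chain unfolding boundaries_def by (metis imageI)
    ultimately show ?thesis using that[of g'] g'_ne by blast
  qed
qed

lemma removable_exists_le3:
  assumes "finite S" "S \<noteq> {}" "card S \<le> 3" and rf: "\<And>x. x \<in> S \<Longrightarrow> A x x" and sym: "\<And>x y. A x y \<Longrightarrow> A y x"
  shows "\<exists>v\<in>S. removable A S v"
proof -
  have "card S = 1 \<or> card S = 2 \<or> card S = 3"
    using assms card_gt_0_iff[of S] by linarith
  then consider a where "S = {a}" | a b where "S = {a, b}" "a \<noteq> b"
    | a b c where "S = {a, b, c}" "a \<noteq> b" "a \<noteq> c" "b \<noteq> c"
    by (auto simp: card_1_singleton_iff card_2_iff card_3_iff)
  then show ?thesis
  proof cases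
    case 1
    then show ?thesis by (auto simp: removable_def)
  next
    case 2
    then show ?thesis using rf by (auto simp: removable_def)
  next
    case 3
    have *: "A b a = A a b" "A c a = A a c" "A c b = A b c" using sym by blast+
    show ?thesis
      using 3 rf * unfolding removable_def
      by (cases "A a b"; cases "A b c"; cases "A a c") auto
  qed
qed

text \<open>Among the graphs on four vertices, the 4-cycle without diagonals is the only one in
  which no vertex is isolated or dominated.\<close>

lemma removable_exists_4:
  assumes "card S = 4" and rf: "\<And>x. x \<in> S \<Longrightarrow> A x x" and sym: "\<And>x y. A x y \<Longrightarrow> A y x"
    and no: "\<And>a b c d. S = {a, b, c, d} \<Longrightarrow> A a b \<Longrightarrow> A b c \<Longrightarrow> A c d \<Longrightarrow> A d a \<Longrightarrow> \<not> A a c \<Longrightarrow> \<not> A b d \<Longrightarrow> False"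
  shows "\<exists>v\<in>S. removable A S v"
proof -
  obtain a T where "S = insert a T" "a \<notin> T" "card T = 3"
    using assms(1) by (metis card_Suc_eq numeral_3_eq_3 numeral_eq_Suc pred_numeral_simps(2) semiring_norm(26,27))
  then obtain b c d where S: "S = {a, b, c, d}" and ne: "distinct [a, b, c, d]"
    by (auto simp: card_3_iff)
  have *: "A b a = A a b" "A c a = A a c" "A c b = A b c" "A d a = A a d" "A d b = A b d" "A d c = A c d"
    using sym by blast+
  have **: "A a a" "A b b" "A c c" "A d d" using rf S by auto
  \<comment> \<open>Four labelled vertices carry three 4-cycles, one for each way to split them into
    two diagonals.\<close>
  have n1: "\<not> (A a b \<and> A b c \<and> A c d \<and> A a d \<and> \<not> A a c \<and> \<not> A b d)"
    using no[of a b c d] S * by auto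
  have n2: "\<not> (A a b \<and> A b d \<and> A c d \<and> A a c \<and> \<not> A a d \<and> \<not> A b c)"
    using no[of a b d c] S * by auto
  have n3: "\<not> (A a c \<and> A b c \<and> A b d \<and> A a d \<and> \<not> A a b \<and> \<not> A c d)"
    using no[of a c b d] S * by auto
  have "removable A {a, b, c, d} a \<or> removable A {a, b, c, d} b \<or> removable A {a, b, c, d} c \<or>
    removable A {a, b, c, d} d"
    using n1 n2 n3 ne unfolding removable_def
    by (cases "A a b"; cases "A a c"; cases "A a d"; cases "A b c"; cases "A b d"; cases "A c d")
      (simp_all add: * ** Diff_insert_absorb insert_Diff_if)
  then show ?thesis using S by auto
qed

text \<open>The support of the cycle shrinks vertex by vertex while the complex stays the same, so
  boundaries found on the way can be added without being moved between complexes.\<close>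

lemma cycles_le3_bound:
  fixes g :: "'v \<Rightarrow> 'v \<Rightarrow> 'f::field"
  assumes fin: "finite Y" and rf: "\<And>x. x \<in> Y \<Longrightarrow> A x x" and sym: "\<And>x y. A x y \<Longrightarrow> A y x"
    and "cycle1 (flag_complex Y A) g" and "\<And>a b. g a b \<noteq> 0 \<Longrightarrow> a \<in> S \<and> b \<in> S"
    and "S \<subseteq> Y" "card S \<le> 3"
  shows "chain1 g \<in> boundaries 1 (flag_complex Y A)"
  using assms(4-)
proof (induction "card S" arbitrary: S g)
  case 0
  then have "S = {}" using fin finite_subset by fastforce
  then have "chain1 g = (\<lambda>xs. 0)" using 0 by (force simp: chain1_def fun_eq_iff split: list.splits)
  then show ?case using zero_in_boundaries by metis
next
  case (Suc k)
  have finS: "finite S" "S \<noteq> {}" using Suc.hyps(2) by (auto intro: card_ge_0_finite)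
  have "\<exists>v\<in>S. removable A S v"
    using Suc.prems rf sym by (intro removable_exists_le3[OF finS]) auto
  then obtain v where v: "v \<in> S" "removable A S v" by blast
  obtain g' where g': "cycle1 (flag_complex Y A) g'" "\<And>a b. g' a b \<noteq> 0 \<Longrightarrow> a \<in> S - {v} \<and> b \<in> S - {v}"
    "\<exists>d\<in>boundaries 1 (flag_complex Y A). chain1 g = chain_add (chain1 g') d"
    using remove_vertex[OF fin rf sym Suc.prems(1,2,3) v] by blast
  have "chain1 g' \<in> boundaries 1 (flag_complex Y A)"
    using Suc.hyps(1)[of "S - {v}" g'] Suc.hyps(2) Suc.prems v finS g' by force
  then show ?case using g'(3) boundaries_add by metis
qed

lemma cycles_subset_boundaries:
  assumes fin: "finite Y" "card Y \<le> 4" and rf: "\<And>x. x \<in> Y \<Longrightarrow> A x x" and sym: "\<And>x y. A x y \<Longrightarrow> A y x"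
    and no: "\<And>a b c d. Y = {a, b, c, d} \<Longrightarrow> A a b \<Longrightarrow> A b c \<Longrightarrow> A c d \<Longrightarrow> A d a \<Longrightarrow> \<not> A a c \<Longrightarrow> \<not> A b d \<Longrightarrow> False"
  shows "(cycles 1 (flag_complex Y A) :: ('v list \<Rightarrow> 'f::field) set) \<subseteq> boundaries 1 (flag_complex Y A)"
proof
  fix z :: "'v list \<Rightarrow> 'f" assume "z \<in> cycles 1 (flag_complex Y A)"
  then obtain g where g: "z = chain1 g" "cycle1 (flag_complex Y A) g" by (auto simp: cycles1_eq[simplified])
  have supp: "a \<in> Y \<and> b \<in> Y" if "g a b \<noteq> 0" for a b
    using g(2) that unfolding cycle1_def flag_complex_def by blast
  show "z \<in> boundaries 1 (flag_complex Y A)"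
  proof (cases "card Y \<le> 3")
    case True
    then show ?thesis using cycles_le3_bound[OF fin(1) rf sym g(2) supp] g(1) by blast
  next
    case False
    then have "card Y = 4" using fin by simp
    then have "\<exists>v\<in>Y. removable A Y v"
      by (rule removable_exists_4) (use rf in blast, use sym in blast, use no in blast)
    then obtain v where v: "v \<in> Y" "removable A Y v" by blast
    obtain g' where g': "cycle1 (flag_complex Y A) g'" "\<And>a b. g' a b \<noteq> 0 \<Longrightarrow> a \<in> Y - {v} \<and> b \<in> Y - {v}"
      "\<exists>d\<in>boundaries 1 (flag_complex Y A). chain1 g = chain_add (chain1 g') d"
      using remove_vertex[OF fin(1) rf sym g(2) supp _ v] by blast
    have "chain1 g' \<in> boundaries 1 (flag_complex Y A)"
      using cycles_le3_bound[OF fin(1) rf sym g'(1,2)] fin v by auto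
    then show ?thesis using g'(3) boundaries_add g(1) by metis
  qed
qed

section \<open>Vietoris-Rips diagrams of four points\<close>

lemma homology_no_boundaries:
  fixes K :: "'v set set"
  assumes "(boundaries p K :: ('v list \<Rightarrow> 'f::field) set) = {\<lambda>xs. 0}"
  shows "vcarrier (homology p K) = (\<lambda>z. {z}) ` (cycles p K :: ('v list \<Rightarrow> 'f) set)"
    and "vadd (homology p K) {x} {y} = {chain_add x (y :: 'v list \<Rightarrow> 'f)}"
    and "vscale (homology p K) a {x} = {chain_scale a (x :: 'v list \<Rightarrow> 'f)}"
    and "homology_inclusion p K {x} = {x}"
  by (auto simp: homology_def homology_inclusion_def assms chain_add_def)

lemma chain_add_chain1: "chain_add (chain1 g) (chain1 h) = chain1 (\<lambda>a b. g a b + h a b)"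
  by (rule ext) (auto simp: chain_add_def chain1_def split: list.splits)

lemma chain_scale_chain1: "chain_scale t (chain1 g) = chain1 (\<lambda>a b. t * g a b)"
  by (rule ext) (auto simp: chain_scale_def chain1_def split: list.splits)

text \<open>Without boundaries the homology classes are singletons, and \<open>the_elem\<close>
  recovers the cycle. So it suffices to give an isomorphism on coefficient functions.\<close>

lemma linear_iso_homology1:
  fixes \<psi> :: "('v \<Rightarrow> 'v \<Rightarrow> 'f::field) \<Rightarrow> 'n"
  assumes B: "(boundaries 1 K :: ('v list \<Rightarrow> 'f) set) = {\<lambda>xs. 0}"
    and bij: "bij_betw \<psi> {g. cycle1 K g} (vcarrier W)"
    and add: "\<And>g h. cycle1 K g \<Longrightarrow> cycle1 K h \<Longrightarrow> \<psi> (\<lambda>a b. g a b + h a b) = vadd W (\<psi> g) (\<psi> h)"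
    and scale: "\<And>t g. cycle1 K g \<Longrightarrow> \<psi> (\<lambda>a b. t * g a b) = vscale W t (\<psi> g)"
  shows "linear_iso (\<lambda>X. \<psi> (\<lambda>a b. the_elem X [a, b])) (homology 1 K) W"
proof -
  let ?H = "homology 1 K :: ('f, ('v list \<Rightarrow> 'f) set) vspace"
  let ?\<phi> = "\<lambda>X. \<psi> (\<lambda>a b. the_elem X [a, b])"
  note H = homology_no_boundaries[OF B]
  have car: "vcarrier ?H = (\<lambda>g. {chain1 g}) ` {g. cycle1 K g}"
    unfolding H(1) cycles1_eq image_image ..
  have \<phi>: "?\<phi> {chain1 g} = \<psi> g" for g by simp
  have "bij_betw (\<lambda>g. {chain1 g}) {g. cycle1 K g} (vcarrier ?H)"
    unfolding car by (rule inj_on_imp_bij_betw) (simp add: inj_on_def chain1_cong_iff)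
  moreover have "bij_betw (?\<phi> \<circ> (\<lambda>g. {chain1 g})) {g. cycle1 K g} (vcarrier W)"
    using bij by (simp add: comp_def)
  ultimately have "bij_betw ?\<phi> (vcarrier ?H) (vcarrier W)"
    using bij_betw_comp_iff by blast
  moreover have "?\<phi> (vadd ?H x y) = vadd W (?\<phi> x) (?\<phi> y)" if xy: "x \<in> vcarrier ?H" "y \<in> vcarrier ?H" for x y
  proof -
    obtain g h where gh: "x = {chain1 g}" "y = {chain1 h}" "cycle1 K g" "cycle1 K h"
      using xy car by auto
    then show ?thesis by (simp add: H(2)[simplified] chain_add_chain1 add)
  qed
  moreover have "?\<phi> (vscale ?H t x) = vscale W t (?\<phi> x)" if x: "x \<in> vcarrier ?H" for t x
  proof -
    obtain g where g: "x = {chain1 g}" "cycle1 K g" using x car by auto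
    then show ?thesis by (simp add: H(3)[simplified] chain_scale_chain1 scale)
  qed
  ultimately show ?thesis unfolding linear_iso_def by blast
qed

lemma vr_complex_flag: "vr_complex d Y r = flag_complex Y (\<lambda>x y. d x y \<le> r)"
  by (simp add: vr_complex_def flag_complex_def)

text \<open>Inside the bar the interval module has at least two vectors, whereas vanishing homology
  would leave a single class.\<close>

lemma vr_diagram_nontrivial:
  fixes d :: "'p \<Rightarrow> 'p \<Rightarrow> real"
  assumes "vr_diagram TYPE('f::field) 1 d Y {#(b, t)#}"
  shows "0 \<le> b" "b < t"
    "\<And>r. b \<le> r \<Longrightarrow> r < t \<Longrightarrow>
      \<not> (cycles 1 (vr_complex d Y r) :: ('p list \<Rightarrow> 'f) set) \<subseteq> boundaries 1 (vr_complex d Y r)"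
proof -
  obtain bars where bars: "mset bars = {#(b, t)#}" "\<forall>(b, t)\<in>set bars. 0 \<le> b \<and> b < t"
    "pmodule_isomorphic (vr_module 1 d Y :: ('f, ('p list \<Rightarrow> 'f) set) pmodule) (interval_sum bars)"
    using assms by (auto simp: vr_diagram_def)
  have bars1: "bars = [(b, t)]" using bars(1) by simp
  show bt: "0 \<le> b" "b < t" using bars(2) bars1 by auto
  fix r assume r: "b \<le> r" "r < t"
  show "\<not> (cycles 1 (vr_complex d Y r) :: ('p list \<Rightarrow> 'f) set) \<subseteq> boundaries 1 (vr_complex d Y r)"
  proof
    assume "(cycles 1 (vr_complex d Y r) :: ('p list \<Rightarrow> 'f) set) \<subseteq> boundaries 1 (vr_complex d Y r)"
    note triv = homology_trivial[OF this]
    obtain \<phi> where "\<forall>r\<ge>0. linear_iso (\<phi> r)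
        (pm_space (vr_module 1 d Y :: ('f, ('p list \<Rightarrow> 'f) set) pmodule) r) (pm_space (interval_sum bars) r)"
      using bars(3) unfolding pmodule_isomorphic_def by blast
    then have "linear_iso (\<phi> r) (pm_space (vr_module 1 d Y :: ('f, ('p list \<Rightarrow> 'f) set) pmodule) r)
        (pm_space (interval_sum bars) r)"
      using r bt by simp
    then have "bij_betw (\<phi> r) {boundaries 1 (vr_complex d Y r)} (vcarrier (pm_space (interval_sum bars) r))"
      using triv unfolding linear_iso_def vr_module_def by simp
    then have "card (vcarrier (pm_space (interval_sum bars :: ('f, nat \<Rightarrow> 'f) pmodule) r)) = 1"
      using bij_betw_same_card by fastforce
    then obtain v where v: "vcarrier (pm_space (interval_sum bars :: ('f, nat \<Rightarrow> 'f) pmodule) r) = {v}"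
      by (auto simp: card_1_singleton_iff)
    have "(\<lambda>i. 0) \<in> vcarrier (pm_space (interval_sum bars :: ('f, nat \<Rightarrow> 'f) pmodule) r)"
      by (simp add: interval_sum_def)
    moreover have "(\<lambda>i. if i = 0 then 1 else 0) \<in> vcarrier (pm_space (interval_sum bars :: ('f, nat \<Rightarrow> 'f) pmodule) r)"
      using r by (auto simp: interval_sum_def bars1)
    ultimately have "(\<lambda>i::nat. 0 :: 'f) = (\<lambda>i. if i = 0 then 1 else 0)" using v by simp
    from fun_cong[OF this, of 0] show False by simp
  qed
qed

lemma square_of_diagram:
  assumes G: "metric_graph G" and Y: "Y \<subseteq> realization G" "finite Y" "card Y \<le> 4"
    and dgm: "vr_diagram TYPE('f::field) 1 (graph_dist G) Y {#(s, 2 * s)#}"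
  shows "0 < s" "has_square G s"
proof -
  let ?d = "graph_dist G"
  note nt = vr_diagram_nontrivial[OF dgm]
  show s: "0 < s" using nt(1,2) by simp
  have quad: "\<exists>a b c e. Y = {a, b, c, e} \<and> ?d a b \<le> r \<and> ?d b c \<le> r \<and> ?d c e \<le> r \<and> ?d e a \<le> r \<and>
      \<not> ?d a c \<le> r \<and> \<not> ?d b e \<le> r" if r: "s \<le> r" "r < 2 * s" for r
  proof (rule ccontr)
    assume no: "\<not> ?thesis"
    have "(cycles 1 (flag_complex Y (\<lambda>x y. ?d x y \<le> r)) :: (('a \<Rightarrow> real) list \<Rightarrow> 'f) set)
        \<subseteq> boundaries 1 (flag_complex Y (\<lambda>x y. ?d x y \<le> r))"
    proof (rule cycles_subset_boundaries[OF Y(2,3)])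
      show "?d x x \<le> r" if "x \<in> Y" for x using graph_dist_refl[OF G, of x] that Y(1) s r by auto
      show "?d y x \<le> r" if "?d x y \<le> r" for x y using that graph_dist_sym[of G x y] by simp
    qed (use no in blast)
    then show False using nt(3)[OF r] unfolding vr_complex_flag by blast
  qed
  obtain a b c e where q: "Y = {a, b, c, e}" "?d a b \<le> s" "?d b c \<le> s" "?d c e \<le> s" "?d e a \<le> s"
      "\<not> ?d a c \<le> s" "\<not> ?d b e \<le> s"
    using quad[of s] s by auto
  have R: "a \<in> realization G" "b \<in> realization G" "c \<in> realization G" "e \<in> realization G"
    using Y(1) q(1) by auto
  have sy: "?d x y = ?d y x" for x y by (rule graph_dist_sym)
  have rf: "?d a a = 0" "?d b b = 0" "?d c c = 0" "?d e e = 0" using graph_dist_refl[OF G] R by auto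
  have diag: "2 * s \<le> ?d a c \<and> 2 * s \<le> ?d b e"
  proof (rule ccontr)
    assume "\<not> ?thesis"
    \<comment> \<open>At the length of the shorter diagonal there would still have to be a 4-cycle
      with two missing diagonals. Only the two old diagonals can exceed \<open>r\<close>, and one of
      them does not.\<close>
    define r where "r = min (?d a c) (?d b e)"
    have r: "s \<le> r" "r < 2 * s" using q \<open>\<not> (2 * s \<le> ?d a c \<and> 2 * s \<le> ?d b e)\<close> by (auto simp: r_def)
    obtain a' b' c' e' where q': "Y = {a', b', c', e'}" "\<not> ?d a' c' \<le> r" "\<not> ?d b' e' \<le> r"
        "?d a' b' \<le> r" "?d b' c' \<le> r" "?d c' e' \<le> r" "?d e' a' \<le> r"
      using quad[OF r] by blast
    have sides: "?d a b \<le> r" "?d b c \<le> r" "?d c e \<le> r" "?d e a \<le> r" using q r by linarith+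
    have far: "{x, y} = {a, c} \<or> {x, y} = {b, e}" if "\<not> ?d x y \<le> r" "x \<in> Y" "y \<in> Y" for x y
      using that sides rf r s sy[of b a] sy[of c b] sy[of e c] sy[of a e] unfolding q(1) by auto
    have f1: "{a', c'} = {a, c} \<or> {a', c'} = {b, e}" using far[OF q'(2)] q'(1) by auto
    have f2: "{b', e'} = {a, c} \<or> {b', e'} = {b, e}" using far[OF q'(3)] q'(1) by auto
    have ne: "{a', c'} \<noteq> {b', e'}"
    proof
      assume "{a', c'} = {b', e'}"
      then have "?d a' b' = ?d a' c' \<or> ?d a' e' = ?d a' c'" by (auto simp: doubleton_eq_iff)
      then show False using q' sy[of a' e'] by auto
    qed
    then have "\<not> ?d a c \<le> r \<and> \<not> ?d b e \<le> r"
      using f1 f2 q'(2,3) sy[of a c] sy[of b e] by (auto simp: doubleton_eq_iff)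
    then show False by (auto simp: r_def)
  qed
  \<comment> \<open>Sides at most \<open>s\<close> and diagonals at least \<open>2 * s\<close> leave
    no slack in the triangle inequalities, so all of these are equalities.\<close>
  have "?d a c \<le> ?d a b + ?d b c" "?d a c \<le> ?d a e + ?d e c" "?d b e \<le> ?d b c + ?d c e"
    using graph_dist_triangle[OF G] R by blast+
  then have "square_tuple ?d s a b c e"
    using q diag sy[of a e] sy[of e c] unfolding square_tuple_def by linarith
  then show "has_square G s" using R unfolding has_square_def by blast
qed

text \<open>Each vertex of the 4-cycle has two neighbours, so conservation hands the value on one
  edge on to the next, and the cycle is determined by its value on \<open>x1 x2\<close>.\<close>

lemma four_cycle_iff:
  assumes Y: "Y = {x1, x2, x3, x4}" "distinct [x1, x2, x3, x4]"
    and A: "\<And>x. x \<in> Y \<Longrightarrow> A x x" "\<And>x y. A x y \<longleftrightarrow> A y x" "A x1 x2" "A x2 x3" "A x3 x4" "A x4 x1"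
      "\<not> A x1 x3" "\<not> A x2 x4"
  defines "z0 \<equiv> \<lambda>a b. if (a, b) \<in> {(x1, x2), (x2, x3), (x3, x4), (x4, x1)} then 1
     else if (b, a) \<in> {(x1, x2), (x2, x3), (x3, x4), (x4, x1)} then - 1 else (0 :: 'f::field)"
  shows "cycle1 (flag_complex Y A) g \<longleftrightarrow> (\<exists>t. g = (\<lambda>a b. t * z0 a b))"
proof -
  have UK: "\<Union>(flag_complex Y A) = Y" using Union_flag_complex[of Y A] A(1) by blast
  have K2: "{a, b} \<in> flag_complex Y A \<longleftrightarrow> a \<in> Y \<and> b \<in> Y \<and> A a b" for a b
    using A(1) A(2)[of a b] by (auto simp: flag_complex_def)
  have sumY: "(\<Sum>v\<in>Y. f v) = f x1 + f x2 + f x3 + f x4" for f :: "'a \<Rightarrow> 'f"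
    using Y by (simp add: add.assoc)
  have ne: "x1 \<noteq> x2" "x1 \<noteq> x3" "x1 \<noteq> x4" "x2 \<noteq> x3" "x2 \<noteq> x4" "x3 \<noteq> x4"
    using Y(2) by auto
  have Z: "z0 x1 x2 = 1" "z0 x2 x3 = 1" "z0 x3 x4 = 1" "z0 x4 x1 = 1" "z0 x2 x1 = - 1" "z0 x3 x2 = - 1"
    "z0 x4 x3 = - 1" "z0 x1 x4 = - 1" "z0 x1 x3 = 0" "z0 x3 x1 = 0" "z0 x2 x4 = 0" "z0 x4 x2 = 0"
    "z0 x1 x1 = 0" "z0 x2 x2 = 0" "z0 x3 x3 = 0" "z0 x4 x4 = 0"
    unfolding z0_def using ne ne[symmetric] by simp_all
  have Z0: "z0 a b = 0" if "a \<notin> Y \<or> b \<notin> Y" for a b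
    using that unfolding Y(1) z0_def by auto
  show ?thesis
  proof
    assume "cycle1 (flag_complex Y A) g"
    then have alt: "g a b = - g b a" and ne: "g a b \<noteq> 0 \<Longrightarrow> a \<noteq> b \<and> a \<in> Y \<and> b \<in> Y \<and> A a b"
      and cyc: "(\<Sum>x\<in>Y. g x b) = 0" for a b
      unfolding cycle1_def UK K2 by blast+
    have 0: "g x1 x3 = 0" "g x3 x1 = 0" "g x2 x4 = 0" "g x4 x2 = 0" "g x1 x1 = 0" "g x2 x2 = 0"
      "g x3 x3 = 0" "g x4 x4 = 0"
      using ne A(7,8) A(2)[of x3 x1] A(2)[of x4 x2] by blast+
    define t where "t = g x1 x2"
    have 1: "g x2 x1 = - t" using alt[of x2 x1] by (simp add: t_def)
    have 2: "g x3 x2 = - t" using cyc[of x2] 0 unfolding sumY t_def by (simp add: eq_neg_iff_add_eq_0 add.commute)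
    have 3: "g x2 x3 = t" using alt[of x2 x3] 2 by simp
    have 4: "g x4 x3 = - t" using cyc[of x3] 0 3 unfolding sumY by (simp add: eq_neg_iff_add_eq_0 add.commute)
    have 5: "g x3 x4 = t" using alt[of x3 x4] 4 by simp
    have 6: "g x1 x4 = - t" using cyc[of x4] 0 5 unfolding sumY by (simp add: eq_neg_iff_add_eq_0)
    have 7: "g x4 x1 = t" using alt[of x4 x1] 6 by simp
    have "g a b = t * z0 a b" for a b
    proof (cases "a \<in> Y \<and> b \<in> Y")
      case True
      have "\<forall>a\<in>{x1, x2, x3, x4}. \<forall>b\<in>{x1, x2, x3, x4}. g a b = t * z0 a b"
        using t_def by (simp add: Z 0 1 2 3 4 5 6 7)
      then show ?thesis using True unfolding Y(1) by blast
    next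
      case False
      then have "g a b = 0" using ne by blast
      moreover have "z0 a b = 0" using False Z0 by blast
      ultimately show ?thesis by simp
    qed
    then show "\<exists>t. g = (\<lambda>a b. t * z0 a b)" by blast
  next
    assume "\<exists>t. g = (\<lambda>a b. t * z0 a b)"
    then obtain t where g: "g = (\<lambda>a b. t * z0 a b)" by blast
    have "\<forall>a\<in>{x1, x2, x3, x4}. \<forall>b\<in>{x1, x2, x3, x4}. z0 a b = - z0 b a" by (simp add: Z)
    then have alt: "z0 a b = - z0 b a" for a b
      using Z0[of a b] Z0[of b a] unfolding Y(1) by (cases "a \<in> {x1, x2, x3, x4} \<and> b \<in> {x1, x2, x3, x4}") auto
    have "\<forall>a\<in>{x1, x2, x3, x4}. \<forall>b\<in>{x1, x2, x3, x4}. z0 a b \<noteq> 0 \<longrightarrow> a \<noteq> b \<and> A a b"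
      using ne ne[symmetric] A(3-6) A(2)[of x2 x1] A(2)[of x3 x2] A(2)[of x4 x3] A(2)[of x1 x4]
      by (simp add: Z)
    then have ne: "a \<noteq> b \<and> {a, b} \<in> flag_complex Y A" if "z0 a b \<noteq> 0" for a b
      unfolding K2 using that Z0[of a b] unfolding Y(1) by blast
    have "\<forall>b\<in>{x1, x2, x3, x4}. (\<Sum>x\<in>Y. z0 x b) = 0" unfolding sumY by (simp add: Z)
    then have cyc: "(\<Sum>x\<in>Y. z0 x b) = 0" for b
      using Z0[of _ b] unfolding Y(1) by (cases "b \<in> {x1, x2, x3, x4}") auto
    have "t * z0 a b = - (t * z0 b a)" for a b using alt[of a b] by simp
    moreover have "(\<Sum>x\<in>Y. t * z0 x b) = 0" for b using cyc[of b] by (simp flip: sum_distrib_left)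
    moreover have "a \<noteq> b \<and> {a, b} \<in> flag_complex Y A" if "t * z0 a b \<noteq> 0" for a b
      using ne[of a b] that by auto
    ultimately show "cycle1 (flag_complex Y A) g" unfolding cycle1_def g UK by blast
  qed
qed

lemma boundaries_trivial:
  fixes K :: "'v set set"
  assumes "\<And>\<sigma>. \<sigma> \<in> K \<Longrightarrow> card \<sigma> \<noteq> Suc (Suc p)"
  shows "(boundaries p K :: ('v list \<Rightarrow> 'f::field) set) = {\<lambda>xs. 0}"
proof -
  have "c = (\<lambda>xs. 0)" if "c \<in> chains (Suc p) K" for c :: "'v list \<Rightarrow> 'f"
  proof
    fix xs show "c xs = 0"
    proof (rule ccontr)
      assume "c xs \<noteq> 0"
      from chains_support[OF that this] show False using assms distinct_card[of xs] by auto
    qed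
  qed
  then have "(chains (Suc p) K :: ('v list \<Rightarrow> 'f) set) = {\<lambda>xs. 0}" using zero_in_chains by blast
  then show ?thesis by (simp add: boundaries_def boundary_zero)
qed

lemma linear_iso_trivial:
  assumes "vcarrier V = {v}" "vcarrier W = {w}" "vadd W w w = w" "\<And>a. vscale W a w = w"
  shows "linear_iso (\<lambda>_. w) V W"
  using assms by (simp add: linear_iso_def bij_betw_def)

lemma interval_sum_single:
  "vcarrier (pm_space (interval_sum [(b, t)] :: ('f::field, nat \<Rightarrow> 'f) pmodule) r) =
    (if b \<le> r \<and> r < t then range (\<lambda>u (i::nat). if i = 0 then u else 0) else {\<lambda>i. 0})"
proof -
  have car: "vcarrier (pm_space (interval_sum [(b, t)] :: ('f, nat \<Rightarrow> 'f) pmodule) r) =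
      {c. \<forall>i. c i \<noteq> 0 \<longrightarrow> i = 0 \<and> b \<le> r \<and> r < t}"
    by (auto simp: interval_sum_def)
  show ?thesis
  proof (cases "b \<le> r \<and> r < t")
    case True
    have "c \<in> range (\<lambda>u i. if i = 0 then u else 0)" if "\<forall>i. c i \<noteq> 0 \<longrightarrow> i = 0" for c :: "nat \<Rightarrow> 'f"
    proof
      show "c = (\<lambda>i. if i = 0 then c 0 else 0)" using that by (auto simp: fun_eq_iff)
    qed simp
    then show ?thesis unfolding car using True by (auto split: if_splits)
  next
    case False
    then show ?thesis unfolding car by (auto simp: fun_eq_iff)
  qed
qed

text \<open>The complex has three regimes: isolated points below \<open>s\<close>, the 4-cycle
  without diagonals from \<open>s\<close> on, and the full simplex from \<open>2 * s\<close> on.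
  Only the middle one has homology in degree 1, and the complex is constant there.\<close>

lemma diagram_of_square:
  fixes d :: "'p \<Rightarrow> 'p \<Rightarrow> real"
  assumes sq: "square_tuple d s x1 x2 x3 x4" and s: "0 < s"
    and rf: "\<And>x. x \<in> {x1, x2, x3, x4} \<Longrightarrow> d x x = 0" and sym: "\<And>x y. d x y = d y x"
  shows "vr_diagram TYPE('f::field) 1 d {x1, x2, x3, x4} {#(s, 2 * s)#}"
proof -
  define Y where "Y = {x1, x2, x3, x4}"
  define A where "A r = (\<lambda>x y. d x y \<le> r)" for r
  define K where "K r = vr_complex d Y r" for r
  let ?W = "interval_sum [(s, 2 * s)] :: ('f, nat \<Rightarrow> 'f) pmodule"
  have D: "d x1 x2 = s" "d x2 x3 = s" "d x3 x4 = s" "d x4 x1 = s" "d x1 x3 = 2 * s" "d x2 x4 = 2 * s"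
    using sq by (auto simp: square_tuple_def)
  have D': "d x2 x1 = s" "d x3 x2 = s" "d x4 x3 = s" "d x1 x4 = s" "d x3 x1 = 2 * s" "d x4 x2 = 2 * s"
    using D sym by metis+
  have D0: "d x1 x1 = 0" "d x2 x2 = 0" "d x3 x3 = 0" "d x4 x4 = 0" using rf by auto
  have ne: "x1 \<noteq> x2" "x1 \<noteq> x3" "x1 \<noteq> x4" "x2 \<noteq> x3" "x2 \<noteq> x4" "x3 \<noteq> x4"
    using D D' D0 s by auto
  then have dist: "distinct [x1, x2, x3, x4]" by auto
  have K: "K r = flag_complex Y (A r)" for r by (simp add: K_def A_def vr_complex_flag)
  have range4: "\<forall>x\<in>Y. \<forall>y\<in>Y. d x y \<le> 2 * s"
    using D D' D0 s by (simp add: Y_def)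
  have short: "\<forall>x\<in>Y. \<forall>y\<in>Y. x \<noteq> y \<longrightarrow> s \<le> d x y"
    using D D' s by (simp add: Y_def)
  have bd: "(boundaries 1 (K r) :: ('p list \<Rightarrow> 'f) set) = {\<lambda>xs. 0}" if r: "r < 2 * s" for r
  proof (rule boundaries_trivial)
    fix \<sigma> assume \<sigma>: "\<sigma> \<in> K r"
    show "card \<sigma> \<noteq> Suc (Suc 1)"
    proof
      assume c: "card \<sigma> = Suc (Suc 1)"
      have sub: "\<sigma> \<subseteq> Y" and adj: "\<And>x y. x \<in> \<sigma> \<Longrightarrow> y \<in> \<sigma> \<Longrightarrow> d x y \<le> r"
        using \<sigma> by (auto simp: K_def vr_complex_def)
      have 1: "\<not> (x1 \<in> \<sigma> \<and> x3 \<in> \<sigma>)" "\<not> (x2 \<in> \<sigma> \<and> x4 \<in> \<sigma>)" using adj D r by force+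
      then have "\<sigma> \<subseteq> {x1, x2} \<or> \<sigma> \<subseteq> {x1, x4} \<or> \<sigma> \<subseteq> {x3, x2} \<or> \<sigma> \<subseteq> {x3, x4}"
        using sub unfolding Y_def by blast
      moreover have "card \<sigma> \<le> 2" if "\<sigma> \<subseteq> {a, b}" for a b
      proof -
        have "card \<sigma> \<le> card {a, b}" using that by (intro card_mono) auto
        also have "\<dots> \<le> 2" by (simp add: card_insert_if)
        finally show ?thesis .
      qed
      ultimately have "card \<sigma> \<le> 2" by blast
      then show False using c by simp
    qed
  qed
  have trivial: "vcarrier (homology 1 (K r) :: ('f, ('p list \<Rightarrow> 'f) set) vspace) = {boundaries 1 (K r)}"
    if r: "0 \<le> r" "\<not> (s \<le> r \<and> r < 2 * s)" for r
  proof (rule homology_trivial)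
    show "(cycles 1 (K r) :: ('p list \<Rightarrow> 'f) set) \<subseteq> boundaries 1 (K r)"
      unfolding K
    proof (rule cycles_subset_boundaries)
      show "finite Y" "card Y \<le> 4" by (auto simp: Y_def card_insert_if)
      show "A r x x" if "x \<in> Y" for x using rf that r unfolding A_def Y_def by simp
      show "A r y x" if "A r x y" for x y using that sym[of x y] by (simp add: A_def)
      \<comment> \<open>A side between distinct points needs \<open>s <= r\<close>, a missing
        diagonal needs \<open>r < 2 * s\<close>. If \<open>a = b\<close>, there would be fewer than
        four points.\<close>
      show False if q: "Y = {a, b, c, e}" "A r a b" "\<not> A r a c" for a b c e
      proof (cases "a = b")
        case True
        then have "card Y \<le> 3" using q(1) by (simp add: card_insert_if)
        moreover have "card Y = 4" using ne by (simp add: Y_def)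
        ultimately show False by simp
      next
        case False
        then have "s \<le> r" using q short unfolding A_def by fastforce
        moreover have "r < 2 * s" using q range4 unfolding A_def by fastforce
        ultimately show False using r by simp
      qed
    qed
  qed
  \<comment> \<open>Inside the bar a class is read off from its coefficient on the edge from
    \<open>x1\<close> to \<open>x2\<close>; outside the bar both spaces vanish.\<close>
  define \<phi> where "\<phi> r X = (\<lambda>i::nat. if i = 0 \<and> s \<le> r \<and> r < 2 * s then (the_elem X :: 'p list \<Rightarrow> 'f) [x1, x2] else 0)"
    for r X
  have iso: "linear_iso (\<phi> r) (homology 1 (K r)) (pm_space ?W r)" if r0: "0 \<le> r" for r
  proof (cases "s \<le> r \<and> r < 2 * s")
    case True
    have cyc: "cycle1 (K r) g \<longleftrightarrow> (\<exists>t. g = (\<lambda>a b. t * (if (a, b) \<in> {(x1, x2), (x2, x3), (x3, x4), (x4, x1)} then 1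
     else if (b, a) \<in> {(x1, x2), (x2, x3), (x3, x4), (x4, x1)} then - 1 else 0)))" for g :: "'p \<Rightarrow> 'p \<Rightarrow> 'f"
      unfolding K
    proof (rule four_cycle_iff[OF _ dist])
      show "Y = {x1, x2, x3, x4}" by (rule Y_def)
      show "A r x x" if "x \<in> Y" for x using rf that r0 unfolding A_def Y_def by simp
      show "A r x y \<longleftrightarrow> A r y x" for x y using sym[of x y] by (simp add: A_def)
    qed (use D True in \<open>auto simp: A_def\<close>)
    define z0 :: "'p \<Rightarrow> 'p \<Rightarrow> 'f" where "z0 a b = (if (a, b) \<in> {(x1, x2), (x2, x3), (x3, x4), (x4, x1)} then 1
     else if (b, a) \<in> {(x1, x2), (x2, x3), (x3, x4), (x4, x1)} then - 1 else 0)" for a b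
    have set: "{g. cycle1 (K r) g} = range (\<lambda>t a b. t * z0 a b)"
      unfolding cyc z0_def by auto
    have z12: "z0 x1 x2 = 1" by (simp add: z0_def)
    define \<psi> where "\<psi> g = (\<lambda>i::nat. if i = 0 then g x1 x2 else (0::'f))" for g :: "'p \<Rightarrow> 'p \<Rightarrow> 'f"
    have "linear_iso (\<lambda>X. \<psi> (\<lambda>a b. the_elem X [a, b])) (homology 1 (K r)) (pm_space ?W r)"
    proof (rule linear_iso_homology1)
      show "(boundaries 1 (K r) :: ('p list \<Rightarrow> 'f) set) = {\<lambda>xs. 0}" using bd True by blast
      have inj: "inj (\<lambda>t a b. t * z0 a b)"
      proof (rule injI)
        fix t u assume "(\<lambda>a b. t * z0 a b) = (\<lambda>a b. u * z0 a b)"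
        from fun_cong[OF fun_cong[OF this, of x1], of x2] show "t = u" by (simp add: z12)
      qed
      have "bij_betw (\<lambda>t a b. t * z0 a b) UNIV {g. cycle1 (K r) g}"
        unfolding set using inj by (rule inj_on_imp_bij_betw)
      moreover have "bij_betw (\<psi> \<circ> (\<lambda>t a b. t * z0 a b)) UNIV (vcarrier (pm_space ?W r))"
      proof -
        have "inj (\<lambda>u (i::nat). if i = 0 then u else (0::'f))"
        proof (rule injI)
          fix u v :: 'f assume "(\<lambda>i::nat. if i = 0 then u else 0) = (\<lambda>i. if i = 0 then v else 0)"
          from fun_cong[OF this, of 0] show "u = v" by simp
        qed
        moreover have "\<psi> \<circ> (\<lambda>t a b. t * z0 a b) = (\<lambda>u i. if i = 0 then u else 0)"
          by (auto simp: fun_eq_iff \<psi>_def z12)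
        ultimately show ?thesis
          unfolding interval_sum_single if_P[OF True] by (simp only: inj_on_imp_bij_betw)
      qed
      ultimately show "bij_betw \<psi> {g. cycle1 (K r) g} (vcarrier (pm_space ?W r))"
        using bij_betw_comp_iff by blast
    qed (auto simp: \<psi>_def interval_sum_def fun_eq_iff)
    moreover have "\<phi> r = (\<lambda>X. \<psi> (\<lambda>a b. the_elem X [a, b]))"
      using True by (auto simp: \<phi>_def \<psi>_def fun_eq_iff)
    ultimately show ?thesis by (simp only:)
  next
    case False
    have "linear_iso (\<lambda>_ i. 0) (homology 1 (K r)) (pm_space ?W r)"
    proof (rule linear_iso_trivial)
      show "vcarrier (homology 1 (K r) :: ('f, ('p list \<Rightarrow> 'f) set) vspace) = {boundaries 1 (K r)}"
        using trivial[OF r0 False] .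
      show "vcarrier (pm_space ?W r) = {\<lambda>i. 0}" unfolding interval_sum_single if_not_P[OF False] ..
    qed (auto simp: interval_sum_def)
    moreover have "\<phi> r = (\<lambda>_ i. 0)" using False by (auto simp: \<phi>_def fun_eq_iff)
    ultimately show ?thesis by (simp only:)
  qed
  have Keq: "K r = K r'" if "s \<le> r" "r \<le> r'" "r' < 2 * s" for r r'
  proof -
    have "\<forall>x\<in>Y. \<forall>y\<in>Y. d x y \<le> r \<longleftrightarrow> d x y \<le> r'"
      using that D D' D0 s by (simp add: Y_def)
    then show ?thesis unfolding K_def vr_complex_def by blast
  qed
  \<comment> \<open>If both indices are in the bar, inclusion is the identity. If only the second
    is, the source vanishes; if the second is not, the target does.\<close>
  have comm: "\<phi> r' (homology_inclusion 1 (K r') X) = pm_map ?W r r' (\<phi> r X)"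
    if r: "0 \<le> r" "r \<le> r'" and X: "X \<in> vcarrier (homology 1 (K r))" for r r' X
  proof (cases "s \<le> r' \<and> r' < 2 * s")
    case True
    note H = homology_no_boundaries[OF bd]
    obtain z where z: "X = {z}" "z \<in> cycles 1 (K r)"
      using X H(1)[of r] True r by auto
    have inc: "homology_inclusion 1 (K r') X = X" using H(4)[of r'] True z by simp
    show ?thesis
    proof (cases "s \<le> r")
      case True
      then show ?thesis unfolding inc using \<open>s \<le> r' \<and> r' < 2 * s\<close> r
        by (auto simp: \<phi>_def interval_sum_def fun_eq_iff)
    next
      case False
      then have "X = {\<lambda>xs. 0}" using trivial[of r] X r bd[of r] s by simp
      then show ?thesis unfolding inc using False
        by (auto simp: \<phi>_def interval_sum_def fun_eq_iff)
    qed
  next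
    case False
    then show ?thesis by (auto simp: \<phi>_def interval_sum_def fun_eq_iff)
  qed
  have "pmodule_isomorphic (vr_module 1 d Y :: ('f, ('p list \<Rightarrow> 'f) set) pmodule) ?W"
    unfolding pmodule_isomorphic_def vr_module_def pmodule.simps K_def[symmetric]
    using iso comm by (intro exI[of _ \<phi>]) blast
  then show ?thesis
    unfolding vr_diagram_def Y_def[symmetric] using s by (intro exI[of _ "[(s, 2 * s)]"]) simp
qed

lemma vr_persistence_set_square:
  assumes G: "metric_graph G"
  shows "(s, 2 * s) \<in> vr_persistence_set TYPE('f::field) 4 1 (graph_dist G) (realization G) \<longleftrightarrow>
    0 < s \<and> has_square G s"
proof
  assume "(s, 2 * s) \<in> vr_persistence_set TYPE('f) 4 1 (graph_dist G) (realization G)"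
  then obtain Y where "Y \<subseteq> realization G" "finite Y" "card Y \<le> 4"
    "vr_diagram TYPE('f) 1 (graph_dist G) Y {#(s, 2 * s)#}"
    unfolding vr_persistence_set_def by blast
  then show "0 < s \<and> has_square G s" using square_of_diagram[OF G] by blast
next
  assume sq: "0 < s \<and> has_square G s"
  then obtain x1 x2 x3 x4 where x: "x1 \<in> realization G" "x2 \<in> realization G" "x3 \<in> realization G"
    "x4 \<in> realization G" "square_tuple (graph_dist G) s x1 x2 x3 x4"
    by (auto simp: has_square_def)
  have "vr_diagram TYPE('f) 1 (graph_dist G) {x1, x2, x3, x4} {#(s, 2 * s)#}"
    by (rule diagram_of_square[OF x(5)]) (use sq x graph_dist_refl[OF G] graph_dist_sym[of G] in auto)
  moreover have "finite {x1, x2, x3, x4}" "card {x1, x2, x3, x4} \<le> 4" "{x1, x2, x3, x4} \<subseteq> realization G"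
    using x by (auto simp: card_insert_if)
  ultimately show "(s, 2 * s) \<in> vr_persistence_set TYPE('f) 4 1 (graph_dist G) (realization G)"
    unfolding vr_persistence_set_def by blast
qed

section \<open>The first Betti number\<close>

lemma Union_graph_simplices: "wf_graph G \<Longrightarrow> \<Union>(graph_simplices G) = verts G"
  by (auto simp: graph_simplices_def wf_graph_def)

lemma pair_in_graph_simplices:
  assumes "a \<noteq> b"
  shows "{a, b} \<in> graph_simplices G \<longleftrightarrow> {a, b} \<in> edges G"
  using assms by (auto simp: graph_simplices_def doubleton_eq_iff)

definition flow :: "'a mgraph \<Rightarrow> ('a \<Rightarrow> 'a \<Rightarrow> rat) \<Rightarrow> bool" where
  "flow G g \<longleftrightarrow> (\<forall>a b. g a b = - g b a) \<and> (\<forall>a b. g a b \<noteq> 0 \<longrightarrow> a \<noteq> b \<and> {a, b} \<in> edges G)"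

definition circulation :: "'a mgraph \<Rightarrow> ('a \<Rightarrow> 'a \<Rightarrow> rat) \<Rightarrow> bool" where
  "circulation G g \<longleftrightarrow> flow G g \<and> (\<forall>b. (\<Sum>v\<in>verts G. g v b) = 0)"

lemma flowI:
  assumes "\<And>a b. g a b = - g b a" "\<And>a b. g a b \<noteq> 0 \<Longrightarrow> a \<noteq> b \<and> {a, b} \<in> edges G"
  shows "flow G g"
  unfolding flow_def
proof (intro conjI allI)
  show "g a b = - g b a" for a b by (rule assms(1))
  show "g a b \<noteq> 0 \<longrightarrow> a \<noteq> b \<and> {a, b} \<in> edges G" for a b using assms(2)[of a b] by (rule impI)
qed

lemma flowD:
  assumes "flow G g"
  shows "g a b = - g b a" "g a b \<noteq> 0 \<Longrightarrow> a \<noteq> b \<and> {a, b} \<in> edges G"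
proof -
  have "\<forall>a b. g a b = - g b a" using assms unfolding flow_def by (rule conjunct1)
  then show "g a b = - g b a" by (elim allE)
  have "\<forall>a b. g a b \<noteq> 0 \<longrightarrow> a \<noteq> b \<and> {a, b} \<in> edges G" using assms unfolding flow_def by (rule conjunct2)
  then show "a \<noteq> b \<and> {a, b} \<in> edges G" if "g a b \<noteq> 0" using that by blast
qed

lemma cycle1_graph_simplices:
  assumes "wf_graph G"
  shows "cycle1 (graph_simplices G) g \<longleftrightarrow> circulation G g"
  unfolding cycle1_def circulation_def flow_def Union_graph_simplices[OF assms]
  using pair_in_graph_simplices[of _ _ G] by blast

text \<open>The space of circulations has dimension \<open>n\<close> over the rationals, stated with
  the kind of coordinate map by which \<open>betti1\<close> is defined.\<close>

definition cycle_rank :: "'a mgraph \<Rightarrow> nat \<Rightarrow> bool" where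
  "cycle_rank G n \<longleftrightarrow> (\<exists>\<psi>. bij_betw \<psi> {g. circulation G g} (vcarrier (coordinate_space n :: (rat, nat \<Rightarrow> rat) vspace)) \<and>
     (\<forall>g h. circulation G g \<longrightarrow> circulation G h \<longrightarrow> \<psi> (\<lambda>a b. g a b + h a b) = (\<lambda>i. \<psi> g i + \<psi> h i)) \<and>
     (\<forall>t g. circulation G g \<longrightarrow> \<psi> (\<lambda>a b. t * g a b) = (\<lambda>i. t * \<psi> g i)))"

text \<open>Uniqueness of dimension, for the definite description in \<open>betti1\<close>: the
  first \<open>m\<close> unit vectors are independent and lie in the span of the images of
  \<open>n\<close> unit vectors.\<close>

lemma coordinate_space_onto_bound:
  fixes f :: "(nat \<Rightarrow> rat) \<Rightarrow> nat \<Rightarrow> rat"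
  assumes add: "\<And>c d. c \<in> {c. \<forall>i\<ge>n. c i = 0} \<Longrightarrow> d \<in> {c. \<forall>i\<ge>n. c i = 0} \<Longrightarrow>
      f (\<lambda>i. c i + d i) = (\<lambda>i. f c i + f d i)"
    and scale: "\<And>a c. c \<in> {c. \<forall>i\<ge>n. c i = 0} \<Longrightarrow> f (\<lambda>i. a * c i) = (\<lambda>i. a * f c i)"
    and onto: "{c. \<forall>i\<ge>m. c i = 0} \<subseteq> f ` {c. \<forall>i\<ge>n. c i = 0}"
  shows "m \<le> n"
proof -
  interpret V: vector_space "\<lambda>(a::rat) (c::nat \<Rightarrow> rat) i. a * c i"
    by unfold_locales (auto simp: fun_eq_iff algebra_simps)
  define e where "e k = (\<lambda>i. if i = k then 1 else (0::rat))" for k :: nat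
  have span: "f c \<in> V.span (f ` e ` {..<n})" if "\<forall>i\<ge>k. c i = 0" "k \<le> n" for k c
    using that
  proof (induction k arbitrary: c)
    case 0
    have c0: "(\<lambda>i. 0 * c i) = c" using 0 by auto
    have "f (\<lambda>i. 0 * c i) = (\<lambda>i. 0 * f c i)" using 0 by (intro scale) auto
    then have "f c = 0" unfolding c0 by (simp add: zero_fun_def)
    then show ?case by (simp only: V.span_zero)
  next
    case (Suc k)
    define c' where "c' = c(k := 0)"
    have "f c' \<in> V.span (f ` e ` {..<n})"
      using Suc.prems by (intro Suc.IH) (auto simp: c'_def)
    moreover have "f (e k) \<in> V.span (f ` e ` {..<n})"
      using Suc.prems by (intro V.span_base) auto
    then have "(\<lambda>i. c k * f (e k) i) \<in> V.span (f ` e ` {..<n})" by (rule V.span_scale)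
    ultimately have "f c' + (\<lambda>i. c k * f (e k) i) \<in> V.span (f ` e ` {..<n})" by (rule V.span_add)
    moreover have "f c = f c' + (\<lambda>i. c k * f (e k) i)"
    proof -
      have "c = (\<lambda>i. c' i + c k * e k i)" by (auto simp: c'_def e_def)
      then have "f c = f (\<lambda>i. c' i + c k * e k i)" by (rule arg_cong)
      also have "\<dots> = (\<lambda>i. f c' i + f (\<lambda>i. c k * e k i) i)"
        using Suc.prems by (intro add) (auto simp: c'_def e_def)
      also have "f (\<lambda>i. c k * e k i) = (\<lambda>i. c k * f (e k) i)"
        using Suc.prems by (intro scale) (auto simp: e_def)
      finally show ?thesis by (simp add: plus_fun_def)
    qed
    ultimately show ?case by (simp only:)
  qed
  have inj: "inj e"
  proof (rule injI)
    fix i j assume "e i = e j"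
    from fun_cong[OF this, of i] show "i = j" by (simp add: e_def split: if_splits)
  qed
  have "V.independent (e ` {..<m})"
  proof
    assume "V.dependent (e ` {..<m})"
    then obtain T u v where T: "finite T" "T \<subseteq> e ` {..<m}" "(\<Sum>v\<in>T. (\<lambda>i. u v * v i)) = 0" "v \<in> T" "u v \<noteq> 0"
      unfolding V.dependent_explicit by (elim exE conjE bexE) (rule that)
    then obtain k where k: "v = e k" by blast
    \<comment> \<open>Evaluating the linear relation at coordinate \<open>k\<close> isolates the
      coefficient of \<open>e k\<close>.\<close>
    have sum_apply: "(\<Sum>v\<in>T. (\<lambda>i. u v * v i)) k = (\<Sum>v\<in>T. u v * v k)"
      using T(1) by (induction T rule: finite_induct) simp_all
    have wk: "w k = (if w = v then 1 else 0)" if "w \<in> T" for w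
    proof -
      obtain j where "w = e j" using T(2) \<open>w \<in> T\<close> by blast
      moreover have "e j = e k \<longleftrightarrow> j = k" using inj by (simp add: inj_eq)
      ultimately show ?thesis using k by (auto simp: e_def)
    qed
    have "(\<Sum>w\<in>T. u w * w k) = (\<Sum>w\<in>T. if w = v then u w else 0)"
    proof (rule sum.cong)
      fix w assume "w \<in> T"
      from wk[OF this] show "u w * w k = (if w = v then u w else 0)" by (cases "w = v") simp_all
    qed simp
    then have "(\<Sum>w\<in>T. u w * w k) = u v" using T(1,4) by simp
    then show False using T sum_apply by simp
  qed
  moreover have "e ` {..<m} \<subseteq> V.span (f ` e ` {..<n})"
  proof
    fix x assume "x \<in> e ` {..<m}"
    then have "x \<in> {c. \<forall>i\<ge>m. c i = 0}" by (auto simp: e_def)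
    then obtain c where "\<forall>i\<ge>n. c i = 0" "x = f c" using onto by blast
    then show "x \<in> V.span (f ` e ` {..<n})" using span[of n c] by simp
  qed
  ultimately have "card (e ` {..<m}) \<le> card (f ` e ` {..<n})"
    using V.independent_span_bound[of "f ` e ` {..<n}"] by blast
  also have "\<dots> \<le> card (e ` {..<n})" by (intro card_image_le) simp
  also have "\<dots> \<le> card {..<n}" by (intro card_image_le) simp
  finally show ?thesis using card_image[OF inj_on_subset[OF inj subset_UNIV], of "{..<m}"] by simp
qed

text \<open>The inverse of \<open>\<phi>'\<close> followed by \<open>\<phi>\<close> is a linear
  surjection between coordinate spaces. Closure of \<open>V\<close> is what makes this inverse
  linear.\<close>

lemma linear_iso_coordinate_space_le:
  assumes 1: "linear_iso \<phi> V (coordinate_space m :: (rat, nat \<Rightarrow> rat) vspace)"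
    and 2: "linear_iso \<phi>' V (coordinate_space n :: (rat, nat \<Rightarrow> rat) vspace)"
    and closed: "\<And>x y. x \<in> vcarrier V \<Longrightarrow> y \<in> vcarrier V \<Longrightarrow> vadd V x y \<in> vcarrier V"
      "\<And>a x. x \<in> vcarrier V \<Longrightarrow> vscale V a x \<in> vcarrier V"
  shows "m \<le> n"
proof (rule coordinate_space_onto_bound)
  let ?C = "{c. \<forall>i\<ge>n. c i = (0::rat)}"
  have bij: "bij_betw \<phi>' (vcarrier V) ?C" using 2 by (simp add: linear_iso_def coordinate_space_def)
  have bij1: "bij_betw \<phi> (vcarrier V) {c. \<forall>i\<ge>m. c i = 0}" using 1 by (simp add: linear_iso_def coordinate_space_def)
  define g where "g = inv_into (vcarrier V) \<phi>'"
  have g: "g c \<in> vcarrier V" "\<phi>' (g c) = c" if "c \<in> ?C" for c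
  proof -
    have "c \<in> \<phi>' ` vcarrier V" using that bij unfolding bij_betw_def by blast
    then show "g c \<in> vcarrier V" "\<phi>' (g c) = c" unfolding g_def by (rule inv_into_into, rule f_inv_into_f)
  qed
  have g': "g (\<phi>' x) = x" if "x \<in> vcarrier V" for x
    unfolding g_def using bij that by (intro inv_into_f_f) (simp_all add: bij_betw_def)
  show "(\<phi> \<circ> g) (\<lambda>i. c i + d i) = (\<lambda>i. (\<phi> \<circ> g) c i + (\<phi> \<circ> g) d i)" if c: "c \<in> ?C" "d \<in> ?C" for c d
  proof -
    have "\<phi>' (vadd V (g c) (g d)) = (\<lambda>i. c i + d i)"
      using 2 g[OF c(1)] g[OF c(2)] by (simp add: linear_iso_def coordinate_space_def)
    then have "g (\<lambda>i. c i + d i) = vadd V (g c) (g d)"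
      using g'[OF closed(1)[OF g(1)[OF c(1)] g(1)[OF c(2)]]] by (simp only:)
    then show ?thesis
      using 1 g(1)[OF c(1)] g(1)[OF c(2)] by (simp add: linear_iso_def coordinate_space_def)
  qed
  show "(\<phi> \<circ> g) (\<lambda>i. a * c i) = (\<lambda>i. a * (\<phi> \<circ> g) c i)" if c: "c \<in> ?C" for a c
  proof -
    have "\<phi>' (vscale V a (g c)) = (\<lambda>i. a * c i)"
      using 2 g[OF c] by (simp add: linear_iso_def coordinate_space_def)
    then have "g (\<lambda>i. a * c i) = vscale V a (g c)"
      using g'[OF closed(2)[OF g(1)[OF c]], of a] by (simp only:)
    then show ?thesis
      using 1 g(1)[OF c] by (simp add: linear_iso_def coordinate_space_def)
  qed
  show "{c. \<forall>i\<ge>m. c i = 0} \<subseteq> (\<phi> \<circ> g) ` ?C"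
  proof
    fix c :: "nat \<Rightarrow> rat" assume "c \<in> {c. \<forall>i\<ge>m. c i = 0}"
    then have "c \<in> \<phi> ` vcarrier V" using bij1 unfolding bij_betw_def by blast
    then obtain x where x: "x \<in> vcarrier V" "c = \<phi> x" by blast
    moreover have "\<phi>' x \<in> ?C" using bij x(1) by (auto simp: bij_betw_def)
    ultimately show "c \<in> (\<phi> \<circ> g) ` ?C" using g'[OF x(1)] by (intro image_eqI[of _ _ "\<phi>' x"]) simp_all
  qed
qed

lemma flow_add: "flow G g \<Longrightarrow> flow G h \<Longrightarrow> flow G (\<lambda>a b. g a b + h a b)"
proof (rule flowI)
  assume gh: "flow G g" "flow G h"
  show "g a b + h a b = - (g b a + h b a)" for a b
    using flowD(1)[OF gh(1), of a b] flowD(1)[OF gh(2), of a b] by simp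
  show "a \<noteq> b \<and> {a, b} \<in> edges G" if "g a b + h a b \<noteq> 0" for a b
    using flowD(2)[OF gh(1), of a b] flowD(2)[OF gh(2), of a b] that by (cases "g a b = 0") auto
qed

lemma flow_scale: "flow G g \<Longrightarrow> flow G (\<lambda>a b. t * g a b)"
proof (rule flowI)
  assume g: "flow G g"
  show "t * g a b = - (t * g b a)" for a b using flowD(1)[OF g, of a b] by simp
  show "a \<noteq> b \<and> {a, b} \<in> edges G" if "t * g a b \<noteq> 0" for a b
    using flowD(2)[OF g, of a b] that by auto
qed

lemma circulation_add: "circulation G g \<Longrightarrow> circulation G h \<Longrightarrow> circulation G (\<lambda>a b. g a b + h a b)"
  unfolding circulation_def by (simp add: flow_add sum.distrib)

lemma circulation_scale: "circulation G g \<Longrightarrow> circulation G (\<lambda>a b. t * g a b)"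
  unfolding circulation_def by (simp add: flow_scale flip: sum_distrib_left)

definition edge_flow :: "'a \<Rightarrow> 'a \<Rightarrow> 'a \<Rightarrow> 'a \<Rightarrow> rat" where
  "edge_flow u w a b = (if a = u \<and> b = w then 1 else if a = w \<and> b = u then - 1 else 0)"

lemma flow_edge_flow: "{u, w} \<in> edges G \<Longrightarrow> u \<noteq> w \<Longrightarrow> flow G (edge_flow u w)"
  by (rule flowI) (auto simp: edge_flow_def insert_commute split: if_splits)

lemma sum_edge_flow:
  assumes "finite V" "u \<in> V" "w \<in> V" "u \<noteq> w"
  shows "(\<Sum>a\<in>V. edge_flow u w a b) = (if b = w then 1 else 0) - (if b = u then 1 else 0)"
proof -
  have "edge_flow u w a b = (if a = u then if b = w then 1 else 0 else 0) - (if a = w then if b = u then 1 else 0 else 0)"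
    for a using assms by (auto simp: edge_flow_def)
  then show ?thesis using assms by (simp add: sum_subtractf)
qed

text \<open>The vertices that a unit flow from \<open>u\<close> can reach are closed under passing
  along an edge, because the flow of that edge can be added; by \<open>crossing_edge\<close> they
  are all vertices. The sums are net inflows: 1 at the sink \<open>w\<close>, -1 at the source
  \<open>u\<close>.\<close>

lemma unit_flow_exists:
  assumes G: "metric_graph G" and "u \<in> verts G" "w \<in> verts G"
  obtains h where "flow G h"
    "\<And>b. (\<Sum>v\<in>verts G. h v b) = (if b = w then 1 else 0) - (if b = u then 1 else 0)"
proof -
  have wf: "wf_graph G" and fin: "finite (verts G)"
    using metric_graph_wf[OF G] by (auto simp: wf_graph_def)
  define R where "R = {w \<in> verts G. \<exists>h. flow G h \<and>
    (\<forall>b. (\<Sum>v\<in>verts G. h v b) = (if b = w then 1 else 0) - (if b = u then 1 else 0))}"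
  have "flow G (\<lambda>a b. 0)" by (simp add: flow_def)
  then have uR: "u \<in> R" using assms(2) unfolding R_def by (intro CollectI conjI exI[of _ "\<lambda>a b. 0"]) auto
  have "R = verts G"
  proof (rule ccontr)
    assume "R \<noteq> verts G"
    then obtain a b where ab: "{a, b} \<in> edges G" "a \<in> R" "b \<in> verts G - R"
      using crossing_edge[OF G, of R] uR unfolding R_def by blast
    then obtain h where h: "flow G h"
      "\<And>b. (\<Sum>v\<in>verts G. h v b) = (if b = a then 1 else 0) - (if b = u then 1 else 0)"
      unfolding R_def by blast
    note e = wf_graph_edgeD[OF wf ab(1)]
    have "flow G (\<lambda>x y. h x y + edge_flow a b x y)"
      using flow_add[OF h(1) flow_edge_flow[OF ab(1) e(1)]] .
    moreover have "(\<Sum>v\<in>verts G. h v y + edge_flow a b v y) = (if y = b then 1 else 0) - (if y = u then 1 else 0)" for y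
      by (simp add: sum.distrib h(2) sum_edge_flow[OF fin e(2,3,1)])
    ultimately have "b \<in> R" using e(3) unfolding R_def by blast
    then show False using ab by blast
  qed
  then show ?thesis using assms(3) that unfolding R_def by blast
qed

text \<open>Conservation at the vertex \<open>w\<close> of degree one forces the flow on the leaf
  edge to be 0.\<close>

lemma circulation_leaf:
  assumes wf: "wf_graph G" "wf_graph H"
    and V: "verts G = insert w (verts H)" and E: "edges G = insert {u, w} (edges H)"
    and uw: "u \<in> verts H" "w \<notin> verts H"
  shows "circulation G g \<longleftrightarrow> circulation H g"
proof -
  have finH: "finite (verts H)" using wf by (simp add: wf_graph_def)
  have sumG: "(\<Sum>v\<in>verts G. g v b) = g w b + (\<Sum>v\<in>verts H. g v b)" for b
    using uw finH by (simp add: V)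
  have noH: "{a, w} \<notin> edges H" for a using wf_graph_edgeD[OF wf(2)] uw by blast
  show ?thesis
  proof
    assume "circulation G g"
    then have fl: "flow G g" and cyc: "\<And>b. (\<Sum>v\<in>verts G. g v b) = 0" unfolding circulation_def by blast+
    have "g v w = 0" if "v \<in> verts H - {u}" for v
      using flowD(2)[OF fl, of v w] that noH[of v] uw unfolding E by (auto simp: doubleton_eq_iff)
    then have "(\<Sum>v\<in>verts H. g v w) = g u w" using finH uw by (simp add: sum.remove[of _ u])
    moreover have "g w w = 0" using flowD(2)[OF fl, of w w] by blast
    ultimately have uw0: "g u w = 0" using cyc[of w] sumG[of w] by simp
    then have wu0: "g w u = 0" using flowD(1)[OF fl, of w u] by simp
    have ne': "a \<noteq> b \<and> {a, b} \<in> edges H" if "g a b \<noteq> 0" for a b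
      using flowD(2)[OF fl that] uw0 wu0 that unfolding E by (auto simp: doubleton_eq_iff)
    have "g w b = 0" for b using ne'[of w b] noH[of b] by (auto simp: insert_commute)
    then have "(\<Sum>v\<in>verts H. g v b) = 0" for b using cyc[of b] sumG[of b] by simp
    moreover have "flow H g" by (rule flowI[OF flowD(1)[OF fl] ne'])
    ultimately show "circulation H g" unfolding circulation_def by blast
  next
    assume "circulation H g"
    then have fl: "flow H g" and cyc: "\<And>b. (\<Sum>v\<in>verts H. g v b) = 0" unfolding circulation_def by blast+
    have "g w b = 0" for b using flowD(2)[OF fl, of w b] noH[of b] by (auto simp: insert_commute)
    then have "(\<Sum>v\<in>verts G. g v b) = 0" for b using cyc sumG by simp
    moreover have "flow G g"
      by (rule flowI[OF flowD(1)[OF fl]]) (use flowD(2)[OF fl] E in blast)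
    ultimately show "circulation G g" unfolding circulation_def by blast
  qed
qed

text \<open>The flow through the new edge is one more coordinate. Its kernel consists of the old
  circulations, and a circulation through the new edge splits it off.\<close>

lemma cycle_rank_close:
  assumes H: "metric_graph H" and V: "verts G = verts H" and E: "edges G = insert {u, w} (edges H)"
    and uw: "{u, w} \<notin> edges H" "u \<in> verts H" "w \<in> verts H" "u \<noteq> w" and rank: "cycle_rank H n"
  shows "cycle_rank G (Suc n)"
proof -
  have fin: "finite (verts H)" using metric_graph_wf[OF H] by (simp add: wf_graph_def)
  obtain h where h: "flow H h"
    "\<And>b. (\<Sum>v\<in>verts H. h v b) = (if b = u then 1 else 0) - (if b = w then 1 else 0)"
    using unit_flow_exists[OF H uw(3,2)] by blast
  \<comment> \<open>A fundamental circulation of the new edge: along it from \<open>u\<close> to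
    \<open>w\<close>, and back through \<open>H\<close> by a unit flow.\<close>
  define z where "z a b = h a b + edge_flow u w a b" for a b
  have sub: "flow G g" if "flow H g" for g
    by (rule flowI[OF flowD(1)[OF that]]) (use flowD(2)[OF that] E in blast)
  have "flow G z" unfolding z_def using E uw by (intro flow_add sub[OF h(1)] flow_edge_flow) auto
  moreover have "(\<Sum>v\<in>verts G. z v b) = 0" for b
    unfolding z_def V by (simp add: sum.distrib h(2) sum_edge_flow[OF fin uw(2,3,4)])
  ultimately have z: "circulation G z" unfolding circulation_def by blast
  have "h u w = 0" using flowD(2)[OF h(1), of u w] uw by blast
  then have zuw: "z u w = 1" by (simp add: z_def edge_flow_def)
  have HG: "circulation H g \<longleftrightarrow> circulation G g \<and> g u w = 0" for g
  proof
    assume "circulation H g"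
    then have fl: "flow H g" and cyc: "\<And>b. (\<Sum>v\<in>verts H. g v b) = 0" unfolding circulation_def by blast+
    then show "circulation G g \<and> g u w = 0"
      using sub[OF fl] flowD(2)[OF fl, of u w] uw(1) unfolding circulation_def V by blast
  next
    assume g: "circulation G g \<and> g u w = 0"
    then have fl: "flow G g" unfolding circulation_def by blast
    then have wu: "g w u = 0" using g flowD(1)[OF fl, of w u] by simp
    have "flow H g"
    proof (rule flowI[OF flowD(1)[OF fl]])
      fix a b assume ab: "g a b \<noteq> 0"
      then have "\<not> (a = u \<and> b = w)" "\<not> (a = w \<and> b = u)" using g wu by auto
      then show "a \<noteq> b \<and> {a, b} \<in> edges H" using flowD(2)[OF fl ab] unfolding E by (auto simp: doubleton_eq_iff)
    qed
    then show "circulation H g" using g unfolding circulation_def V by blast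
  qed
  obtain \<psi> where bij: "bij_betw \<psi> {g. circulation H g} (vcarrier (coordinate_space n :: (rat, nat \<Rightarrow> rat) vspace))"
    and add: "\<And>g h. circulation H g \<Longrightarrow> circulation H h \<Longrightarrow> \<psi> (\<lambda>a b. g a b + h a b) = (\<lambda>i. \<psi> g i + \<psi> h i)"
    and scale: "\<And>t g. circulation H g \<Longrightarrow> \<psi> (\<lambda>a b. t * g a b) = (\<lambda>i. t * \<psi> g i)"
    using rank unfolding cycle_rank_def by blast
  \<comment> \<open>The projection onto the circulations of \<open>H\<close> along \<open>z\<close>,
    using that \<open>z\<close> carries 1 on the new edge.\<close>
  define r where "r g = (\<lambda>a b. g a b + (- g u w) * z a b)" for g
  have r: "circulation H (r g)" if "circulation G g" for g
    unfolding HG r_def using circulation_add[OF that circulation_scale[OF z, of "- g u w"]] zuw by simp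
  define \<psi>' where "\<psi>' g = (\<lambda>i. if i < n then \<psi> (r g) i else if i = n then g u w else 0)" for g
  have bij': "bij_betw \<psi>' {g. circulation G g} (vcarrier (coordinate_space (Suc n) :: (rat, nat \<Rightarrow> rat) vspace))"
    unfolding bij_betw_def
  proof
    show "inj_on \<psi>' {g. circulation G g}"
    proof (rule inj_onI)
      fix f g assume f: "f \<in> {g. circulation G g}" and g: "g \<in> {g. circulation G g}" and eq: "\<psi>' f = \<psi>' g"
      have uweq: "f u w = g u w" using fun_cong[OF eq, of n] by (simp add: \<psi>'_def)
      have "\<psi> (r f) \<in> vcarrier (coordinate_space n)" "\<psi> (r g) \<in> vcarrier (coordinate_space n)"
        using bij r f g by (auto simp: bij_betw_def)
      then have "\<psi> (r f) = \<psi> (r g)"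
      proof (intro ext)
        fix i assume "\<psi> (r f) \<in> vcarrier (coordinate_space n)" "\<psi> (r g) \<in> vcarrier (coordinate_space n)"
        then show "\<psi> (r f) i = \<psi> (r g) i" using fun_cong[OF eq, of i] by (cases "i < n") (auto simp: \<psi>'_def coordinate_space_def)
      qed
      then have "r f = r g"
        using bij r f g by (auto simp: bij_betw_def inj_on_def)
      then have "r f a b = r g a b" for a b by simp
      then show "f = g" by (intro ext) (simp add: r_def uweq)
    qed
    show "\<psi>' ` {g. circulation G g} = vcarrier (coordinate_space (Suc n))"
    proof (intro equalityI subsetI)
      fix c assume "c \<in> \<psi>' ` {g. circulation G g}"
      then show "c \<in> vcarrier (coordinate_space (Suc n))" by (auto simp: \<psi>'_def coordinate_space_def)
    next
      fix c :: "nat \<Rightarrow> rat" assume c: "c \<in> vcarrier (coordinate_space (Suc n))"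
      define c' where "c' i = (if i < n then c i else 0)" for i
      have "c' \<in> vcarrier (coordinate_space n)" by (simp add: c'_def coordinate_space_def)
      then obtain g where g: "circulation H g" "\<psi> g = c'" using bij by (force simp: bij_betw_def)
      define f where "f = (\<lambda>a b. g a b + c n * z a b)"
      have f: "circulation G f"
        unfolding f_def using circulation_add[OF _ circulation_scale[OF z]] g(1) HG by blast
      have fuw: "f u w = c n" using g(1) HG zuw by (simp add: f_def)
      have "r f = g" unfolding r_def fuw by (simp add: f_def)
      then have "\<psi>' f i = c i" for i
        using fuw g(2) c by (cases "i < n"; cases "i = n") (auto simp: \<psi>'_def c'_def coordinate_space_def)
      then have "\<psi>' f = c" by blast
      then show "c \<in> \<psi>' ` {g. circulation G g}" using f by blast
    qed
  qed
  moreover have "\<psi>' (\<lambda>a b. g a b + h a b) = (\<lambda>i. \<psi>' g i + \<psi>' h i)" if gh: "circulation G g" "circulation G h" for g h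
  proof -
    have "r (\<lambda>a b. g a b + h a b) = (\<lambda>a b. r g a b + r h a b)" by (simp add: r_def algebra_simps fun_eq_iff)
    then show ?thesis using add[OF r[OF gh(1)] r[OF gh(2)]] by (auto simp: \<psi>'_def)
  qed
  moreover have "\<psi>' (\<lambda>a b. t * g a b) = (\<lambda>i. t * \<psi>' g i)" if g: "circulation G g" for t g
  proof -
    have "r (\<lambda>a b. t * g a b) = (\<lambda>a b. t * r g a b)" by (simp add: r_def algebra_simps fun_eq_iff)
    then show ?thesis using scale[OF r[OF g]] by (auto simp: \<psi>'_def)
  qed
  ultimately show ?thesis unfolding cycle_rank_def by blast
qed


text \<open>A one-dimensional complex has no 2-simplices, hence no boundaries in degree 1, and its
  homology is the space of circulations.\<close>

lemma betti1_eq: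
  assumes wf: "wf_graph G" and rank: "cycle_rank G n"
  shows "betti1 G = n"
proof -
  let ?K = "graph_simplices G"
  let ?V = "homology 1 ?K :: (rat, ('a list \<Rightarrow> rat) set) vspace"
  have circ: "{g. cycle1 ?K g} = {g. circulation G g}" using cycle1_graph_simplices[OF wf] by blast
  have B: "(boundaries 1 ?K :: ('a list \<Rightarrow> rat) set) = {\<lambda>xs. 0}"
  proof (rule boundaries_trivial)
    fix \<sigma> assume "\<sigma> \<in> ?K"
    then have "card \<sigma> \<le> 2" using wf by (auto simp: graph_simplices_def wf_graph_def)
    then show "card \<sigma> \<noteq> Suc (Suc 1)" by simp
  qed
  obtain \<psi> where \<psi>: "bij_betw \<psi> {g. circulation G g} (vcarrier (coordinate_space n :: (rat, nat \<Rightarrow> rat) vspace))"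
    "\<And>g h. circulation G g \<Longrightarrow> circulation G h \<Longrightarrow> \<psi> (\<lambda>a b. g a b + h a b) = (\<lambda>i. \<psi> g i + \<psi> h i)"
    "\<And>t g. circulation G g \<Longrightarrow> \<psi> (\<lambda>a b. t * g a b) = (\<lambda>i. t * \<psi> g i)"
    using rank unfolding cycle_rank_def by blast
  have iso: "linear_iso (\<lambda>X. \<psi> (\<lambda>a b. the_elem X [a, b])) ?V (coordinate_space n)"
    by (rule linear_iso_homology1[OF B])
      (use \<psi> cycle1_graph_simplices[OF wf] circ in \<open>auto simp: coordinate_space_def\<close>)
  note H = homology_no_boundaries[OF B]
  have car: "vcarrier ?V = (\<lambda>g. {chain1 g}) ` {g. circulation G g}"
    unfolding H(1) cycles1_eq image_image circ ..
  have closed1: "vadd ?V x y \<in> vcarrier ?V" if xy: "x \<in> vcarrier ?V" "y \<in> vcarrier ?V" for x y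
  proof -
    obtain g h where gh: "x = {chain1 g}" "y = {chain1 h}" "circulation G g" "circulation G h"
      using xy unfolding car by blast
    have "vadd ?V x y = {chain1 (\<lambda>a b. g a b + h a b)}"
      unfolding gh H(2) chain_add_chain1 ..
    then show ?thesis unfolding car using circulation_add[OF gh(3,4)] by blast
  qed
  have closed2: "vscale ?V a x \<in> vcarrier ?V" if x: "x \<in> vcarrier ?V" for a x
  proof -
    obtain g where g: "x = {chain1 g}" "circulation G g" using x unfolding car by blast
    have "vscale ?V a x = {chain1 (\<lambda>b c. a * g b c)}"
      unfolding g H(3) chain_scale_chain1 ..
    then show ?thesis unfolding car using circulation_scale[OF g(2)] by blast
  qed
  show ?thesis unfolding betti1_def
  proof (rule the_equality)
    show "\<exists>\<phi>. linear_iso \<phi> ?V (coordinate_space n)" using iso by blast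
    fix m assume "\<exists>\<phi>. linear_iso \<phi> ?V (coordinate_space m)"
    then obtain \<phi> where \<phi>: "linear_iso \<phi> ?V (coordinate_space m)" by blast
    show "m = n"
      using linear_iso_coordinate_space_le[OF \<phi> iso closed1 closed2]
        linear_iso_coordinate_space_le[OF iso \<phi> closed1 closed2] by simp
  qed
qed

section \<open>The Betti number after attaching a path\<close>

context attached_path
begin

definition initial_part where
  "initial_part k = \<lparr>verts = verts H \<union> p ` {1..k}, edges = edges H \<union> (\<lambda>i. {p i, p (Suc i)}) ` {..<k}, elen = elen G\<rparr>"

lemma initial_part_attached:
  assumes "0 < k" "k \<le> n" "p k \<notin> verts H"
  shows "attached_path H (initial_part k) p k"
proof
  show "metric_subgraph H (initial_part k)"
    using sub by (auto simp: metric_subgraph_def initial_part_def)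
  show "inj_on p {1..<k}" by (rule inj_on_subset[OF inj]) (use assms(2) in auto)
  show "p ` {1..<k} \<inter> verts H = {}" proof -
    have "p ` {1..<k} \<subseteq> p ` {1..<n}" using assms(2) by (intro image_mono) auto
    then show ?thesis using new by blast
  qed
  show "p k \<in> verts H \<or> p k \<notin> p ` {1..<k}" proof (intro disjI2 notI)
    assume "p k \<in> p ` {1..<k}"
    then obtain j where "j < k" "p k = p j" by auto
    then show False using new_inj[of k j] assms by simp
  qed
  show "p k = p 0 \<Longrightarrow> 3 \<le> k" using assms p0 by simp
  show "0 < elen (initial_part k) {p i, p (Suc i)}" if "i < k" for i
    using pos[of i] that assms by (simp add: initial_part_def)
qed (use H p0 assms in \<open>auto simp: initial_part_def\<close>)

lemma initial_part_circulation:
  assumes "k \<le> n" "0 < k \<Longrightarrow> p k \<notin> verts H"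
  shows "circulation (initial_part k) g \<longleftrightarrow> circulation H g"
  using assms
proof (induction k)
  case 0
  then show ?case by (simp add: initial_part_def circulation_def flow_def)
next
  case (Suc k)
  have k: "0 < k \<Longrightarrow> p k \<notin> verts H" using new_verts[of k] Suc.prems by simp
  have "wf_graph (initial_part (Suc k))"
    using attached_path.wf_G[OF initial_part_attached[of "Suc k"]] Suc.prems by simp
  moreover have "wf_graph (initial_part k)"
  proof (cases "k = 0")
    case True
    then show ?thesis using wf_H sub by (auto simp: initial_part_def wf_graph_def metric_subgraph_def)
  next
    case False
    then show ?thesis using attached_path.wf_G[OF initial_part_attached[of k]] Suc.prems k by simp
  qed
  moreover have "p (Suc k) \<notin> verts (initial_part k)"
  proof
    assume "p (Suc k) \<in> verts (initial_part k)"
    then obtain j where "1 \<le> j" "j \<le> k" "p (Suc k) = p j"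
      using Suc.prems by (auto simp: initial_part_def)
    then show False using new_inj[of "Suc k" j] Suc.prems by simp
  qed
  moreover have "p k \<in> verts (initial_part k)" using p0 by (cases k) (auto simp: initial_part_def)
  ultimately have "circulation (initial_part (Suc k)) g \<longleftrightarrow> circulation (initial_part k) g"
    by (intro circulation_leaf[of _ _ "p (Suc k)" "p k"])
      (auto simp: initial_part_def atLeastAtMostSuc_conv lessThan_Suc)
  then show ?case using Suc k by simp
qed

lemma cycle_rank_open:
  assumes "p n \<notin> verts H" "cycle_rank H b"
  shows "cycle_rank G b"
proof -
  have "circulation G g \<longleftrightarrow> circulation (initial_part n) g" for g
    by (simp add: circulation_def flow_def initial_part_def vG eG)
  then have "circulation G = circulation H"
    using initial_part_circulation[of n] assms(1) by (intro ext) simp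
  then show ?thesis using assms(2) unfolding cycle_rank_def by (simp only:)
qed

text \<open>All edges of the path but the last are leaves when added in order; the last one joins
  two vertices already present and raises the rank.\<close>

lemma cycle_rank_closed:
  assumes closed: "p n \<in> verts H" and rank: "cycle_rank H b"
  shows "cycle_rank G (Suc b)"
proof -
  obtain k where k: "n = Suc k" "0 < k" using n2[OF closed] by (cases n) auto
  have pk: "p k \<notin> verts H" using new_verts[of k] k by simp
  interpret I: attached_path H "initial_part k" p k
    using initial_part_attached[of k] k pk by simp
  have "circulation (initial_part k) = circulation H"
    using initial_part_circulation[of k] k pk by (intro ext) simp
  then have "cycle_rank (initial_part k) b"
    using rank unfolding cycle_rank_def by (simp only:)
  moreover have "{p k, p n} \<notin> edges (initial_part k)"
  proof
    assume "{p k, p n} \<in> edges (initial_part k)"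
    then obtain i where "i < k" "{p k, p (Suc k)} = {p i, p (Suc i)}"
      using path_edge_not_H[of k] k by (auto simp: initial_part_def)
    then show False using path_edge_inj[of k i] k by simp
  qed
  moreover have "p ` {1..n} = insert (p n) (p ` {1..k})" using k by (auto simp: atLeastAtMostSuc_conv)
  then have "verts G = verts (initial_part k)" using closed by (auto simp: vG initial_part_def)
  moreover have "edges G = insert {p k, p n} (edges (initial_part k))"
    using k by (auto simp: eG initial_part_def lessThan_Suc)
  moreover have "p k \<in> verts (initial_part k)" "p n \<in> verts (initial_part k)" "p k \<noteq> p n"
    using k closed pk by (auto simp: initial_part_def)
  ultimately show ?thesis using cycle_rank_close[OF I.metric_graph_G] by blast
qed

end

section \<open>Polygons and circles\<close>

lemma Arg2pi_inj_on_circle: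
  fixes z w c :: complex
  assumes "norm z = 1" "norm w = 1" "norm c = 1" "Arg2pi (z / c) = Arg2pi (w / c)"
  shows "z = w"
proof -
  have nz: "norm (z / c) = 1" and nw: "norm (w / c) = 1" using assms by (auto simp: norm_divide)
  have "z / c = exp (\<i> * Arg2pi (z / c))" using Arg2pi_eq[of "z / c"] nz by (auto)
  moreover have "w / c = exp (\<i> * Arg2pi (w / c))" using Arg2pi_eq[of "w / c"] nw by (auto)
  ultimately have "z / c = w / c" using assms(4) by simp
  then show ?thesis using assms(3) by auto
qed

lemma circle_minus_point_connected:
  fixes c :: complex
  assumes "norm c = 1"
  shows "connected (sphere 0 1 - {c})"
proof -
  have "sphere 0 1 - {c} = (\<lambda>t. c * exp (\<i> * complex_of_real t)) ` {0<..<2 * pi}"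
  proof (intro equalityI subsetI)
    fix z assume z: "z \<in> sphere 0 1 - {c}"
    have "c \<noteq> 0" using assms by auto
    have nz: "norm (z / c) = 1" using z assms by (auto simp: norm_divide)
    have e: "z / c = exp (\<i> * Arg2pi (z / c))" using Arg2pi_eq[of "z / c"] nz by auto
    have "Arg2pi (z / c) \<noteq> 0"
    proof
      assume "Arg2pi (z / c) = 0"
      then have "z / c = 1" using e by simp
      then show False using z \<open>c \<noteq> 0\<close> by simp
    qed
    then have "Arg2pi (z / c) \<in> {0<..<2 * pi}"
      using Arg2pi_ge_0[of "z / c"] Arg2pi_lt_2pi[of "z / c"] by simp
    moreover have "z = c * exp (\<i> * complex_of_real (Arg2pi (z / c)))"
      using e \<open>c \<noteq> 0\<close> by (metis nonzero_mult_div_cancel_left times_divide_eq_right)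
    ultimately show "z \<in> (\<lambda>t. c * exp (\<i> * complex_of_real t)) ` {0<..<2 * pi}" by blast
  next
    fix z assume "z \<in> (\<lambda>t. c * exp (\<i> * complex_of_real t)) ` {0<..<2 * pi}"
    then obtain t where t: "0 < t" "t < 2 * pi" "z = c * exp (\<i> * complex_of_real t)" by auto
    have "exp (\<i> * complex_of_real t) \<noteq> 1"
    proof
      assume "exp (\<i> * complex_of_real t) = 1"
      then have "Arg2pi 1 = t" using t by (intro Arg2pi_unique[of 1]) auto
      moreover have "Arg2pi 1 = 0" by (rule Arg2pi_unique[of 1]) auto
      ultimately show False using t by simp
    qed
    moreover have "norm z = 1" using t assms by (simp add: norm_mult)
    moreover have "c \<noteq> 0" using assms by auto
    ultimately show "z \<in> sphere 0 1 - {c}" using t by auto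
  qed
  moreover have "connected ((\<lambda>t. c * exp (\<i> * complex_of_real t)) ` {0<..<2 * pi})"
    by (intro connected_continuous_image continuous_intros) auto
  ultimately show ?thesis by simp
qed

text \<open>If a point \<open>c\<close> were missed, the angle measured from \<open>c\<close> would
  be continuous and injective on the image, and the circle would embed into the real line.\<close>

lemma circle_self_embedding_onto:
  fixes f :: "complex \<Rightarrow> complex"
  assumes "continuous_on (sphere 0 1) f" "inj_on f (sphere 0 1)" "f ` sphere 0 1 \<subseteq> sphere 0 1"
  shows "f ` sphere 0 1 = sphere 0 1"
proof (rule ccontr)
  assume "f ` sphere 0 1 \<noteq> sphere 0 1"
  then obtain c where c: "c \<in> sphere 0 1" "c \<notin> f ` sphere 0 1" using assms(3) by blast
  then have nc: "norm c = 1" "c \<noteq> 0" by auto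
  define g where "g z = Arg2pi (f z / c)" for z
  have nf: "norm (f z) = 1" if "z \<in> sphere 0 1" for z
  proof -
    have "f z \<in> sphere 0 1" using assms(3) that by blast
    then show ?thesis by simp
  qed
  have "continuous_on (sphere 0 1) g"
    unfolding g_def
  proof (rule continuous_on_compose2[of "- \<real>\<^sub>\<ge>\<^sub>0" Arg2pi])
    show "continuous_on (- \<real>\<^sub>\<ge>\<^sub>0) Arg2pi"
      by (intro continuous_at_imp_continuous_on ballI continuous_at_Arg2pi) simp
    show "continuous_on (sphere 0 1) (\<lambda>z. f z / c)"
      using nc by (intro continuous_intros assms(1)) auto
    show "(\<lambda>z. f z / c) ` sphere 0 1 \<subseteq> - \<real>\<^sub>\<ge>\<^sub>0"
    proof clarify
      fix z assume z: "z \<in> sphere 0 1" "f z / c \<in> \<real>\<^sub>\<ge>\<^sub>0"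
      then obtain r where r: "f z / c = of_real r" "0 \<le> r" by (auto elim: nonneg_Reals_cases)
      have "norm (f z / c) = 1" using nf[OF z(1)] nc by (simp add: norm_divide)
      then have "f z / c = 1" using r by simp
      then show False using c z nc by auto
    qed
  qed
  moreover have "inj_on g (sphere 0 1)"
  proof (rule inj_onI)
    fix z w assume z: "z \<in> sphere (0::complex) 1" and w: "w \<in> sphere (0::complex) 1" and "g z = g w"
    then have "f z = f w" using Arg2pi_inj_on_circle[OF nf nf nc(1)] by (simp add: g_def)
    then show "z = w" using assms(2) z w by (auto simp: inj_on_def)
  qed
  ultimately have "DIM(complex) \<le> DIM(real)" using no_embedding_sphere_lowdim[of 0 1 g] by simp
  then show False by simp
qed

text \<open>For a polygon found inside a metric cycle: it exhausts the cycle.\<close>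

lemma circle_in_circle:
  fixes X Z :: "'b::topological_space set"
  assumes X: "X homeomorphic sphere (0::complex) 1" and Z: "Z homeomorphic sphere (0::complex) 1"
    and "Z \<subseteq> X"
  shows "Z = X"
proof -
  obtain h h' where h: "homeomorphism X (sphere (0::complex) 1) h h'" using X unfolding homeomorphic_def by blast
  obtain k k' where k: "homeomorphism (sphere (0::complex) 1) Z k k'"
    using Z[THEN homeomorphic_sym[THEN iffD1]] unfolding homeomorphic_def by blast
  have inj: "inj_on h X" by (rule inj_on_inverseI[of _ h']) (rule homeomorphism_apply1[OF h])
  have injk: "inj_on k (sphere 0 1)" by (rule inj_on_inverseI[of _ k']) (rule homeomorphism_apply1[OF k])
  have kZ: "k ` sphere 0 1 = Z" and hX: "h ` X = sphere 0 1" using h k by (auto simp: homeomorphism_def)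
  have "(h \<circ> k) ` sphere 0 1 = sphere 0 1"
  proof (rule circle_self_embedding_onto)
    show "continuous_on (sphere 0 1) (h \<circ> k)"
    proof (rule continuous_on_compose)
      show "continuous_on (sphere 0 1) k" using k by (simp add: homeomorphism_def)
      show "continuous_on (k ` sphere 0 1) h"
        unfolding kZ by (rule continuous_on_subset[OF _ assms(3)]) (use h in \<open>simp add: homeomorphism_def\<close>)
    qed
    show "inj_on (h \<circ> k) (sphere 0 1)"
      by (rule comp_inj_on[OF injk]) (rule inj_on_subset[OF inj], use kZ assms(3) in simp)
    have "(h \<circ> k) ` sphere 0 1 = h ` Z" unfolding image_comp[symmetric] kZ ..
    then show "(h \<circ> k) ` sphere 0 1 \<subseteq> sphere 0 1" using hX assms(3) by blast
  qed
  then have "h ` Z = h ` X" unfolding image_comp[symmetric] kZ hX .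
  then show ?thesis using inj_on_image_eq_iff[OF inj assms(3) subset_refl] by blast
qed

section \<open>Polygons and their realizations\<close>

definition polygon :: "'a mgraph \<Rightarrow> (nat \<Rightarrow> 'a) \<Rightarrow> nat \<Rightarrow> bool" where
  "polygon C p n \<longleftrightarrow> 3 \<le> n \<and> inj_on p {..<n} \<and> verts C = p ` {..<n} \<and>
     edges C = (\<lambda>i. {p i, p (Suc i mod n)}) ` {..<n} \<and> (\<forall>e\<in>edges C. 0 < elen C e)"

text \<open>Reducing indices modulo \<open>n\<close> turns the polygon into a closed path from
  \<open>p 0\<close> to itself.\<close>

lemma attach_polygon_at_vertex:
  assumes C: "polygon C p n" and H: "metric_graph H" and sub: "metric_subgraph H G"
    and V: "verts G = verts H \<union> verts C" and E: "edges G = edges H \<union> edges C"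
    and len: "\<And>e. e \<in> edges C \<Longrightarrow> elen G e = elen C e" and I: "verts H \<inter> verts C = {p 0}"
  shows "attached_path H G (\<lambda>i. p (i mod n)) n"
proof
  have n: "3 \<le> n" and inj: "inj_on p {..<n}" and VC: "verts C = p ` {..<n}"
    and EC: "edges C = (\<lambda>i. {p i, p (Suc i mod n)}) ` {..<n}" and pos: "\<forall>e\<in>edges C. 0 < elen C e"
    using C by (auto simp: polygon_def)
  have idx: "(\<lambda>i. p (i mod n)) ` {1..<n} = p ` {1..<n}" by (intro image_cong) auto
  have p0: "p 0 \<in> verts H" using I by blast
  then show "p (0 mod n) \<in> verts H" by simp
  show "inj_on (\<lambda>i. p (i mod n)) {1..<n}" using inj by (auto simp: inj_on_def)
  have nw: "p i \<notin> verts H" if "0 < i" "i < n" for i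
  proof
    assume "p i \<in> verts H"
    then have "p i = p 0" using I VC that by blast
    then show False using inj_onD[OF inj, of i 0] that by simp
  qed
  then show "(\<lambda>i. p (i mod n)) ` {1..<n} \<inter> verts H = {}" unfolding idx by auto
  show "p (n mod n) \<in> verts H \<or> p (n mod n) \<notin> (\<lambda>i. p (i mod n)) ` {1..<n}" using p0 by simp
  have "(\<lambda>i. p (i mod n)) ` {1..n} = p ` {..<n}"
  proof (intro equalityI subsetI)
    fix x assume "x \<in> (\<lambda>i. p (i mod n)) ` {1..n}"
    then show "x \<in> p ` {..<n}" using n by auto
  next
    fix x assume "x \<in> p ` {..<n}"
    then obtain i where "i < n" "x = p i" by auto
    then have "x = p ((if i = 0 then n else i) mod n)" "(if i = 0 then n else i) \<in> {1..n}" using n by auto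
    then show "x \<in> (\<lambda>i. p (i mod n)) ` {1..n}" by blast
  qed
  then show "verts G = verts H \<union> (\<lambda>i. p (i mod n)) ` {1..n}" using V VC by simp
  have "(\<lambda>i. {p (i mod n), p (Suc i mod n)}) ` {..<n} = edges C"
    unfolding EC by (intro image_cong) auto
  then show "edges G = edges H \<union> (\<lambda>i. {p (i mod n), p (Suc i mod n)}) ` {..<n}" using E by simp
  show "0 < elen G {p (i mod n), p (Suc i mod n)}" if "i < n" for i
    using len[of "{p i, p (Suc i mod n)}"] pos EC that by auto
qed (use H sub C in \<open>auto simp: polygon_def\<close>)

lemma metric_graph_single:
  assumes "verts G = {v}" "edges G = {}"
  shows "metric_graph G"
proof -
  have wf: "wf_graph G" using assms by (simp add: wf_graph_def)
  have "x = vertex_point v" if "x \<in> realization G" for x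
    using wf that by (cases rule: realization_cases) (use assms in auto)
  then have "realization G = {vertex_point v}" using wf assms by auto
  moreover have "graph_path G (vertex_point v) (vertex_point v) 0"
    using wf assms by (intro graph_path.refl) simp
  ultimately show ?thesis using wf unfolding metric_graph_iff by auto
qed

definition single_vertex :: "'a mgraph \<Rightarrow> 'a \<Rightarrow> 'a mgraph" where
  "single_vertex C v = \<lparr>verts = {v}, edges = {}, elen = elen C\<rparr>"

text \<open>Seen as an ear on one of its vertices, a polygon inherits connectedness, the arc length
  parametrization and the distinctness of its edges.\<close>

lemma polygon_attached:
  assumes "polygon C p n"
  shows "attached_path (single_vertex C (p 0)) C (\<lambda>i. p (i mod n)) n"
proof (rule attach_polygon_at_vertex[OF assms])
  show "metric_graph (single_vertex C (p 0))" by (intro metric_graph_single) (simp_all add: single_vertex_def)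
qed (use assms in \<open>auto simp: single_vertex_def metric_subgraph_def polygon_def\<close>)

text \<open>The arc length parametrization is a simple closed path whose image is the whole
  realization.\<close>

lemma polygon_homeomorphic_circle:
  assumes C: "polygon C p n"
  shows "realization C homeomorphic sphere (0::complex) 1"
proof -
  \<comment> \<open>The realization does not depend on the lengths; with unit lengths the vertices
    sit at integer parameters.\<close>
  define D where "D = C\<lparr>elen := \<lambda>_. 1\<rparr>"
  have D: "polygon D p n" using C by (simp add: polygon_def D_def)
  have real: "realization D = realization C" by (simp add: realization_def graph_simplices_def D_def)
  have n: "3 \<le> n" and inj: "inj_on p {..<n}" using C by (auto simp: polygon_def)
  interpret A: attached_path "single_vertex D (p 0)" D "\<lambda>i. p (i mod n)" n
    using polygon_attached[OF D] .
  have step: "A.step_len i = 1" for i unfolding A.step_len_def by (simp add: D_def)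
  have pos: "A.pos_of i = real i" for i unfolding A.pos_of_def step by simp
  have total: "A.total = real n" unfolding A.total_def pos ..
  \<comment> \<open>The barycentric coordinates along the path are hat functions, which makes
    continuity evident. The base vertex \<open>p 0\<close> receives two of them, for
    \<open>j = 0\<close> and for \<open>j = n\<close>.\<close>
  define tent where "tent j \<tau> = max 0 (1 - \<bar>\<tau> - real j\<bar>)" for j :: nat and \<tau> :: real
  define \<gamma> where "\<gamma> \<tau> v = (\<Sum>j\<le>n. of_bool (p (j mod n) = v) * tent j \<tau>)" for \<tau> v
  have \<gamma>_edge: "\<gamma> (real i + \<theta>) = edge_point (p i) (p (Suc i mod n)) \<theta>"
    if i: "i < n" and \<theta>: "0 \<le> \<theta>" "\<theta> \<le> 1" for i \<theta>
  proof
    fix v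
    have t: "tent j (real i + \<theta>) = (if j = i then 1 - \<theta> else if j = Suc i then \<theta> else 0)" for j
    proof -
      consider "j = i" | "j = Suc i" | "real j + 1 \<le> real i" | "real i + 2 \<le> real j" by linarith
      then show ?thesis using \<theta> by cases (auto simp: tent_def)
    qed
    have "\<gamma> (real i + \<theta>) v = (\<Sum>j\<in>{i, Suc i}. of_bool (p (j mod n) = v) * tent j (real i + \<theta>))"
      unfolding \<gamma>_def using i by (intro sum.mono_neutral_right) (auto simp: t)
    also have "\<dots> = (if p i = v then 1 - \<theta> else 0) + (if p (Suc i mod n) = v then \<theta> else 0)"
      using i by (simp add: t)
    also have "\<dots> = edge_point (p i) (p (Suc i mod n)) \<theta> v"
      using A.p_neq[OF i] i by (auto simp: edge_point_def)
    finally show "\<gamma> (real i + \<theta>) v = edge_point (p i) (p (Suc i mod n)) \<theta> v" .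
  qed
  have \<gamma>_at: "A.path_at (\<gamma> \<tau>) \<tau>" if "0 \<le> \<tau>" "\<tau> \<le> real n" for \<tau>
  proof -
    obtain i \<theta> where i: "i < n" "0 \<le> \<theta>" "\<theta> \<le> 1" "\<tau> = real i + \<theta>"
    proof (cases "\<tau> = real n")
      case True
      then show ?thesis using that[of "n - 1" 1] n by (simp add: of_nat_diff)
    next
      case False
      show ?thesis
      proof (rule that[of "nat \<lfloor>\<tau>\<rfloor>" "\<tau> - real (nat \<lfloor>\<tau>\<rfloor>)"])
        show "nat \<lfloor>\<tau>\<rfloor> < n" using False \<open>0 \<le> \<tau>\<close> \<open>\<tau> \<le> real n\<close> by linarith
      qed (use \<open>0 \<le> \<tau>\<close> in linarith)+
    qed
    have "\<gamma> \<tau> = edge_point (p (i mod n)) (p (Suc i mod n)) \<theta>" using \<gamma>_edge[OF i(1-3)] i by simp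
    then show ?thesis using A.path_at_edge_point[OF i(1-3)] i(4) by (simp add: pos step)
  qed
  have at_\<gamma>: "x = \<gamma> \<tau>" if x: "A.path_at x \<tau>" for x \<tau>
  proof -
    obtain i \<theta> where i: "i < n" "0 \<le> \<theta>" "\<theta> \<le> 1" "x = edge_point (p (i mod n)) (p (Suc i mod n)) \<theta>"
      "\<tau> = A.pos_of i + \<theta> * A.step_len i"
      using x unfolding A.path_at_def by blast
    then show ?thesis using \<gamma>_edge[OF i(1-3)] by (simp add: pos step)
  qed
  define \<beta> where "\<beta> t = \<gamma> (real n * t)" for t
  have range: "0 \<le> real n * t" "real n * t \<le> real n" if "t \<in> {0..1}" for t
    using that n by (auto intro: mult_left_le)
  \<comment> \<open>\<open>R\<close> and \<open>Q\<close> re-index the coordinates by natural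
    numbers, so that the closed path runs in a function space with a countable index set.\<close>
  define R where "R x i = of_bool (i < n) * x (p i)" for x :: "'a \<Rightarrow> real" and i
  define Q where "Q y v = (\<Sum>j<n. of_bool (p j = v) * y j)" for y :: "nat \<Rightarrow> real" and v
  have coord: "continuous_on S (\<lambda>x. x v)" for S :: "('b \<Rightarrow> real) set" and v
    by (rule continuous_on_subset[OF continuous_on_product_coordinates]) simp
  have QR: "Q (R x) = x" if x: "x \<in> realization C" for x
  proof
    fix v
    have "x \<in> realization D" using x real by simp
    then have "support x \<subseteq> verts D"
      using A.wf_G unfolding realization_def graph_simplices_def wf_graph_def by auto
    then have V: "support x \<subseteq> p ` {..<n}" using D by (simp add: polygon_def)
    have "Q (R x) v = (\<Sum>j<n. of_bool (p j = v) * x v)"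
      unfolding Q_def R_def by (intro sum.cong) auto
    also have "\<dots> = x v"
    proof (cases "v \<in> p ` {..<n}")
      case True
      then obtain i where i: "i < n" "v = p i" by auto
      have "(\<Sum>j<n. of_bool (p j = v) * x v) = (\<Sum>j\<in>{i}. of_bool (p j = v) * x v)"
        using i inj by (intro sum.mono_neutral_right) (auto simp: inj_on_def)
      then show ?thesis using i by simp
    next
      case False
      then have "x v = 0" using V by (auto simp: support_def)
      then show ?thesis by simp
    qed
    finally show "Q (R x) v = x v" .
  qed
  have "homeomorphism (realization C) (R ` realization C) R Q"
  proof (rule homeomorphismI)
    show "continuous_on (realization C) R"
      unfolding R_def by (intro continuous_on_coordinatewise_then_product continuous_intros coord)
    show "continuous_on (R ` realization C) Q"
      unfolding Q_def by (intro continuous_on_coordinatewise_then_product continuous_intros coord)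
  qed (use QR in auto)
  then have homR: "realization C homeomorphic R ` realization C" unfolding homeomorphic_def by blast
  have "continuous_on {0..1} (\<lambda>t. \<beta> t v)" for v
    unfolding \<beta>_def \<gamma>_def tent_def by (intro continuous_intros)
  then have "path (R \<circ> \<beta>)"
    unfolding path_def R_def comp_def
    by (intro continuous_on_coordinatewise_then_product continuous_intros) auto
  moreover have loop: "loop_free \<beta>"
    unfolding loop_free_def
  proof (intro ballI impI)
    fix s t assume st: "s \<in> {0..1::real}" "t \<in> {0..1}" and eq: "\<beta> s = \<beta> t"
    have a: "A.path_at (\<beta> s) (real n * s)" "A.path_at (\<beta> s) (real n * t)"
      using \<gamma>_at[OF range[OF st(1)]] \<gamma>_at[OF range[OF st(2)]] eq by (auto simp: \<beta>_def)
    show "s = t \<or> s = 0 \<and> t = 1 \<or> s = 1 \<and> t = 0"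
    proof (cases "\<beta> s \<in> realization (single_vertex D (p 0))")
      case True
      have "real n * s = 0 \<or> real n * s = real n" "real n * t = 0 \<or> real n * t = real n"
        using A.path_at_in_H[OF a(1) True] A.path_at_in_H[OF a(2) True] total by auto
      then show ?thesis using n by auto
    next
      case False
      then have "real n * s = real n * t" using A.path_at_unique[OF a] by simp
      then show ?thesis using n by auto
    qed
  qed
  moreover have "pathfinish (R \<circ> \<beta>) = pathstart (R \<circ> \<beta>)"
  proof -
    have "\<gamma> 0 = vertex_point (p 0)" using \<gamma>_edge[of 0 0] n by simp
    moreover have "\<gamma> (real n) = vertex_point (p 0)"
      using at_\<gamma>[OF A.path_at_end] total by simp
    ultimately show ?thesis by (simp add: pathfinish_def pathstart_def \<beta>_def)
  qed
  moreover have im: "path_image \<beta> = realization C"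
  proof (intro equalityI subsetI)
    fix x assume "x \<in> path_image \<beta>"
    then obtain t where t: "t \<in> {0..1}" "x = \<beta> t" by (auto simp: path_image_def)
    then show "x \<in> realization C"
      using A.path_at_realization[OF \<gamma>_at[OF range[OF t(1)]]] real by (simp add: \<beta>_def)
  next
    fix x assume "x \<in> realization C"
    then have "x \<in> realization D" using real by simp
    then obtain \<tau> where \<tau>: "A.path_at x \<tau>"
    proof (rule A.realization_G_cases[THEN disjE])
      assume "x \<in> realization (single_vertex D (p 0))"
      then have "support x \<subseteq> {p 0}" using A.support_H by (simp add: single_vertex_def)
      moreover have "wf_graph (single_vertex D (p 0))" by (rule A.wf_H)
      ultimately have "x = vertex_point (p 0)"
        using \<open>x \<in> realization (single_vertex D (p 0))\<close>
        by (auto elim!: realization_cases simp: single_vertex_def)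
      then show ?thesis using that[of 0] A.path_at_start by simp
    qed (use that in blast)
    have "\<tau> / real n \<in> {0..1}" using A.path_at_range[OF \<tau>] total n by (simp add: divide_le_eq)
    moreover have "x = \<beta> (\<tau> / real n)" using at_\<gamma>[OF \<tau>] n by (simp add: \<beta>_def)
    ultimately show "x \<in> path_image \<beta>" by (auto simp: path_image_def)
  qed
  moreover have "loop_free (R \<circ> \<beta>)"
  proof -
    have "\<beta> t \<in> realization C" if "t \<in> {0..1}" for t using im that by (auto simp: path_image_def)
    then have "\<beta> s = \<beta> t" if "s \<in> {0..1}" "t \<in> {0..1}" "R (\<beta> s) = R (\<beta> t)" for s t
      using that QR by metis
    then show ?thesis using loop unfolding loop_free_def comp_def by blast
  qed
  ultimately have "path_image (R \<circ> \<beta>) homeomorphic sphere (0::complex) 1"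
    using homeomorphic_simple_path_image_circle[of "R \<circ> \<beta>" 1 0] by (simp add: simple_path_def)
  moreover have "path_image (R \<circ> \<beta>) = R ` realization C"
    using im unfolding path_image_def image_comp[symmetric] by simp
  ultimately show ?thesis using homeomorphic_trans[OF homR] by simp
qed

lemma polygon_metric_cycle:
  assumes "polygon C p n"
  shows "metric_cycle C"
  unfolding metric_cycle_def
  using polygon_homeomorphic_circle[OF assms] attached_path.metric_graph_G[OF polygon_attached[OF assms]] by blast

section \<open>From topological circles to polygons\<close>

definition simple_walk :: "'a set set \<Rightarrow> (nat \<Rightarrow> 'a) \<Rightarrow> nat \<Rightarrow> bool" where
  "simple_walk E q k \<longleftrightarrow> inj_on q {..k} \<and> (\<forall>i<k. {q i, q (Suc i)} \<in> E)"

text \<open>If \<open>v\<close> is already on the walk, the walk is cut off there; this is why the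
  resulting walk and its length are existential.\<close>

lemma simple_walk_extend:
  assumes q: "simple_walk E q k" and "{q k, v} \<in> E"
  obtains q' k' where "simple_walk E q' k'" "q' 0 = q 0" "q' k' = v" "q' ` {..k'} \<subseteq> insert v (q ` {..k})"
proof (cases "v \<in> q ` {..k}")
  case True
  then obtain j where j: "j \<le> k" "v = q j" by auto
  have "simple_walk E q j"
    using q j unfolding simple_walk_def by (auto intro: inj_on_subset)
  moreover have "q ` {..j} \<subseteq> insert v (q ` {..k})" using j by auto
  ultimately show ?thesis using that[of q j] j by blast
next
  case False
  define q' where "q' = q(Suc k := v)"
  have "inj_on q' {..Suc k}"
    using q False unfolding simple_walk_def q'_def by (auto simp: inj_on_def atMost_Suc)
  moreover have "{q' i, q' (Suc i)} \<in> E" if "i < Suc k" for i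
    using q assms(2) that unfolding simple_walk_def q'_def by (cases "i = k") auto
  ultimately have "simple_walk E q' (Suc k)" by (simp add: simple_walk_def)
  moreover have "q' ` {..Suc k} \<subseteq> insert v (q ` {..k})" by (auto simp: q'_def atMost_Suc)
  ultimately show ?thesis using that[of q' "Suc k"] by (simp add: q'_def)
qed

lemma polygon_of_closed_walk:
  assumes wf: "wf_graph C" and q: "simple_walk (edges C) q k" and k: "2 \<le> k" and e: "{q k, q 0} \<in> edges C"
  obtains Z where "polygon Z q (Suc k)" "metric_subgraph Z C"
proof -
  define Z where "Z = \<lparr>verts = q ` {..<Suc k}, edges = (\<lambda>i. {q i, q (Suc i mod Suc k)}) ` {..<Suc k}, elen = elen C\<rparr>"
  have E: "{q i, q (Suc i mod Suc k)} \<in> edges C" if "i < Suc k" for i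
    using q e that unfolding simple_walk_def by (cases "i = k") auto
  have V: "q i \<in> verts C" if "i < Suc k" for i using wf_graph_edgeD(2)[OF wf E[OF that]] .
  have "polygon Z q (Suc k)"
    using q k wf E unfolding polygon_def simple_walk_def Z_def
    by (auto simp: lessThan_Suc_atMost wf_graph_def simp del: mod_Suc_eq)
  moreover have "metric_subgraph Z C" using E V by (auto simp: metric_subgraph_def Z_def)
  ultimately show ?thesis using that by blast
qed

text \<open>Suppose removing the edge cut \<open>a\<close> off from \<open>b\<close>. The
  barycentric weight on the part of \<open>a\<close> is continuous and takes the value 1/2 only at
  the midpoint of the edge. A circle without that point is still connected, and the weight goes from
  1 at \<open>a\<close> to 0 at \<open>b\<close>, against the intermediate value theorem.\<close>

lemma no_bridge_in_circle:
  assumes C: "metric_cycle C" and e: "{a, b} \<in> edges C"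
  obtains q k where "simple_walk (edges C - {{a, b}}) q k" "q 0 = a" "q k = b"
proof (rule ccontr)
  assume no: "\<not> thesis"
  have mg: "metric_graph C" and circ: "realization C homeomorphic sphere (0::complex) 1"
    using C by (auto simp: metric_cycle_def)
  have wf: "wf_graph C" by (rule metric_graph_wf[OF mg])
  note ab = wf_graph_edgeD[OF wf e]
  define E where "E = edges C - {{a, b}}"
  define S where "S = {v \<in> verts C. \<exists>q k. simple_walk E q k \<and> q 0 = a \<and> q k = v}"
  have "simple_walk E (\<lambda>_. a) 0" by (simp add: simple_walk_def)
  then have aS: "a \<in> S" unfolding S_def using ab by blast
  have bS: "b \<notin> S" using no that unfolding S_def E_def by blast
  have closed: "w \<in> S" if vw: "{v, w} \<in> E" "v \<in> S" for v w
  proof -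
    obtain q k where q: "simple_walk E q k" "q 0 = a" "q k = v" using vw unfolding S_def by blast
    have "{q k, w} \<in> E" using q vw by simp
    then obtain q' k' where "simple_walk E q' k'" "q' 0 = a" "q' k' = w"
      using simple_walk_extend[OF q(1), of w] q(2) by metis
    moreover have "w \<in> verts C" using vw wf_graph_edgeD(3)[OF wf, of v w] by (auto simp: E_def)
    ultimately show ?thesis unfolding S_def by blast
  qed
  have finS: "finite S" using wf finite_subset[of S "verts C"] unfolding S_def wf_graph_def by blast
  define f where "f x = (\<Sum>v\<in>S. x v)" for x :: "'a \<Rightarrow> real"
  define m where "m = edge_point a b (1 / 2)"
  have mC: "m \<in> realization C" unfolding m_def using edge_point_in_realization[OF wf e] by simp
  have fv: "f (vertex_point v) = (if v \<in> S then 1 else 0)" for v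
    using finS by (simp add: f_def vertex_point_def)
  have fe: "f (edge_point u w t) = (if u \<in> S then 1 - t else 0) + (if w \<in> S then t else 0)" if "u \<noteq> w" for u w t
  proof -
    have "edge_point u w t v = (if v = u then 1 - t else 0) + (if v = w then t else 0)" for v
      using that by (auto simp: edge_point_def)
    then show ?thesis using finS by (simp add: f_def sum.distrib)
  qed
  \<comment> \<open>On every other edge the weight is constantly 0 or 1, since both endpoints are in
    \<open>S\<close> or neither is.\<close>
  have half: "x = m" if "x \<in> realization C" and fx: "f x = 1 / 2" for x
    using wf that(1)
  proof (cases rule: realization_cases)
    case (vertex v)
    then show ?thesis using fx fv[of v] by (auto split: if_splits)
  next
    case (edge u w t)
    note uw = wf_graph_edgeD[OF wf edge(1)]
    show ?thesis
    proof (cases "{u, w} = {a, b}")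
      case True
      then have "u = a \<and> w = b \<or> u = b \<and> w = a" by (auto simp: doubleton_eq_iff)
      then show ?thesis
      proof
        assume uw': "u = a \<and> w = b"
        then have "1 - t = 1 / 2" using fx edge fe[OF uw(1), of t] aS bS by simp
        then have t: "t = 1 / 2" by linarith
        have "x = edge_point a b t" using edge(4) uw' by simp
        then show ?thesis unfolding m_def t .
      next
        assume uw': "u = b \<and> w = a"
        then have t: "t = 1 / 2" using fx edge fe[OF uw(1), of t] aS bS by simp
        have "x = edge_point a b (1 - t)" using edge(4) uw' edge_point_flip[OF uw(1), of t] by simp
        then show ?thesis unfolding m_def t by simp
      qed
    next
      case False
      then have "{u, w} \<in> E" using edge by (simp add: E_def)
      then have "u \<in> S \<longleftrightarrow> w \<in> S" using closed[of u w] closed[of w u] by (auto simp: insert_commute)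
      then show ?thesis using fx edge fe[OF uw(1), of t] by (auto split: if_splits)
    qed
  qed
  obtain h h' where h: "homeomorphism (realization C) (sphere (0::complex) 1) h h'"
    using circ unfolding homeomorphic_def by blast
  have inj: "inj_on h (realization C)" by (rule inj_on_inverseI[of _ h']) (rule homeomorphism_apply1[OF h])
  have hC: "h ` realization C = sphere 0 1" using h by (simp add: homeomorphism_def)
  have "h ` (realization C - {m}) = sphere 0 1 - {h m}"
    using inj hC mC by (auto simp: inj_on_def)
  then have "homeomorphism (realization C - {m}) (sphere 0 1 - {h m}) h h'"
    by (intro homeomorphism_of_subsets[OF h]) auto
  moreover have "norm (h m) = 1" using hC mC by auto
  ultimately have "connected (sphere 0 1 - {h m})" "realization C - {m} homeomorphic sphere 0 1 - {h m}"
    using circle_minus_point_connected unfolding homeomorphic_def by blast+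
  then have "connected (realization C - {m})" using homeomorphic_connectedness by blast
  moreover have "continuous_on (realization C - {m}) f"
    unfolding f_def by (intro continuous_on_sum continuous_on_subset[OF continuous_on_product_coordinates]) auto
  ultimately have conn: "connected (f ` (realization C - {m}))" by (rule connected_continuous_image[rotated])
  have "vertex_point v \<in> realization C - {m}" if "v \<in> {a, b}" for v
  proof -
    have "f m = 1 / 2" using fe[OF ab(1)] aS bS by (simp add: m_def)
    then have "vertex_point v \<noteq> m" using fv[of v] by (auto split: if_splits)
    then show ?thesis using that ab wf by auto
  qed
  then have "f (vertex_point a) \<in> f ` (realization C - {m})" "f (vertex_point b) \<in> f ` (realization C - {m})"
    by blast+
  then have "1 / 2 \<in> f ` (realization C - {m})"
    using connectedD_interval[OF conn, of 0 1 "1 / 2"] fv aS bS by simp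
  then show False using half by auto
qed

text \<open>An edge exists because a circle is infinite. A walk between its endpoints that avoids it
  closes up to a polygon, an embedded circle, which must be the whole cycle.\<close>

lemma metric_cycle_polygon:
  assumes C: "metric_cycle C"
  obtains p n where "polygon C p n"
proof -
  have mg: "metric_graph C" and circ: "realization C homeomorphic sphere (0::complex) 1"
    using C by (auto simp: metric_cycle_def)
  have wf: "wf_graph C" by (rule metric_graph_wf[OF mg])
  have "edges C \<noteq> {}"
  proof
    assume "edges C = {}"
    then have "realization C \<subseteq> vertex_point ` verts C"
      using wf by (auto elim!: realization_cases)
    then have "finite (realization C)" using wf finite_subset unfolding wf_graph_def by blast
    moreover obtain h h' where "homeomorphism (realization C) (sphere (0::complex) 1) h h'"
      using circ unfolding homeomorphic_def by blast
    then have "h ` realization C = sphere 0 1" by (simp add: homeomorphism_def)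
    ultimately have "finite (sphere (0::complex) 1)" using finite_imageI[of "realization C" h] by simp
    moreover have "infinite (sphere (0::complex) 1)"
    proof
      assume "finite (sphere (0::complex) 1)"
      then have fin: "finite (sphere (0::complex) 1 - {1})" by simp
      have conn: "connected (sphere (0::complex) 1 - {1})" by (rule circle_minus_point_connected) simp
      have "sphere (0::complex) 1 - {1} = {} \<or> (\<exists>z. sphere (0::complex) 1 - {1} = {z})"
        using fin unfolding connected_finite_iff_sing[OF conn] .
      then obtain z where "sphere (0::complex) 1 - {1} \<subseteq> {z}" by blast
      moreover have "\<i> \<in> sphere (0::complex) 1 - {1}" "- 1 \<in> sphere (0::complex) 1 - {1}"
        by (auto simp: complex_eq_iff)
      ultimately have "\<i> = - 1" by blast
      then show False by (simp add: complex_eq_iff)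
    qed
    ultimately show False by blast
  qed
  then obtain e0 where e0: "e0 \<in> edges C" by blast
  obtain a b where "e0 = {a, b}" using wf_graph_edge_cases[OF wf e0] .
  then have e: "{a, b} \<in> edges C" "a \<noteq> b" using e0 wf_graph_edgeD[OF wf, of a b] by auto
  obtain q k where q: "simple_walk (edges C - {{a, b}}) q k" "q 0 = a" "q k = b"
    using no_bridge_in_circle[OF C e(1)] .
  have "2 \<le> k"
  proof (rule ccontr)
    assume "\<not> 2 \<le> k"
    then consider "k = 0" | "k = 1" by linarith
    then show False using q e(2) by cases (auto simp: simple_walk_def)
  qed
  moreover have "simple_walk (edges C) q k" using q(1) by (auto simp: simple_walk_def)
  moreover have "{q k, q 0} \<in> edges C" using q e(1) by (simp add: insert_commute)
  ultimately obtain Z where Z: "polygon Z q (Suc k)" "metric_subgraph Z C"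
    using polygon_of_closed_walk[OF wf] by blast
  have rZ: "realization Z = realization C"
    using circle_in_circle[OF circ polygon_homeomorphic_circle[OF Z(1)] metric_subgraph_realization[OF Z(2)]] .
  have wfZ: "wf_graph Z" using attached_path.wf_G[OF polygon_attached[OF Z(1)]] .
  have "verts C = verts Z"
  proof (intro equalityI subsetI)
    fix v assume "v \<in> verts C"
    then show "v \<in> verts Z" using rZ vertex_point_in_realization[OF wf, of v] vertex_point_in_realization[OF wfZ, of v] by simp
  qed (use Z(2) in \<open>auto simp: metric_subgraph_def\<close>)
  moreover have "edges C = edges Z"
  proof (intro equalityI subsetI)
    fix e assume "e \<in> edges C"
    then obtain u w where uw: "e = {u, w}" "u \<noteq> w" using wf_graph_edge_cases[OF wf] by metis
    then have "edge_point u w (1 / 2) \<in> realization Z"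
      using edge_point_in_realization[OF wf, of u w "1 / 2"] \<open>e \<in> edges C\<close> rZ by simp
    then have "{u, w} \<in> graph_simplices Z"
      using support_edge_point[of "1 / 2" u w] by (simp add: realization_def)
    then show "e \<in> edges Z" using uw by (auto simp: graph_simplices_def doubleton_eq_iff)
  qed (use Z(2) in \<open>auto simp: metric_subgraph_def\<close>)
  moreover have "\<forall>e\<in>edges C. 0 < elen C e" using wf by (simp add: wf_graph_def)
  ultimately have "polygon C q (Suc k)" using Z(1) by (simp add: polygon_def)
  then show ?thesis using that by blast
qed

section \<open>Assembling the graph\<close>

text \<open>A normal form of the assembly: single leaves and ears instead of whole pieces.
  \<open>B\<close> holds every edge along which a gluing takes place at any stage, so its edges are
  controlled when they first appear; the list records the lengths of the cycles. For an ear on an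
  edge, the inequality with factor 2 says that the base is shorter than
  \<open>l / 3\<close>.\<close>

inductive built :: "'a set set \<Rightarrow> real list \<Rightarrow> 'a mgraph \<Rightarrow> bool" for B where
  point: "verts G = {v} \<Longrightarrow> edges G = {} \<Longrightarrow> built B [] G"
| leaf: "built B ls H \<Longrightarrow> attached_path H G p 1 \<Longrightarrow> p 1 \<notin> verts H \<Longrightarrow> built B ls G"
| ear: "\<lbrakk> built B ls H; attached_path H G p n; p n \<in> verts H;
    p 0 = p n \<or> {p 0, p n} \<in> B \<and> {p 0, p n} \<in> edges H \<and>
      2 * elen H {p 0, p n} < (\<Sum>i<n. elen G {p i, p (Suc i)});
    l = (\<Sum>i<n. elen G {p i, p (Suc i)}) + (if p 0 = p n then 0 else elen H {p 0, p n});
    \<And>i. i < n \<Longrightarrow> {p i, p (Suc i)} \<in> B \<Longrightarrow> 3 * elen G {p i, p (Suc i)} < l \<rbrakk>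
    \<Longrightarrow> built B (l # ls) G"

lemma built_single_vertex:
  assumes "verts G = {v}" "edges G = {}"
  shows "short_edges B G" "cycle_rank G 0" "0 < s \<Longrightarrow> \<not> has_square G s"
proof -
  show "short_edges B G" using assms by (simp add: short_edges_def)
  have mg: "metric_graph G" using metric_graph_single[OF assms] .
  have x: "x = vertex_point v" if "x \<in> realization G" for x
    using metric_graph_wf[OF mg] that by (cases rule: realization_cases) (use assms in auto)
  show "\<not> has_square G s" if "0 < s"
  proof
    assume "has_square G s"
    then obtain x1 x2 where "x1 \<in> realization G" "x2 \<in> realization G" "graph_dist G x1 x2 = s"
      unfolding has_square_def square_tuple_def by blast
    moreover from this have "x1 = x2" using x[of x1] x[of x2] by simp
    ultimately show False using graph_dist_refl[OF mg, of x2] that by simp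
  qed
  have "g = (\<lambda>a b. 0)" if "circulation G g" for g
    using that assms unfolding circulation_def flow_def by blast
  moreover have "circulation G (\<lambda>a b. 0)" by (simp add: circulation_def flow_def)
  ultimately have "{g. circulation G g} = {\<lambda>a b. 0}" by blast
  moreover have "vcarrier (coordinate_space 0 :: (rat, nat \<Rightarrow> rat) vspace) = {\<lambda>i. 0}"
    by (auto simp: coordinate_space_def)
  ultimately show "cycle_rank G 0"
    unfolding cycle_rank_def by (intro exI[of _ "\<lambda>g i. 0"]) (simp add: bij_betw_def)
qed

text \<open>The invariants support each other: that an ear adds only its own square depends on the
  shortness of its base edge in the graph built so far.\<close>

lemma built_invariants:
  assumes "built B ls G"
  shows "metric_graph G \<and> short_edges B G \<and> cycle_rank G (length ls) \<and>
    (\<forall>s>0. has_square G s \<longleftrightarrow> 4 * s \<in> set ls)"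
  using assms
proof (induction rule: built.induct)
  case (point G v)
  then show ?case
    using metric_graph_single[OF point] built_single_vertex[OF point] by simp
next
  case (leaf ls H G p)
  interpret attached_path H G p 1 by (rule leaf.hyps(2))
  show ?case
    using leaf.IH metric_graph_G short_edges_leaf[OF leaf.hyps(3)] cycle_rank_open[OF leaf.hyps(3)]
      has_square_leaf[OF leaf.hyps(3)] by simp
next
  case (ear ls H G p n l)
  interpret attached_path H G p n by (rule ear.hyps(2))
  have total: "total = (\<Sum>i<n. elen G {p i, p (Suc i)})"
    by (simp add: total_def pos_of_def step_len_def)
  interpret attached_ear H G p n B
    using ear.hyps(3,4) ear.IH by unfold_locales (simp_all add: total)
  have l: "ear_len = l" using ear.hyps(5) by (simp add: ear_len_def base_len_def total)
  have "has_square G s \<longleftrightarrow> 4 * s \<in> set (l # ls)" if "0 < s" for s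
    using has_square_ear[OF that] ear.IH that by (auto simp: l)
  then show ?case
    using ear.IH metric_graph_G short_edges_ear[unfolded l, OF ear.hyps(6)] cycle_rank_closed[OF ear.hyps(3)]
    by simp
qed

text \<open>Intermediate stages of the assembly with the lengths of the final graph, so that they
  differ only in vertices and edges and no lengths need to be transported.\<close>

definition with_len :: "'a mgraph \<Rightarrow> 'a set \<Rightarrow> 'a set set \<Rightarrow> 'a mgraph" where
  "with_len G V E = \<lparr>verts = V, edges = E, elen = elen G\<rparr>"

lemma with_len_simps [simp]:
  "verts (with_len G V E) = V" "edges (with_len G V E) = E" "elen (with_len G V E) = elen G"
  by (simp_all add: with_len_def)

section \<open>Gluing a tree leaf by leaf\<close>

lemma simple_walk_mono: "simple_walk E q k \<Longrightarrow> E \<subseteq> E' \<Longrightarrow> simple_walk E' q k"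
  by (auto simp: simple_walk_def)

lemma simple_walk_rev:
  assumes "simple_walk E q k"
  shows "simple_walk E (\<lambda>i. q (k - i)) k"
proof -
  have "inj_on (\<lambda>i. q (k - i)) {..k}"
  proof (rule inj_onI)
    fix i j assume ij: "i \<in> {..k}" "j \<in> {..k}" "q (k - i) = q (k - j)"
    have "inj_on q {..k}" using assms by (simp add: simple_walk_def)
    then have "k - i = k - j" using ij(3) by (rule inj_onD) auto
    then show "i = j" using ij by auto
  qed
  moreover have "{q (k - i), q (k - Suc i)} \<in> E" if "i < k" for i
  proof -
    have "{q (k - Suc i), q (Suc (k - Suc i))} \<in> E" using assms that unfolding simple_walk_def by simp
    moreover have "Suc (k - Suc i) = k - i" using that by simp
    ultimately show ?thesis by (simp add: insert_commute)
  qed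
  ultimately show ?thesis by (simp add: simple_walk_def)
qed

definition walk_connected :: "'a set set \<Rightarrow> 'a set \<Rightarrow> bool" where
  "walk_connected E S \<longleftrightarrow> (\<forall>a\<in>S. \<forall>b\<in>S. \<exists>q k. simple_walk E q k \<and> q 0 = a \<and> q k = b)"

lemma walk_connected_singleton: "walk_connected E {v}"
proof -
  have "simple_walk E (\<lambda>_. v) 0" by (simp add: simple_walk_def)
  then show ?thesis unfolding walk_connected_def by blast
qed

lemma walk_connected_insert:
  assumes S: "walk_connected E S" and u: "u \<in> S" "{u, w} \<in> E'" and "E \<subseteq> E'"
  shows "walk_connected E' (insert w S)"
proof -
  have S': "\<exists>q k. simple_walk E' q k \<and> q 0 = a \<and> q k = b" if "a \<in> S" "b \<in> S" for a b
    using S that simple_walk_mono[OF _ assms(4)] unfolding walk_connected_def by blast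
  have to_w: "\<exists>q k. simple_walk E' q k \<and> q 0 = a \<and> q k = w" if a: "a \<in> S" for a
  proof -
    obtain q k where q: "simple_walk E' q k" "q 0 = a" "q k = u" using S'[OF a u(1)] by blast
    have "{q k, w} \<in> E'" using u q by simp
    from simple_walk_extend[OF q(1) this] show ?thesis using q(2) by metis
  qed
  have from_w: "\<exists>q k. simple_walk E' q k \<and> q 0 = w \<and> q k = a" if a: "a \<in> S" for a
  proof -
    obtain q k where "simple_walk E' q k" "q 0 = a" "q k = w" using to_w[OF a] by blast
    then show ?thesis using simple_walk_rev[of E' q k] by (intro exI[of _ "\<lambda>i. q (k - i)"] exI[of _ k]) simp
  qed
  have "simple_walk E' (\<lambda>_. w) 0" by (simp add: simple_walk_def)
  then have "\<exists>q k. simple_walk E' q k \<and> q 0 = w \<and> q k = w" by blast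
  then show ?thesis unfolding walk_connected_def using S' to_w from_w by blast
qed

text \<open>Metric trees in combinatorial terms, which makes the invariance under isomorphisms visible.\<close>

definition tree_like :: "'a mgraph \<Rightarrow> bool" where
  "tree_like T \<longleftrightarrow> wf_graph T \<and>
     (\<forall>S. S \<subseteq> verts T \<longrightarrow> S \<noteq> {} \<longrightarrow> S \<noteq> verts T \<longrightarrow> (\<exists>u w. {u, w} \<in> edges T \<and> u \<in> S \<and> w \<in> verts T - S)) \<and>
     (\<forall>q k. 2 \<le> k \<longrightarrow> simple_walk (edges T) q k \<longrightarrow> {q k, q 0} \<notin> edges T)"

lemma tree_likeI:
  assumes "wf_graph T"
    and "\<And>S. S \<subseteq> verts T \<Longrightarrow> S \<noteq> {} \<Longrightarrow> S \<noteq> verts T \<Longrightarrow>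
      \<exists>u w. {u, w} \<in> edges T \<and> u \<in> S \<and> w \<in> verts T - S"
    and "\<And>q k. 2 \<le> k \<Longrightarrow> simple_walk (edges T) q k \<Longrightarrow> {q k, q 0} \<notin> edges T"
  shows "tree_like T"
  unfolding tree_like_def by (intro conjI allI impI) (rule assms; assumption)+

lemma tree_like_crossing:
  assumes "tree_like T" "S \<subseteq> verts T" "S \<noteq> {}" "S \<noteq> verts T"
  obtains u w where "{u, w} \<in> edges T" "u \<in> S" "w \<in> verts T - S"
  using assms unfolding tree_like_def by meson

lemma tree_like_no_closed_walk:
  "tree_like T \<Longrightarrow> 2 \<le> k \<Longrightarrow> simple_walk (edges T) q k \<Longrightarrow> {q k, q 0} \<notin> edges T"
  by (simp add: tree_like_def)

lemma metric_tree_tree_like: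
  assumes "metric_tree T"
  shows "tree_like T"
proof -
  have mg: "metric_graph T" and no: "\<And>C. metric_subgraph C T \<Longrightarrow> \<not> metric_cycle C"
    using assms by (auto simp: metric_tree_def)
  have wf: "wf_graph T" by (rule metric_graph_wf[OF mg])
  show ?thesis
  proof (rule tree_likeI[OF wf])
    show "\<exists>u w. {u, w} \<in> edges T \<and> u \<in> S \<and> w \<in> verts T - S"
      if "S \<subseteq> verts T" "S \<noteq> {}" "S \<noteq> verts T" for S
      using crossing_edge[OF mg that] by blast
    show "{q k, q 0} \<notin> edges T" if k: "2 \<le> k" and q: "simple_walk (edges T) q k" for q k
    proof
      assume e: "{q k, q 0} \<in> edges T"
      obtain Z where "polygon Z q (Suc k)" "metric_subgraph Z T"
        using polygon_of_closed_walk[OF wf q k e] .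
      then show False using polygon_metric_cycle[of Z] no[of Z] by blast
    qed
  qed
qed

definition iso_by :: "('a \<Rightarrow> 'a) \<Rightarrow> 'a mgraph \<Rightarrow> 'a mgraph \<Rightarrow> bool" where
  "iso_by f G H \<longleftrightarrow> inj_on f (verts G) \<and> verts H = f ` verts G \<and>
     edges H = (\<lambda>e. f ` e) ` edges G \<and> (\<forall>e\<in>edges G. elen H (f ` e) = elen G e)"

lemma mgraph_iso_iff: "mgraph_iso G H \<longleftrightarrow> (\<exists>f. iso_by f G H)"
  by (simp add: mgraph_iso_def iso_by_def)

lemma iso_byD:
  assumes "iso_by f G H"
  shows "inj_on f (verts G)" "verts H = f ` verts G" "edges H = (\<lambda>e. f ` e) ` edges G"
    "\<And>e. e \<in> edges G \<Longrightarrow> elen H (f ` e) = elen G e"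
  using assms by (auto simp only: iso_by_def)

lemma mgraph_iso_wf:
  assumes f: "inj_on f (verts G)" "verts H = f ` verts G" "edges H = (\<lambda>e. f ` e) ` edges G"
    "\<And>e. e \<in> edges G \<Longrightarrow> elen H (f ` e) = elen G e" and wf: "wf_graph G"
  shows "wf_graph H"
proof -
  have "f ` e \<subseteq> verts H \<and> card (f ` e) = 2 \<and> 0 < elen H (f ` e)" if "e \<in> edges G" for e
  proof -
    have e: "e \<subseteq> verts G" "card e = 2" "0 < elen G e" using wf that by (auto simp: wf_graph_def)
    then show ?thesis using f card_image[OF inj_on_subset[OF f(1) e(1)]] that by auto
  qed
  then show ?thesis using wf f(2,3) unfolding wf_graph_def by auto
qed

lemma mgraph_iso_tree_like:
  assumes "tree_like G" "mgraph_iso G H"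
  shows "tree_like H"
proof -
  obtain f where "iso_by f G H" using assms(2) mgraph_iso_iff by blast
  note f = iso_byD[OF this]
  have wf: "wf_graph G" using assms(1) by (simp add: tree_like_def)
  show ?thesis
  proof (rule tree_likeI[OF mgraph_iso_wf[OF f wf]])
    show "\<exists>u w. {u, w} \<in> edges H \<and> u \<in> S \<and> w \<in> verts H - S"
      if S: "S \<subseteq> verts H" "S \<noteq> {}" "S \<noteq> verts H" for S
    proof -
      define S0 where "S0 = {v \<in> verts G. f v \<in> S}"
      have "f ` S0 = S" using S f(2) by (auto simp: S0_def)
      then have "S0 \<subseteq> verts G" "S0 \<noteq> {}" "S0 \<noteq> verts G" using S f(2) by (auto simp: S0_def)
      then obtain u w where uw: "{u, w} \<in> edges G" "u \<in> S0" "w \<in> verts G - S0"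
        using tree_like_crossing[OF assms(1)] by metis
      have "{f u, f w} \<in> edges H" using imageI[OF uw(1), of "\<lambda>e. f ` e"] f(3) by simp
      moreover have "f u \<in> S" "f w \<in> verts H - S" using uw f(2) by (auto simp: S0_def)
      ultimately show ?thesis by blast
    qed
    show "{q k, q 0} \<notin> edges H" if k: "2 \<le> k" and q: "simple_walk (edges H) q k" for q k
    proof
      assume e: "{q k, q 0} \<in> edges H"
      \<comment> \<open>Closed walks are pulled back along the inverse vertex map, which is
        injective and maps edges to edges.\<close>
      define g where "g = inv_into (verts G) f"
      have wfH: "wf_graph H" by (rule mgraph_iso_wf[OF f wf])
      have pull: "{g a, g b} \<in> edges G" if ab: "{a, b} \<in> edges H" for a b
      proof -
        obtain e0 where e0: "e0 \<in> edges G" "{a, b} = f ` e0" using ab f(3) by blast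
        have "e0 \<subseteq> verts G" using wf e0 by (auto simp: wf_graph_def)
        then have "g ` f ` e0 = e0" unfolding g_def by (rule inv_into_image_cancel[OF f(1)])
        then have "g ` {a, b} = e0" using e0(2) by simp
        then show ?thesis using e0(1) by simp
      qed
      have qV: "q i \<in> verts H" if "i \<le> k" for i
      proof (cases "i < k")
        case True
        then have "{q i, q (Suc i)} \<in> edges H" using q by (simp add: simple_walk_def)
        then show ?thesis by (rule wf_graph_edgeD(2)[OF wfH])
      next
        case False
        then show ?thesis using that wf_graph_edgeD(2)[OF wfH e] by simp
      qed
      have injg: "inj_on g (verts H)" unfolding g_def f(2) by (rule inj_on_inv_into) simp
      have "inj_on (g \<circ> q) {..k}"
      proof (rule comp_inj_on)
        show "inj_on q {..k}" using q by (simp add: simple_walk_def)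
        show "inj_on g (q ` {..k})" by (rule inj_on_subset[OF injg]) (use qV in auto)
      qed
      then have "simple_walk (edges G) (g \<circ> q) k" using q pull unfolding simple_walk_def by simp
      from tree_like_no_closed_walk[OF assms(1) k this] show False using pull[OF e] by simp
    qed
  qed
qed

text \<open>Starting from the glued part \<open>I\<close>, the attached part \<open>S\<close> of the
  tree grows across a crossing edge until it is everything. Keeping \<open>S\<close> connected
  inside the tree is what makes each new vertex a leaf.\<close>

lemma attach_tree:
  assumes T: "tree_like T" and built: "built B ls (with_len G V E)"
    and len: "\<And>e. e \<in> edges T \<Longrightarrow> 0 < elen G e"
    and I: "V \<inter> verts T = I" "I \<noteq> {}" "{e \<in> edges T. e \<subseteq> I} \<subseteq> E"
      "walk_connected {e \<in> edges T. e \<subseteq> I} I"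
  shows "built B ls (with_len G (V \<union> verts T) (E \<union> edges T))"
proof -
  define ET where "ET S = {e \<in> edges T. e \<subseteq> S}" for S
  have wf: "wf_graph T" using T by (simp add: tree_like_def)
  have fin: "finite (verts T)" using wf by (simp add: wf_graph_def)
  have grow: "built B ls (with_len G (V \<union> verts T) (E \<union> ET (verts T)))"
    if "I \<subseteq> S" "S \<subseteq> verts T" "built B ls (with_len G (V \<union> S) (E \<union> ET S))" "walk_connected (ET S) S" for S
    using that
  proof (induction "card (verts T - S)" arbitrary: S rule: less_induct)
    case less
    show ?case
    proof (cases "S = verts T")
      case True
      then show ?thesis using less.prems(3) by simp
    next
      case False
      moreover have "S \<noteq> {}" using less.prems(1) I(2) by blast
      ultimately obtain u w where uw: "{u, w} \<in> edges T" "u \<in> S" "w \<in> verts T - S"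
        using tree_like_crossing[OF T less.prems(2)] by metis
      have wV: "w \<notin> V \<union> S" using uw I(1) less.prems(1) by blast
      \<comment> \<open>The new vertex \<open>w\<close> has only one neighbour in \<open>S\<close>:
        a second one would be joined to \<open>u\<close> by a walk inside \<open>S\<close>, and
        together with \<open>w\<close> this would be a closed walk in the tree.\<close>
      have ET: "ET (insert w S) = insert {u, w} (ET S)"
      proof (intro equalityI subsetI)
        fix e assume e: "e \<in> ET (insert w S)"
        show "e \<in> insert {u, w} (ET S)"
        proof (cases "w \<in> e")
          case False
          then show ?thesis using e by (auto simp: ET_def)
        next
          case True
          then obtain x where x: "e = {w, x}" "x \<noteq> w"
            proof -
            have "e \<in> edges T" using e by (simp add: ET_def)
            then obtain y z where yz: "e = {y, z}" "y \<noteq> z" using wf_graph_edge_cases[OF wf] by metis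
            then show ?thesis using True that[of y] that[of z] by (auto simp: insert_commute)
          qed
          then have xS: "x \<in> S" using e by (auto simp: ET_def)
          have "x = u"
          proof (rule ccontr)
            assume "x \<noteq> u"
            obtain q k where q: "simple_walk (ET S) q k" "q 0 = x" "q k = u"
              using less.prems(4) xS uw(2) unfolding walk_connected_def by blast
            have k: "0 < k" using q \<open>x \<noteq> u\<close> by (metis neq0_conv)
            have qS: "q i \<in> S" if "i \<le> k" for i
            proof (cases "i < k")
              case True
              then have "{q i, q (Suc i)} \<in> ET S" using q(1) by (simp add: simple_walk_def)
              then show ?thesis by (simp add: ET_def)
            next
              case False
              then show ?thesis using that q(3) uw(2) by simp
            qed
            define q' where "q' = q(Suc k := w)"
            have "inj_on q' {..Suc k}"
              using q(1) qS uw(3) unfolding simple_walk_def q'_def by (auto simp: inj_on_def atMost_Suc)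
            moreover have "{q' i, q' (Suc i)} \<in> edges T" if "i < Suc k" for i
              using q uw(1) that unfolding simple_walk_def q'_def ET_def by (cases "i = k") auto
            ultimately have "simple_walk (edges T) q' (Suc k)" by (simp add: simple_walk_def)
            moreover have "{q' (Suc k), q' 0} \<in> edges T"
              using e x q(2) by (simp add: q'_def ET_def)
            ultimately show False using tree_like_no_closed_walk[OF T, of "Suc k" q'] k by simp
          qed
          then show ?thesis using x by (simp add: insert_commute)
        qed
      next
        fix e assume "e \<in> insert {u, w} (ET S)"
        then show "e \<in> ET (insert w S)" using uw by (auto simp: ET_def)
      qed
      define p where "p i = (if i = 0 then u else w)" for i :: nat
      have mg: "metric_graph (with_len G (V \<union> S) (E \<union> ET S))"
        using built_invariants[OF less.prems(3)] by blast
      have ap: "attached_path (with_len G (V \<union> S) (E \<union> ET S))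
          (with_len G (V \<union> insert w S) (E \<union> ET (insert w S))) p 1"
        by unfold_locales (use mg uw wV ET len in \<open>auto simp: metric_subgraph_def p_def\<close>)
      have "built B ls (with_len G (V \<union> insert w S) (E \<union> ET (insert w S)))"
        by (rule built.leaf[OF less.prems(3) ap]) (use wV in \<open>simp add: p_def\<close>)
      moreover have "walk_connected (ET (insert w S)) (insert w S)"
        by (rule walk_connected_insert[OF less.prems(4) uw(2)]) (auto simp: ET)
      moreover have "card (verts T - insert w S) < card (verts T - S)"
        using uw fin by (intro psubset_card_mono) auto
      ultimately show ?thesis using less.hyps[of "insert w S"] less.prems(1,2) uw by blast
    qed
  qed
  have ETT: "ET (verts T) = edges T" using wf by (auto simp: ET_def wf_graph_def)
  have VI: "V \<union> I = V" and EI: "E \<union> ET I = E" and IT: "I \<subseteq> verts T" using I by (auto simp: ET_def)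
  have "built B ls (with_len G (V \<union> I) (E \<union> ET I))" using built by (simp only: VI EI)
  moreover have "walk_connected (ET I) I" using I(4) by (simp only: ET_def)
  ultimately show ?thesis using grow[OF subset_refl IT] by (simp only: ETT)
qed

section \<open>Gluing a cycle as an ear\<close>

lemma polygon_rotate:
  assumes C: "polygon C p n" and k: "k < n"
  shows "polygon C (\<lambda>i. p ((i + k) mod n)) n"
proof -
  have n: "3 \<le> n" and inj: "inj_on p {..<n}" using C by (auto simp: polygon_def)
  have surj: "(\<lambda>i. (i + k) mod n) ` {..<n} = {..<n}"
  proof (rule card_subset_eq)
    show inj2: "card ((\<lambda>i. (i + k) mod n) ` {..<n}) = card {..<n}"
    proof (rule card_image, rule inj_onI)
      fix i j assume "i \<in> {..<n}" "j \<in> {..<n}" "(i + k) mod n = (j + k) mod n"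
      then show "i = j" using k by (auto simp: mod_if split: if_splits)
    qed
  qed (use n in auto)
  then have injr: "inj_on (\<lambda>i. (i + k) mod n) {..<n}" by (metis eq_card_imp_inj_on finite_lessThan)
  have "inj_on (p \<circ> (\<lambda>i. (i + k) mod n)) {..<n}"
    by (rule comp_inj_on[OF injr]) (use surj inj in simp)
  moreover have "(\<lambda>i. p ((i + k) mod n)) ` {..<n} = p ` {..<n}"
    using surj by (metis image_image)
  moreover have "(\<lambda>i. {p ((i + k) mod n), p ((Suc i mod n + k) mod n)}) ` {..<n} =
      (\<lambda>i. {p i, p (Suc i mod n)}) ` {..<n}"
  proof -
    have "(\<lambda>i. {p ((i + k) mod n), p ((Suc i mod n + k) mod n)}) ` {..<n} =
      (\<lambda>i. {p i, p (Suc i mod n)}) ` (\<lambda>i. (i + k) mod n) ` {..<n}"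
      unfolding image_image by (intro image_cong) (auto simp: mod_add_left_eq mod_Suc_eq)
    then show ?thesis using surj by simp
  qed
  ultimately show ?thesis using C unfolding polygon_def comp_def by simp
qed

lemma polygon_length:
  assumes C: "polygon C p n"
  shows "graph_length C = (\<Sum>i<n. elen C {p i, p (Suc i mod n)})"
proof -
  interpret attached_path "single_vertex C (p 0)" C "\<lambda>i. p (i mod n)" n
    by (rule polygon_attached[OF C])
  have "inj_on (\<lambda>i. {p i, p (Suc i mod n)}) {..<n}"
  proof (rule inj_onI)
    fix i j assume "i \<in> {..<n}" "j \<in> {..<n}" "{p i, p (Suc i mod n)} = {p j, p (Suc j mod n)}"
    then show "i = j" using path_edge_inj[of i j] by simp
  qed
  then show ?thesis
    using C unfolding graph_length_def polygon_def by (simp add: sum.reindex)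
qed

lemma mgraph_iso_polygon:
  assumes C: "polygon C p n" and "mgraph_iso C D"
  obtains p' where "polygon D p' n" "graph_length D = graph_length C"
proof -
  obtain f where "iso_by f C D" using assms(2) mgraph_iso_iff by blast
  note f = iso_byD[OF this]
  have pos: "0 < elen D e" if e: "e \<in> edges D" for e
  proof -
    obtain e0 where "e0 \<in> edges C" "e = f ` e0" using e unfolding f(3) by blast
    then show ?thesis using f(4) C by (simp add: polygon_def)
  qed
  have n: "3 \<le> n" and inj: "inj_on p {..<n}" and VC: "verts C = p ` {..<n}"
    and EC: "edges C = (\<lambda>i. {p i, p (Suc i mod n)}) ` {..<n}"
    using C by (auto simp only: polygon_def)
  have "inj_on (f \<circ> p) {..<n}" using comp_inj_on[OF inj, of f] f(1) by (simp only: VC)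
  moreover have "verts D = (f \<circ> p) ` {..<n}" unfolding f(2) VC image_comp ..
  moreover have "edges D = (\<lambda>i. {(f \<circ> p) i, (f \<circ> p) (Suc i mod n)}) ` {..<n}"
    unfolding f(3) EC image_image by simp
  ultimately have D: "polygon D (f \<circ> p) n" using n pos unfolding polygon_def by blast
  have "elen D {(f \<circ> p) i, (f \<circ> p) (Suc i mod n)} = elen C {p i, p (Suc i mod n)}" if "i < n" for i
    using f(4)[of "{p i, p (Suc i mod n)}"] C that by (simp add: polygon_def)
  then have "graph_length D = graph_length C"
    unfolding polygon_length[OF C] polygon_length[OF D] by (intro sum.cong) auto
  then show ?thesis using that D by blast
qed

lemma attach_cycle_vertex:
  assumes C: "polygon C p n" and built: "built B ls (with_len G V E)"
    and len: "\<And>e. e \<in> edges C \<Longrightarrow> elen G e = elen C e" and I: "V \<inter> verts C = {v}"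
    and short: "\<And>e. e \<in> edges C \<Longrightarrow> e \<in> B \<Longrightarrow> 3 * elen G e < graph_length C"
  shows "built B (graph_length C # ls) (with_len G (V \<union> verts C) (E \<union> edges C))"
proof -
  have "v \<in> verts C" using I by blast
  then obtain k where k: "k < n" "v = p k" using C by (auto simp: polygon_def)
  define p' where "p' i = p ((i + k) mod n)" for i
  have C': "polygon C p' n" unfolding p'_def by (rule polygon_rotate[OF C k(1)])
  have p'0: "p' 0 = v" using k by (simp add: p'_def)
  have mg: "metric_graph (with_len G V E)" using built_invariants[OF built] by blast
  have ap: "attached_path (with_len G V E) (with_len G (V \<union> verts C) (E \<union> edges C)) (\<lambda>i. p' (i mod n)) n"
    by (rule attach_polygon_at_vertex[OF C' mg]) (use I p'0 len in \<open>auto simp: metric_subgraph_def\<close>)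
  have edge: "{p' i, p' (Suc i mod n)} \<in> edges C" if "i < n" for i
    using C' that by (auto simp: polygon_def)
  have "(\<Sum>i<n. elen G {p' (i mod n), p' (Suc i mod n)}) = graph_length C"
    unfolding polygon_length[OF C'] using edge len by (intro sum.cong) auto
  then show ?thesis
    using p'0 I edge short by (intro built.ear[OF built ap]) auto
qed

lemma attach_cycle_edge:
  assumes C: "polygon C p n" and built: "built B ls (with_len G V E)"
    and len: "\<And>e. e \<in> edges C \<Longrightarrow> elen G e = elen C e"
    and I: "V \<inter> verts C = e" "e \<in> E" "e \<in> edges C" "e \<in> B"
    and short: "\<And>e. e \<in> edges C \<Longrightarrow> e \<in> B \<Longrightarrow> 3 * elen G e < graph_length C"
  shows "built B (graph_length C # ls) (with_len G (V \<union> verts C) (E \<union> edges C))"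
proof -
  obtain j where j: "j < n" "e = {p j, p (Suc j mod n)}" using I(3) C by (auto simp: polygon_def)
  \<comment> \<open>Rotation makes the gluing edge the closing edge, from \<open>p' m\<close> back
    to \<open>p' 0\<close>. The remaining \<open>m = n - 1\<close> edges form the ear.\<close>
  define p' where "p' i = p ((i + Suc j mod n) mod n)" for i
  have C': "polygon C p' n" unfolding p'_def using j by (intro polygon_rotate[OF C]) auto
  have n: "3 \<le> n" and inj: "inj_on p' {..<n}" and VC: "verts C = p' ` {..<n}"
    and EC: "edges C = (\<lambda>i. {p' i, p' (Suc i mod n)}) ` {..<n}" and pos: "\<forall>e\<in>edges C. 0 < elen C e"
    using C' by (auto simp: polygon_def)
  obtain m where m: "n = Suc m" "2 \<le> m" using n by (cases n) auto
  have p0: "p' 0 = p (Suc j mod n)" by (simp add: p'_def)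
  have pm: "p' m = p j"
  proof -
    have "(m + Suc j mod n) mod n = (m + Suc j) mod n" by (simp add: mod_add_right_eq)
    also have "m + Suc j = n + j" using m by simp
    finally show ?thesis using j by (simp add: p'_def)
  qed
  have e: "e = {p' 0, p' m}" using j p0 pm by (simp add: insert_commute)
  have VI: "p' 0 \<in> V" "p' m \<in> V" using I(1) e by auto
  have mg: "metric_graph (with_len G V E)" using built_invariants[OF built] by blast
  have pne: "p' i = p' k \<Longrightarrow> i = k" if "i < n" "k < n" for i k using inj_onD[OF inj, of i k] that by simp
  have nw: "p' i \<notin> V" if "1 \<le> i" "i < m" for i
  proof
    assume "p' i \<in> V"
    then have "p' i \<in> e" using I(1) VC that m by auto
    then show False using e pne[of i 0] pne[of i m] that m by auto
  qed
  have edge: "{p' i, p' (Suc i)} \<in> edges C" if "i < m" for i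
    using EC that m by (auto intro!: image_eqI[of _ _ i])
  have EC': "edges C = insert e ((\<lambda>i. {p' i, p' (Suc i)}) ` {..<m})"
  proof -
    have "(\<lambda>i. {p' i, p' (Suc i mod n)}) ` {..<m} = (\<lambda>i. {p' i, p' (Suc i)}) ` {..<m}"
      using m by (intro image_cong) auto
    then show ?thesis unfolding EC m(1) lessThan_Suc using e m by (simp add: insert_commute)
  qed
  have ap: "attached_path (with_len G V E) (with_len G (V \<union> verts C) (E \<union> edges C)) p' m"
  proof
    show "inj_on p' {1..<m}" using pne m by (auto simp: inj_on_def)
    show "p' ` {1..<m} \<inter> verts (with_len G V E) = {}" using nw by auto
    have "verts C = insert (p' 0) (p' ` {1..m})"
    proof -
      have "{..<n} = insert 0 {1..m}" using m by auto
      then show ?thesis using VC by simp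
    qed
    then show "verts (with_len G (V \<union> verts C) (E \<union> edges C)) = verts (with_len G V E) \<union> p' ` {1..m}"
      using VI by auto
    show "edges (with_len G (V \<union> verts C) (E \<union> edges C)) =
        edges (with_len G V E) \<union> (\<lambda>i. {p' i, p' (Suc i)}) ` {..<m}"
      using EC' I(2) by auto
    show "0 < elen (with_len G (V \<union> verts C) (E \<union> edges C)) {p' i, p' (Suc i)}" if "i < m" for i
      using edge[OF that] len pos by auto
    show "p' m = p' 0 \<Longrightarrow> 3 \<le> m" using pne[of m 0] m by auto
  qed (use mg VI m in \<open>auto simp: metric_subgraph_def\<close>)
  have sum: "graph_length C = (\<Sum>i<m. elen G {p' i, p' (Suc i)}) + elen G {p' 0, p' m}"
  proof -
    have "(\<Sum>i<m. elen C {p' i, p' (Suc i mod n)}) = (\<Sum>i<m. elen G {p' i, p' (Suc i)})"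
      using m edge len by (intro sum.cong) auto
    moreover have "elen C {p' m, p' (Suc m mod n)} = elen G {p' 0, p' m}"
      using len[OF I(3)] e m by (simp add: insert_commute)
    ultimately show ?thesis unfolding polygon_length[OF C'] by (simp add: m(1))
  qed
  have ne: "p' 0 \<noteq> p' m" using pne[of 0 m] m by auto
  show ?thesis
  proof (rule built.ear[OF built ap])
    show "p' 0 = p' m \<or> {p' 0, p' m} \<in> B \<and> {p' 0, p' m} \<in> edges (with_len G V E) \<and>
      2 * elen (with_len G V E) {p' 0, p' m}
      < (\<Sum>i<m. elen (with_len G (V \<union> verts C) (E \<union> edges C)) {p' i, p' (Suc i)})"
      using I e sum short[OF I(3,4)] by simp
  qed (use VI ne sum edge short in auto)
qed

text \<open>A cycle becomes one ear, a tree a sequence of leaves. For a tree glued along an edge,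
  that edge is already in \<open>E\<close>, so the growth starts from both of its endpoints.\<close>

lemma attach_piece:
  assumes piece: "metric_tree P \<or> metric_cycle P" and iso: "mgraph_iso P P'"
    and built: "built B ls (with_len G V E)" and sub: "metric_subgraph P' G"
    and I: "(\<exists>v. V \<inter> verts P' = {v}) \<or> (V \<inter> verts P' \<in> E \<and> V \<inter> verts P' \<in> edges P' \<and> V \<inter> verts P' \<in> B)"
    and short: "\<forall>e\<in>B. \<forall>C. metric_subgraph C G \<and> metric_cycle C \<and> realization C \<inter> closed_edge G e \<noteq> {}
           \<longrightarrow> elen G e < 1 / 3 * graph_length C"
  shows "built B (if metric_cycle P then graph_length P # ls else ls)
    (with_len G (V \<union> verts P') (E \<union> edges P'))"
proof (cases "metric_cycle P")
  case True
  obtain p n where P: "polygon P p n" using metric_cycle_polygon[OF True] .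
  obtain p' where P': "polygon P' p' n" and l: "graph_length P' = graph_length P"
    using mgraph_iso_polygon[OF P iso] .
  have cyc: "metric_cycle P'" by (rule polygon_metric_cycle[OF P'])
  have wf: "wf_graph P'" using cyc unfolding metric_cycle_def by (blast intro: metric_graph_wf)
  have len: "elen G e = elen P' e" if "e \<in> edges P'" for e using sub that by (simp add: metric_subgraph_def)
  have sh: "3 * elen G e < graph_length P'" if e: "e \<in> edges P'" "e \<in> B" for e
  proof -
    \<comment> \<open>An endpoint of \<open>e\<close> lies on the copy \<open>P'\<close> and on the
      closed edge, so the bound for cycles that meet \<open>e\<close> applies to \<open>P'\<close>
      itself.\<close>
    obtain u w where uw: "e = {u, w}" "u \<in> verts P'" using wf_graph_edge_cases[OF wf e(1)] by metis
    have "vertex_point u \<in> realization P'" using uw wf by simp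
    moreover from this have "vertex_point u \<in> closed_edge G e"
      using metric_subgraph_realization[OF sub] uw by (auto simp: closed_edge_def)
    ultimately have "elen G e < 1 / 3 * graph_length P'" using short e(2) sub cyc by blast
    then show ?thesis by simp
  qed
  show ?thesis
    using I
  proof
    assume "\<exists>v. V \<inter> verts P' = {v}"
    then obtain v where "V \<inter> verts P' = {v}" by blast
    then show ?thesis using attach_cycle_vertex[OF P' built len _ sh] True l by simp
  next
    assume "V \<inter> verts P' \<in> E \<and> V \<inter> verts P' \<in> edges P' \<and> V \<inter> verts P' \<in> B"
    then show ?thesis using attach_cycle_edge[OF P' built len HOL.refl _ _ _ sh] True l by simp
  qed
next
  case False
  then have T: "tree_like P'" using piece mgraph_iso_tree_like[OF metric_tree_tree_like iso] by blast
  then have wf: "wf_graph P'" by (simp add: tree_like_def)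
  have pos: "0 < elen G e" if "e \<in> edges P'" for e
    using sub wf that by (auto simp: metric_subgraph_def wf_graph_def)
  let ?I = "V \<inter> verts P'"
  have "built B ls (with_len G (V \<union> verts P') (E \<union> edges P'))"
  proof (rule attach_tree[OF T built pos HOL.refl])
    have c2: "card e = 2" if "e \<in> edges P'" for e using wf that by (simp add: wf_graph_def)
    show "?I \<noteq> {}" using I c2 by force
    show "{e \<in> edges P'. e \<subseteq> ?I} \<subseteq> E"
    proof
      fix e assume e: "e \<in> {e \<in> edges P'. e \<subseteq> ?I}"
      show "e \<in> E" using I
      proof
        assume "\<exists>v. ?I = {v}"
        then have "card e \<le> 1" using e card_mono[of ?I e] by auto
        then show ?thesis using c2[of e] e by simp
      next
        assume i: "?I \<in> E \<and> ?I \<in> edges P' \<and> ?I \<in> B"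
        have "finite ?I" using wf by (simp add: wf_graph_def)
        then have "e = ?I" using card_subset_eq[of ?I e] c2[of e] c2[of ?I] e i by auto
        then show ?thesis using i by simp
      qed
    qed
    show "walk_connected {e \<in> edges P'. e \<subseteq> ?I} ?I"
      using I
    proof
      assume "\<exists>v. ?I = {v}"
      then obtain v where v: "?I = {v}" by blast
      show ?thesis unfolding v by (rule walk_connected_singleton)
    next
      assume i: "?I \<in> E \<and> ?I \<in> edges P' \<and> ?I \<in> B"
      then obtain u w where uw: "?I = {u, w}" "u \<noteq> w" using wf_graph_edge_cases[OF wf] by metis
      have "walk_connected {} {u}" by (rule walk_connected_singleton)
      then have "walk_connected {e \<in> edges P'. e \<subseteq> ?I} {w, u}"
        by (rule walk_connected_insert[of _ _ u]) (use i uw in auto)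
      then show ?thesis using uw by (simp add: insert_commute)
    qed
  qed
  then show ?thesis using False by simp
qed

section \<open>Following the assembly, and the count of points\<close>

lemma metric_subgraph_union:
  assumes "metric_subgraph (mgraph_union H P) G"
  shows "metric_subgraph H G"
    and "(\<And>e. e \<in> edges P \<Longrightarrow> e \<in> edges H \<Longrightarrow> elen P e = elen H e) \<Longrightarrow> metric_subgraph P G"
proof -
  have len: "(if e \<in> edges H then elen H e else elen P e) = elen G e" if "e \<in> edges H \<union> edges P" for e
    using assms that unfolding metric_subgraph_def mgraph_union_def by simp
  have sub: "verts H \<union> verts P \<subseteq> verts G" "edges H \<union> edges P \<subseteq> edges G"
    using assms unfolding metric_subgraph_def mgraph_union_def by simp_all
  show "metric_subgraph H G" using len sub unfolding metric_subgraph_def by fastforce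
  assume eq: "\<And>e. e \<in> edges P \<Longrightarrow> e \<in> edges H \<Longrightarrow> elen P e = elen H e"
  have "elen P e = elen G e" if "e \<in> edges P" for e
    using len[of e] eq[OF that] that by (cases "e \<in> edges H") simp_all
  then show "metric_subgraph P G" using sub unfolding metric_subgraph_def by blast
qed

lemma with_len_union:
  "with_len G (verts H \<union> verts P) (edges H \<union> edges P) =
    with_len G (verts (mgraph_union H P)) (edges (mgraph_union H P))"
  by (simp add: mgraph_union_def)

lemma mgraph_iso_piece_wf:
  assumes "metric_tree P \<or> metric_cycle P" "mgraph_iso P P'"
  shows "wf_graph P'"
proof -
  have "wf_graph P" using assms(1) metric_graph_wf by (auto simp: metric_tree_def metric_cycle_def)
  moreover obtain f where "iso_by f P P'" using assms(2) mgraph_iso_iff by blast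
  ultimately show ?thesis using mgraph_iso_wf[OF iso_byD] by blast
qed

text \<open>The final graph \<open>G\<close> and the set \<open>B\<close> stay fixed while the stage
  \<open>H\<close> and its gluing edges \<open>A\<close> grow, so the bound on cycles of
  \<open>G\<close> is available at every stage.\<close>

lemma assembled_built:
  assumes "assembled Ps A H" "A \<subseteq> B" "metric_subgraph H G"
    and "\<forall>P\<in>set Ps. metric_tree P \<or> metric_cycle P"
    and short: "\<forall>e\<in>B. \<forall>C. metric_subgraph C G \<and> metric_cycle C \<and> realization C \<inter> closed_edge G e \<noteq> {}
           \<longrightarrow> elen G e < 1 / 3 * graph_length C"
  shows "\<exists>ls. mset ls = mset (map graph_length (filter metric_cycle Ps)) \<and>
    built B ls (with_len G (verts H) (edges H))"
  using assms(1-4)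
proof (induction rule: assembled.induct)
  case (start P P')
  have piece: "metric_tree P \<or> metric_cycle P" using start.prems(3) by simp
  have "verts P' \<noteq> {}" using mgraph_iso_piece_wf[OF piece start.hyps] by (simp add: wf_graph_def)
  then obtain v where v: "v \<in> verts P'" by blast
  \<comment> \<open>The first piece is treated as glued to one of its own vertices.\<close>
  have b: "built B [] (with_len G {v} {})" by (rule built.point) simp_all
  have "\<exists>x. {v} \<inter> verts P' = {x}" using v by blast
  then have "built B (if metric_cycle P then graph_length P # [] else [])
      (with_len G ({v} \<union> verts P') ({} \<union> edges P'))"
    using attach_piece[OF piece start.hyps b start.prems(2) _ short] by blast
  moreover have "{v} \<union> verts P' = verts P'" using v by blast
  ultimately show ?case by (intro exI[of _ "if metric_cycle P then [graph_length P] else []"]) simp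
next
  case (glue_vertex Ps A H P P' v)
  have piece: "metric_tree P \<or> metric_cycle P" using glue_vertex.prems(3) by simp
  note U = metric_subgraph_union[OF glue_vertex.prems(2)]
  have "\<forall>P\<in>set Ps. metric_tree P \<or> metric_cycle P" using glue_vertex.prems(3) by simp
  then obtain ls where ls: "mset ls = mset (map graph_length (filter metric_cycle Ps))"
      "built B ls (with_len G (verts H) (edges H))"
    using glue_vertex.IH[OF glue_vertex.prems(1) U(1)] by blast
  have wfH: "wf_graph (with_len G (verts H) (edges H))"
    using built_invariants[OF ls(2)] metric_graph_wf by blast
  have wfP: "wf_graph P'" by (rule mgraph_iso_piece_wf[OF piece glue_vertex.hyps(2)])
  have disj: "e \<notin> edges H" if "e \<in> edges P'" for e
  proof
    assume "e \<in> edges H"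
    then have "e \<subseteq> verts H" "e \<subseteq> verts P'" using wfH wfP that unfolding wf_graph_def by simp_all
    then have "e \<subseteq> {v}" using glue_vertex.hyps(3) by blast
    then have "card e \<le> 1" using card_mono[of "{v}" e] by simp
    moreover have "card e = 2" using wfP that by (simp add: wf_graph_def)
    ultimately show False by simp
  qed
  have sub: "metric_subgraph P' G" by (rule U(2)) (use disj in blast)
  have "\<exists>v. verts H \<inter> verts P' = {v}" using glue_vertex.hyps(3) by blast
  then have "built B (if metric_cycle P then graph_length P # ls else ls)
      (with_len G (verts H \<union> verts P') (edges H \<union> edges P'))"
    using attach_piece[OF piece glue_vertex.hyps(2) ls(2) sub _ short] by blast
  then show ?case unfolding with_len_union using ls(1)
    by (intro exI[of _ "if metric_cycle P then graph_length P # ls else ls"]) simp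
next
  case (glue_edge Ps A H P P' e)
  have piece: "metric_tree P \<or> metric_cycle P" using glue_edge.prems(3) by simp
  note U = metric_subgraph_union[OF glue_edge.prems(2)]
  have "\<forall>P\<in>set Ps. metric_tree P \<or> metric_cycle P" "A \<subseteq> B" using glue_edge.prems by simp_all
  then obtain ls where ls: "mset ls = mset (map graph_length (filter metric_cycle Ps))"
      "built B ls (with_len G (verts H) (edges H))"
    using glue_edge.IH[OF _ U(1)] by blast
  have wfH: "wf_graph (with_len G (verts H) (edges H))"
    using built_invariants[OF ls(2)] metric_graph_wf by blast
  have wfP: "wf_graph P'" by (rule mgraph_iso_piece_wf[OF piece glue_edge.hyps(2)])
  have only: "e' = e" if "e' \<in> edges P'" "e' \<in> edges H" for e'
  proof -
    have "e' \<subseteq> verts H" "e' \<subseteq> verts P'" using wfH wfP that unfolding wf_graph_def by simp_all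
    then have "e' \<subseteq> e" using glue_edge.hyps(3) by blast
    moreover have "card e' = 2" "card e = 2" using wfP that glue_edge.hyps(5) by (simp_all add: wf_graph_def)
    ultimately show ?thesis using card_subset_eq[of e e'] by (simp add: card_ge_0_finite)
  qed
  have sub: "metric_subgraph P' G" by (rule U(2)) (use only glue_edge.hyps(6) in force)
  have "verts H \<inter> verts P' \<in> edges H \<and> verts H \<inter> verts P' \<in> edges P' \<and> verts H \<inter> verts P' \<in> B"
    using glue_edge.hyps(3-5) glue_edge.prems(1) by simp
  then have "built B (if metric_cycle P then graph_length P # ls else ls)
      (with_len G (verts H \<union> verts P') (edges H \<union> edges P'))"
    using attach_piece[OF piece glue_edge.hyps(2) ls(2) sub _ short] by blast
  then show ?case unfolding with_len_union using ls(1)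
    by (intro exI[of _ "if metric_cycle P then graph_length P # ls else ls"]) simp
qed

lemma metric_tree_not_cycle: "metric_tree T \<Longrightarrow> \<not> metric_cycle T"
  unfolding metric_tree_def metric_subgraph_def by blast

theorem proposition7p10:
  fixes Ts Cs Ps :: "'a mgraph list" and G :: "'a mgraph" and A :: "'a set set"
  assumes "\<forall>T\<in>set Ts. metric_tree T"
    and "\<forall>C\<in>set Cs. metric_cycle C"
    and "distinct (map graph_length Cs)"
    and "mset Ps = mset (Ts @ Cs)"
    and "assembled Ps A G"
    and "\<forall>e\<in>A. \<forall>C. metric_subgraph C G \<and> metric_cycle C \<and> realization C \<inter> closed_edge G e \<noteq> {}
           \<longrightarrow> elen G e < 1 / 3 * graph_length C"
  shows "let S = {(tb, td). (tb, td) \<in> vr_persistence_set TYPE('f::field) 4 1 (graph_dist G) (realization G)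
                   \<and> (\<exists>l. (tb, td) = (l / 2, l))}
         in finite S \<and> betti1 G = card S"
proof -
  let ?D = "vr_persistence_set TYPE('f) 4 1 (graph_dist G) (realization G)"
  have "set Ps = set Ts \<union> set Cs" using mset_eq_setD[OF assms(4)] by simp
  then have "\<forall>P\<in>set Ps. metric_tree P \<or> metric_cycle P" using assms(1,2) by blast
  moreover have "metric_subgraph G G" by (simp add: metric_subgraph_def)
  ultimately obtain ls where ls: "mset ls = mset (map graph_length (filter metric_cycle Ps))"
      "built A ls (with_len G (verts G) (edges G))"
    using assembled_built[OF assms(5) subset_refl _ _ assms(6)] by blast
  have "\<forall>T\<in>set Ts. \<not> metric_cycle T" using assms(1) metric_tree_not_cycle by blast
  then have "filter metric_cycle Ts = []" by (simp add: filter_empty_conv)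
  moreover have "filter metric_cycle Cs = Cs" using assms(2) by (simp add: filter_id_conv)
  moreover have "mset (filter metric_cycle Ps) = mset (filter metric_cycle (Ts @ Cs))"
    using assms(4) by (metis mset_filter)
  ultimately have "mset ls = mset (map graph_length Cs)" using ls(1) by simp
  then have dist: "distinct ls" using assms(3) by (metis mset_eq_imp_distinct_iff)
  have "with_len G (verts G) (edges G) = G" by (simp add: with_len_def)
  then have built: "built A ls G" using ls(2) by (simp only:)
  have inv: "metric_graph G" "cycle_rank G (length ls)" "\<And>s. 0 < s \<Longrightarrow> has_square G s \<longleftrightarrow> 4 * s \<in> set ls"
    using built_invariants[OF built] by simp_all
  have pos: "0 < l" if "l \<in> set ls" for l
  proof -
    have "l \<in> set (map graph_length Cs)"
      using that \<open>mset ls = mset (map graph_length Cs)\<close> mset_eq_setD by metis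
    then obtain C where C: "C \<in> set Cs" "l = graph_length C" by auto
    then obtain p n where P: "polygon C p n" using metric_cycle_polygon assms(2) by blast
    then have "0 < n" "\<And>i. i < n \<Longrightarrow> 0 < elen C {p i, p (Suc i mod n)}" by (auto simp: polygon_def)
    then show ?thesis unfolding C(2) polygon_length[OF P] by (intro sum_pos) auto
  qed
  define S where "S = {(tb, td). (tb, td) \<in> ?D \<and> (\<exists>l. (tb, td) = (l / 2, l))}"
  \<comment> \<open>A cycle of length \<open>l\<close> gives squares of side \<open>l / 4\<close>
    and diagonal \<open>l / 2\<close>. The parameter of a point of \<open>S\<close> is its death
    time, so it corresponds to half a cycle length.\<close>
  have "S = (\<lambda>l. (l / 4, l / 2)) ` set ls"
  proof (intro set_eqI iffI)
    fix x assume "x \<in> S"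
    then obtain l where l: "x = (l / 2, 2 * (l / 2))" "(l / 2, 2 * (l / 2)) \<in> ?D" by (auto simp: S_def)
    then have "0 < l / 2" "has_square G (l / 2)" using vr_persistence_set_square[OF inv(1)] by blast+
    then have "4 * (l / 2) \<in> set ls" using inv(3) by blast
    then show "x \<in> (\<lambda>l. (l / 4, l / 2)) ` set ls" using l(1) by (intro image_eqI[of _ _ "4 * (l / 2)"]) auto
  next
    fix x assume "x \<in> (\<lambda>l. (l / 4, l / 2)) ` set ls"
    then obtain l where l: "l \<in> set ls" "x = (l / 4, 2 * (l / 4))" by auto
    have "0 < l / 4" using pos[OF l(1)] by simp
    moreover from this have "has_square G (l / 4)" using inv(3) l(1) by simp
    ultimately have "(l / 4, 2 * (l / 4)) \<in> ?D" using vr_persistence_set_square[OF inv(1)] by blast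
    then show "x \<in> S" unfolding S_def l(2) by (auto intro!: exI[of _ "l / 2"])
  qed
  moreover have "inj_on (\<lambda>l::real. (l / 4, l / 2)) (set ls)" by (auto simp: inj_on_def)
  ultimately have "finite S" "card S = length ls"
    using distinct_card[OF dist] by (simp_all add: card_image)
  then show ?thesis
    using betti1_eq[OF metric_graph_wf[OF inv(1)] inv(2)] unfolding Let_def S_def by simp
qed

end
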